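(* Let $G=\mathbb{Z}_{p^3}\times\mathbb{Z}_2$ for an odd prime $p$, let $S$ be a proper subset of $G\setminus\{0\}$ that generates $G$, and let $S_0=S\cup\{0\}$. Let $0\in C\subseteq G$. Then $C$ is a perfect code in $\mathrm{Cay}(G,S)$ if and only if, for some integer parameters, $(S_0,C)$ is one of the following pairs: (1) $S_0=\{(i+\alpha_ip,\alpha_i)\mid i\in[p]\}$, $C=\{(ip,j)\mid i\in[p^2],j\in[2]\}$; (2) $S_0=\{(\alpha_i,i)\mid i\in[2]\}$, $C=\{(i,0)\mid i\in[p^3]\}$; (3) $S_0=\{(i+\alpha_ip+jp^2,\alpha_i)\mid i,j\in[p]\}$, $C=\{(ip+\lambda_{ij}p^2,j)\mid i\in[p],j\in[2]\}$; (4) $S_0=\{(i+\alpha_ip+jp^2,\alpha_{ij})\mid i,j\in[p]\}$, $C=\{(ip+\lambda_ip^2,j)\mid i\in[p],j\in[2]\}$; (5) $S_0=\{(i+jp+\alpha_{ij}p^2,\alpha_i)\mid i,j\in[p]\}$, $C=\{(\lambda_ip+jp^2,i)\mid i\in[2],j\in[p]\}$; (6) $S_0=\{(i+\alpha_ip^2,\alpha_i)\mid i\in[p^2]\}$, $C=\{(ip^2,j)\mid i\in[p],j\in[2]\}$; (7) $S_0=\{(i+\alpha_ip,j)\mid i\in[p],j\in[2]\}$, $C=\{(ip,\lambda_i)\mid i\in[p^2]\}$; (8) $S_0=\{(\alpha_i+jp^2,i)\mid i\in[2],j\in[p]\}$, $C=\{(i+\lambda_ip^2,0)\mid i\in[p^2]\}$;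 (9) $S_0=\{(i+\alpha_ip+\alpha_{ij}p^2,j)\mid i\in[p],j\in[2]\}$, $C=\{(ip+jp^2,\lambda_i)\mid i,j\in[p]\}$; (10) $S_0=\{(\alpha_i+jp+\alpha_{ij}p^2,i)\mid i\in[2],j\in[p]\}$, $C=\{(i+\lambda_ip+jp^2,0)\mid i,j\in[p]\}$; (11) $S_0=\{(i+\alpha_{ij}p,j)\mid i\in[p],j\in[2]\}$, $C=\{(ip,0)\mid i\in[p^2]\}$; (12) $S_0=\{(i+jp^2,\alpha_i)\mid i\in[p^2],j\in[p]\}$, $C=\{(\lambda_ip^2,i)\mid i\in[2]\}$; (13) $S_0=\{(i+jp,\alpha_i)\mid i\in[p],j\in[p^2]\}$, $C=\{(\lambda_ip,i)\mid i\in[2]\}$; (14) $S_0=\{(i,\alpha_i)\mid i\in[p^3]\}$, $C=\{(0,i)\mid i\in[2]\}$; (15) $S_0=\{(i+\alpha_ip^2,j)\mid i\in[p^2],j\in[2]\}$, $C=\{(ip^2,\lambda_i)\mid i\in[p]\}$; (16) $S_0=\{(i+\alpha_{ik}p+jp^2,k)\mid i,j\in[p],k\in[2]\}$, $C=\{(ip+\lambda_ip^2,0)\mid i\in[p]\}$; (17) $S_0=\{(i+\alpha_ip+jp^2,k)\mid i,j\in[p],k\in[2]\}$, $C=\{(ip+\lambda_ip^2,\lambda_i)\mid i\in[p]\}$; (18) $S_0=\{(\alpha_i+jp,i)\mid i\in[2],j\in[p^2]\}$, $C=\{(i+\lambda_ip,0)\mid i\in[p]\}$; (19) $S_0=\{(i+\alpha_{ij}p^2,j)\mid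 i\in[p^2],j\in[2]\}$, $C=\{(ip^2,0)\mid i\in[p]\}$.
   Context: Groups are finite abelian, written additively; $\mathbb{Z}_n$ is the group of integers modulo $n$ and $[n]=\{0,1,\dots,n-1\}$; integers in coordinates are read modulo the relevant modulus. For $S\subseteq G\setminus\{0\}$, $\mathrm{Cay}(G,S)$ is the directed graph with vertex set $G$ and an arc from $x$ to $y$ if and only if $y-x\in S$ ($S$ is not assumed to be inverse-closed). A subset $C\subseteq G$ is a perfect code in $\mathrm{Cay}(G,S)$ if the sets $\{c\}\cup\{v:\text{there is an arc from } c \text{ to } v\}$, $c\in C$, form a partition of $G$. Greek letters with subscripts denote arbitrary integers, one for each value of the displayed indices, subject only to being $0$ when all subscripts are $0$; different letters (or index patterns) denote independent families, and an integer occurring several times in one element is the same integer each time. *)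

theory Defs
  imports
    "HOL-Algebra.Elementary_Groups"
    "HOL-Computational_Algebra.Primes"
    "HOL-Library.Disjoint_Sets"
    "Graph_Theory.Pair_Digraph"
begin

text \<open>
  Groups of HOL-Algebra are written multiplicatively, so \<open>y \<otimes> inv x\<close> is the difference \<open>y - x\<close>
  and \<open>\<one>\<close> is the zero element of the additive notation.
\<close>

definition cayley_digraph :: "('a, 'b) monoid_scheme \<Rightarrow> 'a set \<Rightarrow> 'a pair_pre_digraph" where
  "cayley_digraph G S =
     \<lparr> pverts = carrier G,
       parcs = {(x, y). x \<in> carrier G \<and> y \<in> carrier G \<and> y \<otimes>\<^bsub>G\<^esub> inv\<^bsub>G\<^esub> x \<in> S} \<rparr>"

definition closed_out_nbhd :: "'a pair_pre_digraph \<Rightarrow> 'a \<Rightarrow> 'a set" where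
  "closed_out_nbhd D c = insert c {v. (c, v) \<in> parcs D}"

text \<open>
  The partition is that of an indexed family: distinct code words have disjoint closed
  out-neighbourhoods. (Applying \<^const>\<open>partition_on\<close> to the set of these neighbourhoods would
  identify code words that have the same neighbourhood.)
\<close>

definition perfect_code :: "'a pair_pre_digraph \<Rightarrow> 'a set \<Rightarrow> bool" where
  "perfect_code D C \<longleftrightarrow>
     C \<subseteq> pverts D \<and>
     disjoint_family_on (closed_out_nbhd D) C \<and>
     (\<Union>c\<in>C. closed_out_nbhd D c) = pverts D"

definition Z_p3_2 :: "nat \<Rightarrow> (int \<times> int) monoid" where
  "Z_p3_2 p = integer_mod_group (p ^ 3) \<times>\<times> integer_mod_group 2"

text \<open>
  The carrier of \<^term>\<open>integer_mod_group n\<close> is \<^term>\<open>{0..<int n}\<close> for \<open>n > 0\<close>; \<open>elt p x y\<close> is the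
  element of \<^term>\<open>Z_p3_2 p\<close> whose coordinates are the residues of the integers \<open>x\<close> and \<open>y\<close>.
\<close>

definition elt :: "nat \<Rightarrow> int \<Rightarrow> int \<Rightarrow> int \<times> int" where
  "elt p x y = (x mod int p ^ 3, y mod 2)"

text \<open>
  \<open>listed_pair p S\<^sub>0 C\<close> says that \<open>(S\<^sub>0, C)\<close> is one of the nineteen pairs, for some choice of the
  parameters. Each letter is a family of integers that vanishes when all its indices are \<open>0\<close>:
  \<open>a\<close> is \<open>\<alpha>\<close> with one index, \<open>b\<close> is \<open>\<alpha>\<close> with two indices (in the order in which they are
  displayed), and \<open>l\<close> is \<open>\<lambda>\<close>.
\<close>

inductive listed_pair :: "nat \<Rightarrow> (int \<times> int) set \<Rightarrow> (int \<times> int) set \<Rightarrow> bool" for p :: nat where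
  pair1: "a 0 = 0 \<Longrightarrow>
    listed_pair p
      {elt p (i + a i * int p) (a i) | i. i \<in> {0..<int p}}
      {elt p (i * int p) j | i j. i \<in> {0..<(int p)\<^sup>2} \<and> j \<in> {0..<2}}"
| pair2: "a 0 = 0 \<Longrightarrow>
    listed_pair p
      {elt p (a i) i | i. i \<in> {0..<2}}
      {elt p i 0 | i. i \<in> {0..<int p ^ 3}}"
| pair3: "a 0 = 0 \<Longrightarrow> l 0 0 = 0 \<Longrightarrow>
    listed_pair p
      {elt p (i + a i * int p + j * (int p)\<^sup>2) (a i) | i j. i \<in> {0..<int p} \<and> j \<in> {0..<int p}}
      {elt p (i * int p + l i j * (int p)\<^sup>2) j | i j. i \<in> {0..<int p} \<and> j \<in> {0..<2}}"
| pair4: "a 0 = 0 \<Longrightarrow> b 0 0 = 0 \<Longrightarrow> l 0 = 0 \<Longrightarrow>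
    listed_pair p
      {elt p (i + a i * int p + j * (int p)\<^sup>2) (b i j) | i j. i \<in> {0..<int p} \<and> j \<in> {0..<int p}}
      {elt p (i * int p + l i * (int p)\<^sup>2) j | i j. i \<in> {0..<int p} \<and> j \<in> {0..<2}}"
| pair5: "a 0 = 0 \<Longrightarrow> b 0 0 = 0 \<Longrightarrow> l 0 = 0 \<Longrightarrow>
    listed_pair p
      {elt p (i + j * int p + b i j * (int p)\<^sup>2) (a i) | i j. i \<in> {0..<int p} \<and> j \<in> {0..<int p}}
      {elt p (l i * int p + j * (int p)\<^sup>2) i | i j. i \<in> {0..<2} \<and> j \<in> {0..<int p}}"
| pair6: "a 0 = 0 \<Longrightarrow>
    listed_pair p
      {elt p (i + a i * (int p)\<^sup>2) (a i) | i. i \<in> {0..<(int p)\<^sup>2}}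
      {elt p (i * (int p)\<^sup>2) j | i j. i \<in> {0..<int p} \<and> j \<in> {0..<2}}"
| pair7: "a 0 = 0 \<Longrightarrow> l 0 = 0 \<Longrightarrow>
    listed_pair p
      {elt p (i + a i * int p) j | i j. i \<in> {0..<int p} \<and> j \<in> {0..<2}}
      {elt p (i * int p) (l i) | i. i \<in> {0..<(int p)\<^sup>2}}"
| pair8: "a 0 = 0 \<Longrightarrow> l 0 = 0 \<Longrightarrow>
    listed_pair p
      {elt p (a i + j * (int p)\<^sup>2) i | i j. i \<in> {0..<2} \<and> j \<in> {0..<int p}}
      {elt p (i + l i * (int p)\<^sup>2) 0 | i. i \<in> {0..<(int p)\<^sup>2}}"
| pair9: "a 0 = 0 \<Longrightarrow> b 0 0 = 0 \<Longrightarrow> l 0 = 0 \<Longrightarrow>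
    listed_pair p
      {elt p (i + a i * int p + b i j * (int p)\<^sup>2) j | i j. i \<in> {0..<int p} \<and> j \<in> {0..<2}}
      {elt p (i * int p + j * (int p)\<^sup>2) (l i) | i j. i \<in> {0..<int p} \<and> j \<in> {0..<int p}}"
| pair10: "a 0 = 0 \<Longrightarrow> b 0 0 = 0 \<Longrightarrow> l 0 = 0 \<Longrightarrow>
    listed_pair p
      {elt p (a i + j * int p + b i j * (int p)\<^sup>2) i | i j. i \<in> {0..<2} \<and> j \<in> {0..<int p}}
      {elt p (i + l i * int p + j * (int p)\<^sup>2) 0 | i j. i \<in> {0..<int p} \<and> j \<in> {0..<int p}}"
| pair11: "b 0 0 = 0 \<Longrightarrow>
    listed_pair p
      {elt p (i + b i j * int p) j | i j. i \<in> {0..<int p} \<and> j \<in> {0..<2}}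
      {elt p (i * int p) 0 | i. i \<in> {0..<(int p)\<^sup>2}}"
| pair12: "a 0 = 0 \<Longrightarrow> l 0 = 0 \<Longrightarrow>
    listed_pair p
      {elt p (i + j * (int p)\<^sup>2) (a i) | i j. i \<in> {0..<(int p)\<^sup>2} \<and> j \<in> {0..<int p}}
      {elt p (l i * (int p)\<^sup>2) i | i. i \<in> {0..<2}}"
| pair13: "a 0 = 0 \<Longrightarrow> l 0 = 0 \<Longrightarrow>
    listed_pair p
      {elt p (i + j * int p) (a i) | i j. i \<in> {0..<int p} \<and> j \<in> {0..<(int p)\<^sup>2}}
      {elt p (l i * int p) i | i. i \<in> {0..<2}}"
| pair14: "a 0 = 0 \<Longrightarrow>
    listed_pair p
      {elt p i (a i) | i. i \<in> {0..<int p ^ 3}}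
      {elt p 0 i | i. i \<in> {0..<2}}"
| pair15: "a 0 = 0 \<Longrightarrow> l 0 = 0 \<Longrightarrow>
    listed_pair p
      {elt p (i + a i * (int p)\<^sup>2) j | i j. i \<in> {0..<(int p)\<^sup>2} \<and> j \<in> {0..<2}}
      {elt p (i * (int p)\<^sup>2) (l i) | i. i \<in> {0..<int p}}"
| pair16: "b 0 0 = 0 \<Longrightarrow> l 0 = 0 \<Longrightarrow>
    listed_pair p
      {elt p (i + b i k * int p + j * (int p)\<^sup>2) k | i j k. i \<in> {0..<int p} \<and> j \<in> {0..<int p} \<and> k \<in> {0..<2}}
      {elt p (i * int p + l i * (int p)\<^sup>2) 0 | i. i \<in> {0..<int p}}"
| pair17: "a 0 = 0 \<Longrightarrow> l 0 = 0 \<Longrightarrow>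
    listed_pair p
      {elt p (i + a i * int p + j * (int p)\<^sup>2) k | i j k. i \<in> {0..<int p} \<and> j \<in> {0..<int p} \<and> k \<in> {0..<2}}
      {elt p (i * int p + l i * (int p)\<^sup>2) (l i) | i. i \<in> {0..<int p}}"
| pair18: "a 0 = 0 \<Longrightarrow> l 0 = 0 \<Longrightarrow>
    listed_pair p
      {elt p (a i + j * int p) i | i j. i \<in> {0..<2} \<and> j \<in> {0..<(int p)\<^sup>2}}
      {elt p (i + l i * int p) 0 | i. i \<in> {0..<int p}}"
| pair19: "b 0 0 = 0 \<Longrightarrow>
    listed_pair p
      {elt p (i + b i j * (int p)\<^sup>2) j | i j. i \<in> {0..<(int p)\<^sup>2} \<and> j \<in> {0..<2}}
      {elt p (i * (int p)\<^sup>2) 0 | i. i \<in> {0..<int p}}"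

end

theory Submission
  imports Defs Complex_Main "HOL-Computational_Algebra.Polynomial" "HOL-Library.Product_Plus"
begin

text \<open>
  A set \<open>C\<close> is a perfect code in the Cayley digraph of \<open>S\<close> exactly when every element of the group
  is in a unique way a sum of an element of \<open>S\<^sub>0 = S \<union> {0}\<close> and an element of \<open>C\<close>
  (\<open>perfect_code_iff_tiles\<close>). The theorem therefore classifies the factorizations
  \<open>G = S\<^sub>0 + C\<close> of the cyclic group \<open>G = \<int>\<^sub>m \<times> \<int>\<^sub>2\<close>, \<open>m = p\<^sup>3\<close>, in which \<open>S\<^sub>0\<close> generates \<open>G\<close>.

  The heart of the matter is that in a factorization \<open>A + B\<close> of \<open>\<int>\<^sub>N \<times> \<int>\<^sub>2\<close>, with \<open>N > 1\<close> a power of \<open>p\<close>,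
  one of the two factors is a union of cosets of a subgroup of prime order (\<open>periodic_factor\<close>).
  For a character of order \<open>N\<close> or \<open>2N\<close> the product of the character sums over \<open>A\<close> and \<open>B\<close> is \<open>0\<close>, so one
  of the sums vanishes. As the cyclotomic polynomial of order \<open>N\<close> is irreducible, an integer
  combination of \<open>N\<close>-th roots of unity vanishes only if its coefficients are constant on the
  cosets of the subgroup of order \<open>p\<close> (\<open>vanishing_int_char_sum_periodic\<close>). Writing \<open>A\<^sub>0\<close> and \<open>A\<^sub>1\<close>
  for the two layers of \<open>A\<close>, the characters give such a periodicity for \<open>1\<^bsub>A0\<^esub> + 1\<^bsub>A1\<^esub>\<close> or
  \<open>1\<^bsub>B0\<^esub> + 1\<^bsub>B1\<^esub>\<close>, and for \<open>1\<^bsub>A0\<^esub> - 1\<^bsub>A1\<^esub>\<close> or \<open>1\<^bsub>B0\<^esub> - 1\<^bsub>B1\<^esub>\<close>. If the same factor has both, it is periodic;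
  otherwise a pigeonhole argument for three points of a coset and two layers, hence \<open>p \<ge> 3\<close>, gives
  the claim.

  A periodic factor is the full preimage of its image in the quotient by its period, the other
  factor is mapped injectively, and the two images form a factorization of the quotient
  (\<open>factorization_quotient\<close>). Iterating this and merging consecutive steps in which the same
  factor is the full preimage, one obtains a chain of divisors from \<open>1\<close> to \<open>2 p\<^sup>3\<close> along which the
  two factors take turns in being lifted fully and injectively (\<open>factorization_tower\<close>). The factor
  that is lifted injectively in the lowest step lies in a proper subgroup, so for a generating
  \<open>S\<^sub>0\<close> the lowest step is full on \<open>S\<^sub>0\<close>. There are twenty chains of divisors
  (\<open>descending_3_1\<close>); the one with a single step means \<open>S\<^sub>0 = G\<close>, and the other nineteen are the
  nineteen pairs: a full lift adds an index running through a complete set of digits, and an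
  injective lift adds an arbitrary parameter depending on the indices present so far. Conversely,
  such lifts turn factorizations of the quotient into factorizations of the group
  (\<open>family_tiles_lift\<close>), so all nineteen pairs are factorizations.
\<close>

section \<open>Irreducibility of cyclotomic polynomials of prime power order\<close>

text \<open>
  Since \<open>q\<^sup>2\<close> does not divide the constant coefficient, one of the factors, say \<open>a\<close>, has a constant
  coefficient prime to \<open>q\<close>. If \<open>i\<close> is the least index at which the other factor \<open>b\<close> has a coefficient
  prime to \<open>q\<close>, then the coefficient of \<open>a * b\<close> at \<open>i\<close> is prime to \<open>q\<close>, although \<open>i \<le> degree b\<close>.
\<close>

lemma eisenstein_no_factorization:
  fixes P g h :: "int poly" and q :: int
  assumes q: "prime q" and P: "P = g * h" and deg: "degree g > 0" "degree h > 0"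
    and lead: "\<not> q dvd lead_coeff P"
    and low: "\<And>i. i < degree P \<Longrightarrow> q dvd coeff P i"
    and const: "\<not> q\<^sup>2 dvd coeff P 0"
  shows False
proof -
  have nz: "g \<noteq> 0" "h \<noteq> 0" using deg by auto
  have degP: "degree P = degree g + degree h"
    unfolding P using nz by (simp add: degree_mult_eq)
  have leadP: "lead_coeff P = lead_coeff g * lead_coeff h"
    unfolding P by (simp add: lead_coeff_mult)
  have main: False
    if "\<not> q dvd coeff a 0" "P = a * b" "\<not> q dvd lead_coeff b" "degree b < degree P" for a b
  proof -
    define i where "i = (LEAST i. \<not> q dvd coeff b i)"
    have i1: "\<not> q dvd coeff b i" unfolding i_def using that(3) by (rule LeastI)
    have i2: "q dvd coeff b j" if "j < i" for j using not_less_Least that unfolding i_def by blast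
    have "i \<le> degree b" unfolding i_def using that(3) by (rule Least_le)
    then have "q dvd coeff P i" using low that(4) by simp
    moreover have "coeff P i = coeff a 0 * coeff b i + (\<Sum>j\<in>{1..i}. coeff a j * coeff b (i - j))"
      unfolding that(2) coeff_mult
      by (subst sum.atLeast_Suc_atMost[of 0 i, simplified atLeast0AtMost]) auto
    moreover have "q dvd (\<Sum>j\<in>{1..i}. coeff a j * coeff b (i - j))"
      by (intro dvd_sum dvd_mult i2) auto
    ultimately have "q dvd coeff a 0 * coeff b i" by (simp add: dvd_add_left_iff)
    then show False using i1 that(1) q by (simp add: prime_dvd_mult_iff)
  qed
  have "coeff P 0 = coeff g 0 * coeff h 0" unfolding P by (simp add: coeff_mult)
  then have "\<not> (q dvd coeff g 0 \<and> q dvd coeff h 0)"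
    using const by (auto simp: power2_eq_square intro: mult_dvd_mono)
  moreover have "\<not> q dvd lead_coeff g" "\<not> q dvd lead_coeff h" using lead leadP by auto
  ultimately show False
    using main[of g h] main[of h g] P degP deg by (auto simp: mult.commute)
qed

lemma freshman_dream_dvd:
  fixes a b :: "'a :: comm_ring_1"
  assumes "prime p"
  shows "of_nat p dvd (a + b) ^ p - (a ^ p + b ^ p)"
proof -
  have p: "p > 0" using assms prime_gt_0_nat by blast
  have "(a + b) ^ p = (\<Sum>k\<le>p. of_nat (p choose k) * a ^ k * b ^ (p - k))"
    by (rule binomial_ring)
  also have "{..p} = insert 0 (insert p {1..<p})" using p by auto
  also have "(\<Sum>k\<in>\<dots>. of_nat (p choose k) * a ^ k * b ^ (p - k)) =
      b ^ p + (a ^ p + (\<Sum>k\<in>{1..<p}. of_nat (p choose k) * a ^ k * b ^ (p - k)))"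
    using p by simp
  finally have "(a + b) ^ p - (a ^ p + b ^ p) = (\<Sum>k\<in>{1..<p}. of_nat (p choose k) * a ^ k * b ^ (p - k))"
    by simp
  moreover have "of_nat p dvd (\<Sum>k\<in>{1..<p}. of_nat (p choose k) * a ^ k * b ^ (p - k))"
  proof (intro dvd_sum dvd_mult2)
    fix k assume "k \<in> {1..<p}"
    then have "p dvd (p choose k)" using assms by (intro dvd_choose_prime) auto
    then show "of_nat p dvd (of_nat (p choose k) :: 'a)" by (auto elim!: dvdE)
  qed
  ultimately show ?thesis by simp
qed

text \<open>
  The shift \<open>x = 1 + y\<close> turns powers \<open>x ^ (p ^ k)\<close> into \<open>1 + y ^ (p ^ k)\<close> modulo \<open>p\<close>; this makes the
  shifted cyclotomic polynomial an Eisenstein polynomial.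
\<close>

lemma power_one_plus_prime_power_dvd:
  fixes y :: "'a :: comm_ring_1"
  assumes "prime p"
  shows "of_nat p dvd (1 + y) ^ (p ^ k) - (1 + y ^ (p ^ k))"
proof (induction k)
  case (Suc k)
  let ?m = "p ^ k"
  have "(1 + y) ^ ?m - (1 + y ^ ?m) dvd ((1 + y) ^ ?m) ^ p - (1 + y ^ ?m) ^ p"
    by (simp add: power_diff_sumr2)
  with Suc have "of_nat p dvd ((1 + y) ^ ?m) ^ p - (1 + y ^ ?m) ^ p" by (rule dvd_trans)
  moreover have "of_nat p dvd (1 + y ^ ?m) ^ p - (1 ^ p + (y ^ ?m) ^ p)"
    by (rule freshman_dream_dvd[OF assms])
  ultimately have "of_nat p dvd (((1 + y) ^ ?m) ^ p - (1 + y ^ ?m) ^ p)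
      + ((1 + y ^ ?m) ^ p - (1 ^ p + (y ^ ?m) ^ p))"
    by (rule dvd_add)
  also have "\<dots> = (1 + y) ^ (p ^ Suc k) - (1 + y ^ (p ^ Suc k))"
    by (simp add: power_mult[symmetric] mult.commute)
  finally show ?case .
qed simp

text \<open>
  The cyclotomic polynomial of order \<open>p ^ Suc k\<close>, as a geometric sum.
\<close>

definition cyclotomic_pp :: "nat \<Rightarrow> nat \<Rightarrow> int poly" where
  "cyclotomic_pp p k = (\<Sum>j<p. monom 1 (p ^ k) ^ j)"

lemma degree_monom_minus_one:
  assumes "n > 0"
  shows "degree (monom (1::int) n - 1) = n" "lead_coeff (monom (1::int) n - 1) = 1"
proof -
  have "degree (monom (1::int) n - 1) \<le> n"
    by (intro degree_diff_le) (auto simp: degree_monom_le)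
  moreover have c: "coeff (monom (1::int) n - 1) n = 1" using assms by (simp add: coeff_1)
  ultimately show "degree (monom (1::int) n - 1) = n"
    by (metis le_antisym le_degree zero_neq_one)
  with c show "lead_coeff (monom (1::int) n - 1) = 1" by simp
qed

context
  fixes p k :: nat
  assumes p: "prime p"
begin

lemma cyclotomic_pp_times:
  "cyclotomic_pp p k * (monom 1 (p ^ k) - 1) = monom 1 (p ^ Suc k) - 1"
  using power_diff_1_eq[of "monom (1::int) (p ^ k)" p]
  by (simp add: cyclotomic_pp_def monom_power mult.commute)

lemma degree_cyclotomic_pp: "degree (cyclotomic_pp p k) = p ^ Suc k - p ^ k"
  and lead_coeff_cyclotomic_pp: "lead_coeff (cyclotomic_pp p k) = 1"
proof -
  have pos: "p ^ k > 0" "p ^ Suc k > 0" using p prime_gt_0_nat by auto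
  have nz: "monom 1 n - 1 \<noteq> (0::int poly)" if "n > 0" for n
    using degree_monom_minus_one(2)[OF that] by (metis leading_coeff_0_iff zero_neq_one)
  note nz = nz[OF pos(1)] nz[OF pos(2)]
  then have nz': "cyclotomic_pp p k \<noteq> 0" using cyclotomic_pp_times by auto
  have "degree (cyclotomic_pp p k) + p ^ k = p ^ Suc k"
    using arg_cong[OF cyclotomic_pp_times, of degree] nz nz'
    by (simp add: degree_mult_eq degree_monom_minus_one(1)[OF pos(1)]
        degree_monom_minus_one(1)[OF pos(2)] del: power_Suc)
  then show "degree (cyclotomic_pp p k) = p ^ Suc k - p ^ k" by simp
  show "lead_coeff (cyclotomic_pp p k) = 1"
    using arg_cong[OF cyclotomic_pp_times, of lead_coeff]
    unfolding lead_coeff_mult degree_monom_minus_one(2)[OF pos(1)] degree_monom_minus_one(2)[OF pos(2)]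
    by simp
qed

text \<open>
  After the substitution \<open>x = 1 + y\<close> the identity \<open>cyclotomic_pp_times\<close> reads, modulo \<open>p\<close>,
  \<open>Psi * y ^ m = y ^ (p * m)\<close> with \<open>m = p ^ k\<close>, so \<open>p\<close> divides all coefficients of \<open>Psi\<close> except the leading
  one; and the constant coefficient of \<open>Psi\<close> is the value \<open>p\<close> of the cyclotomic polynomial at \<open>1\<close>.
\<close>

lemma cyclotomic_pp_irreducible:
  assumes "cyclotomic_pp p k = g * h" "degree g > 0" "degree h > 0"
  shows False
proof -
  let ?m = "p ^ k" and ?y = "[:0, 1:] :: int poly" and ?s = "[:1, 1:] :: int poly"
  define Psi where "Psi = pcompose (cyclotomic_pp p k) ?s"
  have deg: "degree Psi = p ^ Suc k - ?m"
    unfolding Psi_def degree_pcompose degree_cyclotomic_pp by simp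
  have s: "?s = 1 + ?y" by (simp add: one_pCons)
  have comp: "pcompose (monom 1 n) ?s = ?s ^ n" for n
    by (induction n) (simp_all add: monom_0 monom_Suc pcompose_pCons one_pCons)
  have "Psi * (?s ^ ?m - 1) = ?s ^ (p ^ Suc k) - 1"
    using arg_cong[OF cyclotomic_pp_times, of "\<lambda>f. pcompose f ?s"]
    by (simp only: Psi_def pcompose_mult pcompose_diff comp pcompose_1)
  moreover obtain A where "?s ^ ?m - (1 + ?y ^ ?m) = of_nat p * A"
    using power_one_plus_prime_power_dvd[OF p, of ?y k] unfolding s by (elim dvdE)
  then have "?s ^ ?m - 1 = monom 1 ?m + of_nat p * A"
    by (simp add: monom_altdef algebra_simps)
  moreover obtain B where "?s ^ (p ^ Suc k) - (1 + ?y ^ (p ^ Suc k)) = of_nat p * B"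
    using power_one_plus_prime_power_dvd[OF p, of ?y "Suc k"] unfolding s by (elim dvdE)
  then have "?s ^ (p ^ Suc k) - 1 = monom 1 (p ^ Suc k) + of_nat p * B"
    by (simp add: monom_altdef algebra_simps)
  ultimately have eq: "monom 1 ?m * Psi = monom 1 (p ^ Suc k) + of_nat p * (B - A * Psi)"
    by (simp add: algebra_simps)
  have coeff_p: "coeff (of_nat p * f) i = int p * coeff f i" for f :: "int poly" and i
    by (simp add: of_nat_poly)
  \<comment> \<open>The coefficient of \<open>Psi\<close> at \<open>i\<close> is that of \<open>monom 1 ?m * Psi\<close> at \<open>?m + i\<close>, where \<open>monom 1 (p ^ Suc k)\<close>
    has no term because \<open>i\<close> is below the degree of \<open>Psi\<close>.\<close>
  have low: "int p dvd coeff Psi i" if "i < degree Psi" for i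
  proof -
    have "coeff (monom 1 ?m * Psi) (?m + i) = coeff Psi i" by (simp add: coeff_monom_mult)
    moreover have "coeff (monom (1::int) (p ^ Suc k)) (?m + i) = 0"
      using that deg by (simp del: power_Suc)
    ultimately show ?thesis unfolding eq by (metis add_0 coeff_add dvd_triv_left coeff_p)
  qed
  show False
  proof (rule eisenstein_no_factorization[where q = "int p" and P = Psi])
    show "prime (int p)" using p by simp
    show "Psi = pcompose g ?s * pcompose h ?s"
      by (simp add: Psi_def assms(1) pcompose_mult)
    show "degree (pcompose g ?s) > 0" "degree (pcompose h ?s) > 0"
      using assms by (simp_all add: degree_pcompose)
    show "\<not> int p dvd lead_coeff Psi"
      unfolding Psi_def using p not_prime_unit by (subst lead_coeff_comp) (auto simp: lead_coeff_cyclotomic_pp)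
    have "coeff Psi 0 = int p"
      by (simp add: Psi_def pcompose_coeff_0 cyclotomic_pp_def poly_sum poly_monom)
    then show "\<not> (int p)\<^sup>2 dvd coeff Psi 0"
      using p by (auto simp: power2_eq_square dest: prime_gt_1_nat)
  qed (use low in auto)
qed

end

lemma eval_int_poly_add:
  "poly (map_poly of_int (f + g)) (z::complex) = poly (map_poly of_int f) z + poly (map_poly of_int g) z"
  by (induction f g rule: poly_induct2) (simp_all add: map_poly_pCons algebra_simps)

lemma eval_int_poly_smult:
  "poly (map_poly of_int (smult c f)) (z::complex) = of_int c * poly (map_poly of_int f) z"
  by (induction f) (simp_all add: map_poly_pCons algebra_simps)

lemma eval_int_poly_mult:
  "poly (map_poly of_int (f * g)) (z::complex) = poly (map_poly of_int f) z * poly (map_poly of_int g) z"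
  by (induction f) (simp_all add: map_poly_pCons eval_int_poly_add eval_int_poly_smult algebra_simps)

text \<open>
  An annihilating polynomial of least degree divides, once it is made primitive, a nonzero multiple
  of the cyclotomic polynomial (pseudo-division) and hence, by the lemma of Gauss on contents, the
  cyclotomic polynomial itself. A smaller degree would contradict irreducibility.
\<close>

lemma cyclotomic_pp_minimal:
  fixes z :: complex
  assumes p: "prime p" and root: "poly (map_poly of_int (cyclotomic_pp p k)) z = 0"
    and f: "poly (map_poly of_int f) z = 0" "degree f < p ^ Suc k - p ^ k"
  shows "f = 0"
proof (rule ccontr)
  let ?ev = "\<lambda>f. poly (map_poly of_int f) z"
  let ?C = "cyclotomic_pp p k"
  assume "f \<noteq> 0"
  then obtain g where g: "g \<noteq> 0" "?ev g = 0"
    and least: "\<And>h. h \<noteq> 0 \<Longrightarrow> ?ev h = 0 \<Longrightarrow> degree g \<le> degree h"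
    using ex_has_least_nat[of "\<lambda>g. g \<noteq> 0 \<and> ?ev g = 0" f degree] f by blast
  define u where "u = primitive_part g"
  have u: "u \<noteq> 0" "degree u = degree g" "content u = 1" using g unfolding u_def by auto
  have "?ev g = of_int (content g) * ?ev u"
    unfolding u_def by (metis content_times_primitive_part eval_int_poly_smult)
  then have evu: "?ev u = 0" using g by auto
  have "degree u \<noteq> 0"
  proof
    assume "degree u = 0"
    then obtain c where "u = [:c:]" by (rule degree_eq_zeroE)
    then show False using evu u(1) by (simp add: map_poly_pCons)
  qed
  then have du: "degree u > 0" by simp
  obtain c q where c: "c \<noteq> 0" and cq: "smult c ?C = u * q + pseudo_mod ?C u"
    using pseudo_mod(1)[OF u(1)] by blast
  have "?ev (pseudo_mod ?C u) = 0"
    using arg_cong[OF cq, of ?ev] root evu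
    by (simp add: eval_int_poly_add eval_int_poly_smult eval_int_poly_mult)
  then have "pseudo_mod ?C u = 0"
    using pseudo_mod(2)[OF u(1), of ?C] least u(2) by fastforce
  with cq have cq: "smult c ?C = u * q" by simp
  have "content ?C dvd 1"
    using content_dvd_coeff[of ?C "degree ?C"] lead_coeff_cyclotomic_pp[OF p, of k] by simp
  then have "content ?C = 1" using is_unit_normalize[of "content ?C"] by (metis normalize_content)
  then have "normalize c = content q"
    using arg_cong[OF cq, of content] u(3) by (simp add: content_mult)
  then have "[:c:] dvd q" by (simp add: const_poly_dvd_iff_dvd_content flip: \<open>normalize c = content q\<close>)
  then obtain h where "q = smult c h" by (auto elim: dvdE)
  then have "smult c (?C - u * h) = 0" using cq by (simp add: smult_diff_right)
  then have C: "?C = u * h" using c by simp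
  have "h \<noteq> 0" using C lead_coeff_cyclotomic_pp[OF p, of k] by auto
  then have "degree ?C = degree u + degree h" unfolding C using u by (simp add: degree_mult_eq)
  moreover have "degree u \<le> degree f" using least[of f] \<open>f \<noteq> 0\<close> f u by simp
  ultimately have "degree h > 0" using f(2) degree_cyclotomic_pp[OF p, of k] by simp
  then show False using cyclotomic_pp_irreducible[OF p C du] by simp
qed


section \<open>Vanishing integer combinations of roots of unity\<close>

definition int_char :: "nat \<Rightarrow> int \<Rightarrow> complex" where
  "int_char N x = cis (2 * pi * of_int x / of_nat N)"

lemma int_char_add: "int_char N (x + y) = int_char N x * int_char N y"
  by (simp add: int_char_def cis_mult add_divide_distrib distrib_left)

lemma int_char_nat: "int_char N (int i) = int_char N 1 ^ i"
  by (simp add: int_char_def DeMoivre mult_ac)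

lemma int_char_mod:
  assumes "N > 0"
  shows "int_char N (x mod int N) = int_char N x"
proof -
  have "int_char N (int N * q) = 1" for q
    using assms cis_multiple_2pi[of "of_int q"] by (simp add: int_char_def mult.assoc)
  then show ?thesis
    using int_char_add[of N "int N * (x div int N)" "x mod int N"] by simp
qed

lemma int_char_one_power_neq_one:
  assumes "N > 0" "0 < i" "i < N"
  shows "int_char N 1 ^ i \<noteq> 1"
proof
  assume *: "int_char N 1 ^ i = 1"
  have "inj_on (\<lambda>k. cis (2 * pi * real k / real N)) {..<N}"
    using bij_betw_roots_unity[OF assms(1)] by (auto simp: bij_betw_def)
  from inj_onD[OF this, of i 0] have "cis (2 * pi * real i / real N) \<noteq> 1" using assms by auto
  moreover have "cis (2 * pi * real i / real N) = 1"
    using * by (simp add: int_char_nat[symmetric]) (simp add: int_char_def)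
  ultimately show False by simp
qed

lemma int_char_one_power_N: "N > 0 \<Longrightarrow> int_char N 1 ^ N = 1"
  using int_char_mod[of N "int N"] int_char_nat[of N N] by (simp add: int_char_def)

lemma sum_int_char_eq_0:
  assumes "N > 1"
  shows "(\<Sum>x\<in>{0..<int N}. int_char N x) = 0"
proof -
  have "(\<Sum>x\<in>{0..<int N}. int_char N x) = (\<Sum>i<N. int_char N 1 ^ i)"
    using sum.atLeast_int_lessThan_int_shift[of "int_char N" 0 N]
    by (simp add: int_char_nat comp_def atLeast0LessThan)
  also have "\<dots> = 0"
    using geometric_sum[of "int_char N 1" N] int_char_one_power_neq_one[of N 1] int_char_one_power_N[of N] assms
    by simp
  finally show ?thesis .
qed

text \<open>
  On the coset of \<open>r\<close> modulo \<open>m\<close> the coefficient is the constant \<open>H r\<close>, and the values of the character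
  there are multiples of all the \<open>p\<close>-th roots of unity, which have sum \<open>0\<close>.
\<close>

lemma sum_int_char_mod_eq_0:
  fixes m p :: nat and H :: "nat \<Rightarrow> complex"
  assumes "m > 0" "p > 1"
  shows "(\<Sum>i<p * m. H (i mod m) * int_char (p * m) 1 ^ i) = 0"
proof -
  let ?z = "int_char (p * m) 1"
  have "(\<Sum>i<p * m. H (i mod m) * ?z ^ i) = (\<Sum>j<p. \<Sum>i\<in>{j * m..<j * m + m}. H (i mod m) * ?z ^ i)"
    by (rule sum.nat_group[symmetric])
  also have "\<dots> = (\<Sum>j<p. \<Sum>r<m. (?z ^ m) ^ j * (H r * ?z ^ r))"
  proof (rule sum.cong[OF refl])
    fix j
    have "(\<Sum>i\<in>{j * m..<j * m + m}. H (i mod m) * ?z ^ i)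
        = (\<Sum>r<m. H ((r + j * m) mod m) * ?z ^ (r + j * m))"
      using sum.shift_bounds_nat_ivl[of "\<lambda>i. H (i mod m) * ?z ^ i" 0 "j * m" m]
      by (simp add: atLeast0LessThan add.commute)
    also have "\<dots> = (\<Sum>r<m. (?z ^ m) ^ j * (H r * ?z ^ r))"
      by (intro sum.cong) (auto simp: power_add power_mult[symmetric] mult_ac)
    finally show "(\<Sum>i\<in>{j * m..<j * m + m}. H (i mod m) * ?z ^ i) = (\<Sum>r<m. (?z ^ m) ^ j * (H r * ?z ^ r))" .
  qed
  also have "\<dots> = (\<Sum>j<p. (?z ^ m) ^ j) * (\<Sum>r<m. H r * ?z ^ r)"
    by (simp add: sum_product)
  also have "(\<Sum>j<p. (?z ^ m) ^ j) = 0"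
    using geometric_sum[of "?z ^ m" p] int_char_one_power_neq_one[of "p * m" m]
      int_char_one_power_N[of "p * m"] assms
    by (simp add: power_mult[symmetric] mult.commute)
  finally show ?thesis by simp
qed

text \<open>
  Subtracting from \<open>F\<close> the \<open>m\<close>-periodic function that agrees with it on the last block
  \<open>{p * m - m..<p * m}\<close> changes nothing in the sum and removes all terms from that block. What remains
  is a polynomial in the root of unity of degree below that of the cyclotomic polynomial, so it is \<open>0\<close>.
\<close>

lemma vanishing_int_char_sum_periodic:
  fixes F :: "int \<Rightarrow> int"
  assumes p: "prime p"
    and zero: "(\<Sum>x\<in>{0..<int (p ^ Suc k)}. of_int (F x) * int_char (p ^ Suc k) x) = 0"
    and xy: "x \<in> {0..<int (p ^ Suc k)}" "y \<in> {0..<int (p ^ Suc k)}" "x mod int (p ^ k) = y mod int (p ^ k)"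
  shows "F x = F y"
proof -
  define m where "m = p ^ k"
  have m: "m > 0" and p1: "p > 1" using p prime_gt_0_nat prime_gt_1_nat unfolding m_def by auto
  have N: "p ^ Suc k = p * m" by (simp add: m_def)
  let ?z = "int_char (p * m) 1"
  let ?ev = "\<lambda>f. poly (map_poly of_int f) ?z"
  define d where "d = p * m - m"
  have d: "d + m = p * m" "m dvd d" unfolding d_def using p1 by (auto simp: le_square dvd_diff_nat)
  define G where "G i = F (int i) - F (int (d + i mod m))" for i
  have G0: "G i = 0" if "d \<le> i" "i < p * m" for i
  proof -
    have "i - d < m" using that d by linarith
    moreover obtain c where "d = m * c" using d(2) by blast
    then have "i mod m = (i - d + m * c) mod m" using that by simp
    ultimately have "i mod m = i - d" by simp
    then show ?thesis using that by (simp add: G_def)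
  qed
  define f where "f = (\<Sum>i<d. monom (G i) i)"
  have ev_monom: "?ev (monom c n) = of_int c * ?z ^ n" for c n
    by (simp add: map_poly_monom poly_monom)
  have ev_sum: "?ev (\<Sum>i\<in>I. g i) = (\<Sum>i\<in>I. ?ev (g i))" for g :: "nat \<Rightarrow> int poly" and I
    by (induction I rule: infinite_finite_induct) (simp_all add: eval_int_poly_add)
  have "?ev f = (\<Sum>i<d. of_int (G i) * ?z ^ i)"
    unfolding f_def ev_sum ev_monom ..
  also have "\<dots> = (\<Sum>i<p * m. of_int (G i) * ?z ^ i)"
    using d G0 by (intro sum.mono_neutral_left) auto
  also have "\<dots> = (\<Sum>i<p * m. of_int (F (int i)) * ?z ^ i)
      - (\<Sum>i<p * m. of_int (F (int (d + i mod m))) * ?z ^ i)"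
    by (simp add: G_def left_diff_distrib sum_subtractf)
  also have "(\<Sum>i<p * m. of_int (F (int (d + i mod m))) * ?z ^ i) = 0"
    by (rule sum_int_char_mod_eq_0[OF m p1, of "\<lambda>r. of_int (F (int (d + r)))"])
  also have "(\<Sum>i<p * m. of_int (F (int i)) * ?z ^ i) = 0"
    using zero sum.atLeast_int_lessThan_int_shift[of "\<lambda>x. of_int (F x) * int_char (p * m) x" 0 "p * m"]
    unfolding N by (simp add: int_char_nat comp_def atLeast0LessThan)
  finally have "?ev f = 0" by simp
  moreover have "?ev (cyclotomic_pp p k) = 0"
  proof -
    have "?ev (cyclotomic_pp p k) * ?ev (monom 1 m - 1) = ?ev (monom 1 (p * m) - 1)"
      using cyclotomic_pp_times[of p k, OF p] by (simp add: m_def flip: eval_int_poly_mult)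
    moreover have "?ev (monom 1 n - 1) = ?z ^ n - 1" for n
    proof -
      have "monom 1 n - 1 = monom 1 n + monom (- 1 :: int) 0" by (simp add: poly_eq_iff)
      then show ?thesis by (simp only: eval_int_poly_add ev_monom) simp
    qed
    ultimately show ?thesis
      using int_char_one_power_neq_one[of "p * m" m] int_char_one_power_N[of "p * m"] m p1 by simp
  qed
  moreover have "degree f < d"
  proof -
    have "degree f \<le> d - 1"
      unfolding f_def by (intro degree_sum_le) (auto intro: order_trans[OF degree_monom_le])
    moreover have "d > 0" unfolding d_def using m p1 by simp
    ultimately show ?thesis by simp
  qed
  ultimately have "f = 0"
    using cyclotomic_pp_minimal[OF p, of k ?z f] by (simp add: d_def m_def)
  have "G i = 0" if "i < p * m" for i
  proof (cases "i < d")
    case True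
    have "coeff f i = G i"
      unfolding f_def coeff_sum coeff_monom using True by simp
    then show ?thesis using \<open>f = 0\<close> by simp
  qed (use G0 that in auto)
  then have *: "F x = F (int d + x mod int m)" if "x \<in> {0..<int (p * m)}" for x
    using that \<open>\<And>i. i < p * m \<Longrightarrow> G i = 0\<close>[of "nat x"] by (simp add: G_def zmod_int nat_less_iff)
  show ?thesis using *[of x] *[of y] xy by (simp add: m_def)
qed

section \<open>Tilings of a product of two cyclic groups\<close>

text \<open>
  Elements of \<open>\<int>\<^sub>m \<times> \<int>\<^sub>n\<close> are represented by pairs of reduced integers; \<open>red\<close> also serves as the
  quotient map onto \<open>\<int>\<^sub>m \<times> \<int>\<^sub>n\<close> from a group with larger moduli.
\<close>

definition red :: "int \<Rightarrow> int \<Rightarrow> int \<times> int \<Rightarrow> int \<times> int" where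
  "red m n z = (fst z mod m, snd z mod n)"

definition box :: "int \<Rightarrow> int \<Rightarrow> (int \<times> int) set" where
  "box m n = {0..<m} \<times> {0..<n}"

text \<open>
  The families \<open>F\<close> and \<open>G\<close> of integer points represent every element of \<open>\<int>\<^sub>m \<times> \<int>\<^sub>n\<close> exactly once as a
  sum. Indexing by arbitrary sets serves the parametrized families; a set is indexed by itself.
\<close>

definition tiles :: "int \<Rightarrow> int \<Rightarrow> 'u set \<Rightarrow> ('u \<Rightarrow> int \<times> int) \<Rightarrow> 'v set \<Rightarrow> ('v \<Rightarrow> int \<times> int) \<Rightarrow> bool" where
  "tiles m n U F V G \<longleftrightarrow> bij_betw (\<lambda>(u, v). red m n (F u + G v)) (U \<times> V) (box m n)"

definition factorization :: "int \<Rightarrow> int \<Rightarrow> (int \<times> int) set \<Rightarrow> (int \<times> int) set \<Rightarrow> bool" where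
  "factorization m n A B \<longleftrightarrow>
     A \<subseteq> box m n \<and> B \<subseteq> box m n \<and> (0, 0) \<in> A \<and> (0, 0) \<in> B \<and> tiles m n A (\<lambda>a. a) B (\<lambda>b. b)"

lemma red_in_box: "m > 0 \<Longrightarrow> n > 0 \<Longrightarrow> red m n z \<in> box m n"
  by (simp add: red_def box_def)

lemma red_id: "z \<in> box m n \<Longrightarrow> red m n z = z"
  by (auto simp: red_def box_def)

lemma red_red: "m dvd M \<Longrightarrow> n dvd N \<Longrightarrow> red m n (red M N z) = red m n z"
  by (simp add: red_def mod_mod_cancel)

lemma red_eq_iff: "red m n z = red m n w \<longleftrightarrow> m dvd fst z - fst w \<and> n dvd snd z - snd w"
  by (simp add: red_def mod_eq_dvd_iff)

lemma red_add_cong: "red m n z = red m n z' \<Longrightarrow> red m n w = red m n w' \<Longrightarrow> red m n (z + w) = red m n (z' + w')"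
  unfolding red_def by (auto intro: mod_add_cong)

lemma tilesI:
  assumes "m > 0" "n > 0"
    and "\<And>u v u' v'. u \<in> U \<Longrightarrow> v \<in> V \<Longrightarrow> u' \<in> U \<Longrightarrow> v' \<in> V \<Longrightarrow>
           red m n (F u + G v) = red m n (F u' + G v') \<Longrightarrow> u = u' \<and> v = v'"
    and "\<And>z. z \<in> box m n \<Longrightarrow> \<exists>u\<in>U. \<exists>v\<in>V. red m n (F u + G v) = z"
  shows "tiles m n U F V G"
  unfolding tiles_def bij_betw_def
proof
  show "inj_on (\<lambda>(u, v). red m n (F u + G v)) (U \<times> V)"
    using assms(3) by (fastforce intro!: inj_onI)
  show "(\<lambda>(u, v). red m n (F u + G v)) ` (U \<times> V) = box m n"
  proof
    show "(\<lambda>(u, v). red m n (F u + G v)) ` (U \<times> V) \<subseteq> box m n"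
      by (rule image_subsetI) (auto intro: red_in_box assms)
    show "box m n \<subseteq> (\<lambda>(u, v). red m n (F u + G v)) ` (U \<times> V)"
    proof
      fix z assume "z \<in> box m n"
      then obtain u v where "u \<in> U" "v \<in> V" "red m n (F u + G v) = z" using assms(4) by blast
      then show "z \<in> (\<lambda>(u, v). red m n (F u + G v)) ` (U \<times> V)"
        by (intro image_eqI[of _ _ "(u, v)"]) auto
    qed
  qed
qed

lemma tiles_unique:
  assumes "tiles m n U F V G" "u \<in> U" "v \<in> V" "u' \<in> U" "v' \<in> V"
    "red m n (F u + G v) = red m n (F u' + G v')"
  shows "u = u'" "v = v'"
  using assms(2-) inj_onD[OF bij_betw_imp_inj_on[OF assms(1)[unfolded tiles_def]], of "(u, v)" "(u', v')"]
  by auto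

lemma tiles_ex:
  assumes "tiles m n U F V G" "m > 0" "n > 0"
  shows "\<exists>u\<in>U. \<exists>v\<in>V. red m n (F u + G v) = red m n z"
proof -
  have "red m n z \<in> (\<lambda>(u, v). red m n (F u + G v)) ` (U \<times> V)"
    using bij_betw_imp_surj_on[OF assms(1)[unfolded tiles_def]] red_in_box[OF assms(2,3)] by simp
  then show ?thesis by force
qed

lemma tiles_commute: "tiles m n U F V G \<Longrightarrow> tiles m n V G U F"
proof -
  assume "tiles m n U F V G"
  moreover have "bij_betw prod.swap (V \<times> U) (U \<times> V)"
    by (auto simp: bij_betw_def product_swap)
  ultimately have "bij_betw ((\<lambda>(u, v). red m n (F u + G v)) \<circ> prod.swap) (V \<times> U) (box m n)"
    unfolding tiles_def using bij_betw_trans by blast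
  moreover have "(\<lambda>(u, v). red m n (F u + G v)) \<circ> prod.swap = (\<lambda>(v, u). red m n (G v + F u))"
    by (auto simp: fun_eq_iff add.commute)
  ultimately show ?thesis unfolding tiles_def by simp
qed

lemma factorization_commute: "factorization m n A B \<Longrightarrow> factorization m n B A"
  by (auto simp: factorization_def intro: tiles_commute)

section \<open>One factor is periodic\<close>

text \<open>
  \<open>A\<close> is a union of cosets of the kernel of the reduction from the moduli \<open>M\<close>, \<open>N\<close> to \<open>m\<close>, \<open>n\<close>.
\<close>

definition saturated :: "int \<Rightarrow> int \<Rightarrow> int \<Rightarrow> int \<Rightarrow> (int \<times> int) set \<Rightarrow> bool" where
  "saturated M N m n A \<longleftrightarrow> (\<forall>z\<in>box M N. red m n z \<in> red m n ` A \<longrightarrow> z \<in> A)"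

text \<open>
  With \<open>e = 1\<close> and \<open>e = - 1\<close> this is the sum and the difference of the indicator functions of the two
  layers of \<open>A\<close>; with the single layer of \<open>\<int>\<^sub>M \<times> \<int>\<^sub>1\<close> it is the indicator function.
\<close>

definition fibre :: "int \<Rightarrow> (int \<times> int) set \<Rightarrow> int \<Rightarrow> int" where
  "fibre e A x = of_bool ((x, 0) \<in> A) + e * of_bool ((x, 1) \<in> A)"

definition box_char :: "nat \<Rightarrow> int \<Rightarrow> int \<times> int \<Rightarrow> complex" where
  "box_char N e z = int_char N (fst z) * (if even (snd z) then 1 else of_int e)"

lemma box_char_add:
  assumes "e = 1 \<or> e = - 1"
  shows "box_char N e (z + w) = box_char N e z * box_char N e w"
  using assms by (auto simp: box_char_def int_char_add)

lemma box_char_red: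
  assumes "N > 0" "e = 1 \<and> n = 1 \<or> e = 1 \<and> n = 2 \<or> e = - 1 \<and> n = 2"
  shows "box_char N e (red (int N) n z) = box_char N e z"
proof -
  have "even (y mod 2) = even y" for y :: int by presburger
  then show ?thesis
    using assms by (auto simp: box_char_def red_def int_char_mod)
qed

lemma sum_box_char_box:
  assumes "N > 1"
  shows "(\<Sum>z\<in>box (int N) n. box_char N e z) = 0"
proof -
  have "(\<Sum>z\<in>box (int N) n. box_char N e z) =
      (\<Sum>x\<in>{0..<int N}. int_char N x) * (\<Sum>y\<in>{0..<n}. if even y then 1 else of_int e)"
    unfolding box_def sum_product sum.cartesian_product
    by (rule sum.cong) (auto simp: box_char_def)
  then show ?thesis by (simp add: sum_int_char_eq_0[OF assms])
qed

lemma sum_box_char_fibre: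
  assumes "A \<subseteq> box (int N) n" "n = 1 \<or> n = 2"
  shows "(\<Sum>z\<in>A. box_char N e z) = (\<Sum>x\<in>{0..<int N}. of_int (fibre e A x) * int_char N x)"
proof -
  have sub: "A \<subseteq> {0..<int N} \<times> {0, 1}" using assms by (auto simp: box_def)
  have "(\<Sum>z\<in>A. box_char N e z) = (\<Sum>z\<in>{0..<int N} \<times> {0, 1}. of_bool (z \<in> A) * box_char N e z)"
    using sub by (intro sum.mono_neutral_cong_left) auto
  also have "\<dots> = (\<Sum>x\<in>{0..<int N}. \<Sum>y\<in>{0, 1}. of_bool ((x, y) \<in> A) * box_char N e (x, y))"
    unfolding sum.cartesian_product by (rule sum.cong) auto
  also have "\<dots> = (\<Sum>x\<in>{0..<int N}. of_int (fibre e A x) * int_char N x)"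
    by (intro sum.cong) (auto simp: fibre_def box_char_def algebra_simps)
  finally show ?thesis .
qed

context
  fixes p k :: nat and m n :: int
  assumes p: "prime p" and m: "m = int p ^ k" and n: "n = 1 \<or> n = 2"
begin

text \<open>
  The character \<open>box_char\<close> is multiplicative and its sum over the whole group is \<open>0\<close>, so its sum over
  \<open>A\<close> or over \<open>B\<close> is \<open>0\<close>. That sum is an integer combination of roots of unity with the coefficients
  \<open>fibre e A\<close> or \<open>fibre e B\<close>.
\<close>

lemma fibre_periodic_or:
  assumes fact: "factorization (int p * m) n A B" and e: "e = 1 \<or> e = - 1 \<and> n = 2"
  shows "(\<forall>x\<in>{0..<int p * m}. \<forall>y\<in>{0..<int p * m}. x mod m = y mod m \<longrightarrow> fibre e A x = fibre e A y)
       \<or> (\<forall>x\<in>{0..<int p * m}. \<forall>y\<in>{0..<int p * m}. x mod m = y mod m \<longrightarrow> fibre e B x = fibre e B y)"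
proof -
  let ?N = "p ^ Suc k"
  have N: "int p * m = int ?N" and m': "m = int (p ^ k)" by (simp_all add: m)
  have N1: "?N > 1" using p prime_gt_1_nat by (metis one_less_power zero_less_Suc)
  have AB: "A \<subseteq> box (int ?N) n" "B \<subseteq> box (int ?N) n"
    and bij: "bij_betw (\<lambda>(a, b). red (int ?N) n (a + b)) (A \<times> B) (box (int ?N) n)"
    using fact unfolding factorization_def tiles_def N by auto
  have "(\<Sum>a\<in>A. box_char ?N e a) * (\<Sum>b\<in>B. box_char ?N e b)
      = (\<Sum>(a, b)\<in>A \<times> B. box_char ?N e a * box_char ?N e b)"
    by (simp add: sum_product sum.cartesian_product)
  also have "\<dots> = (\<Sum>ab\<in>A \<times> B. box_char ?N e ((\<lambda>(a, b). red (int ?N) n (a + b)) ab))"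
  proof (intro sum.cong refl)
    fix ab assume "ab \<in> A \<times> B"
    obtain a b where ab: "ab = (a, b)" by (cases ab)
    have "box_char ?N e (red (int ?N) n (a + b)) = box_char ?N e (a + b)"
      using e n p prime_gt_0_nat by (intro box_char_red) auto
    also have "\<dots> = box_char ?N e a * box_char ?N e b"
      using e by (intro box_char_add) auto
    finally show "(case ab of (a, b) \<Rightarrow> box_char ?N e a * box_char ?N e b)
        = box_char ?N e ((\<lambda>(a, b). red (int ?N) n (a + b)) ab)"
      by (simp add: ab)
  qed
  also have "\<dots> = (\<Sum>z\<in>box (int ?N) n. box_char ?N e z)"
    by (rule sum.reindex_bij_betw[OF bij])
  also have "\<dots> = 0" by (rule sum_box_char_box[OF N1])
  finally have "(\<Sum>a\<in>A. box_char ?N e a) = 0 \<or> (\<Sum>b\<in>B. box_char ?N e b) = 0" by simp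
  then show ?thesis
    unfolding sum_box_char_fibre[OF AB(1) n] sum_box_char_fibre[OF AB(2) n] N
    unfolding m'
    using vanishing_int_char_sum_periodic[OF p, where k = k and F = "fibre e A"]
      vanishing_int_char_sum_periodic[OF p, where k = k and F = "fibre e B"] by blast
qed

lemma saturated_if_fibre_periodic:
  assumes "n = 1" "A \<subseteq> box (int p * m) n"
    and per: "\<forall>x\<in>{0..<int p * m}. \<forall>y\<in>{0..<int p * m}. x mod m = y mod m \<longrightarrow> fibre 1 A x = fibre 1 A y"
  shows "saturated (int p * m) n m n A"
  unfolding saturated_def
proof safe
  fix x y x' y' assume z: "(x, y) \<in> box (int p * m) n" and a: "red m n (x, y) = red m n (x', y')" "(x', y') \<in> A"
  have "(x', y') \<in> box (int p * m) n" using a assms(2) by blast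
  moreover have "(x, 1) \<notin> A" "(x', 1) \<notin> A" using assms(1,2) by (auto simp: box_def)
  ultimately show "(x, y) \<in> A"
    using per[rule_format, of x x'] z a assms(1)
    by (cases "y = 0"; cases "y' = 0") (auto simp: red_def box_def fibre_def of_bool_def split: if_splits)
qed

lemma saturated_if_fibres_periodic:
  assumes "n = 2" "A \<subseteq> box (int p * m) n"
    and per: "\<forall>x\<in>{0..<int p * m}. \<forall>y\<in>{0..<int p * m}. x mod m = y mod m \<longrightarrow> fibre 1 A x = fibre 1 A y"
    and per': "\<forall>x\<in>{0..<int p * m}. \<forall>y\<in>{0..<int p * m}. x mod m = y mod m \<longrightarrow> fibre (- 1) A x = fibre (- 1) A y"
  shows "saturated (int p * m) n m n A"
  unfolding saturated_def
proof safe
  fix x y x' y' assume z: "(x, y) \<in> box (int p * m) n" and a: "red m n (x, y) = red m n (x', y')" "(x', y') \<in> A"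
  have "(x', y') \<in> box (int p * m) n" using a assms(2) by blast
  moreover from this z a assms(1) have "y' = y" "y = 0 \<or> y = 1" by (auto simp: red_def box_def)
  ultimately show "(x, y) \<in> A"
    using per[rule_format, of x x'] per'[rule_format, of x x'] z a
    by (auto simp: red_def box_def fibre_def of_bool_def split: if_splits)
qed

text \<open>
  If \<open>A\<close> is not invariant under \<open>(0, 1)\<close>, some coset of the subgroup of order \<open>p\<close> lies in one layer of
  \<open>A\<close>, by periodicity of the difference of the layers. If \<open>A\<close> is not invariant under that subgroup, then
  \<open>A\<close> contains some \<open>(x, 0)\<close> and \<open>(x, 1)\<close>, and the sum of its layers is not periodic, so that of \<open>B\<close> is.
  The points \<open>(x, 0)\<close> and \<open>(x, 1)\<close> force \<open>B\<close> to have at most one point over each first coordinate. Hence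
  \<open>B\<close> has a point over each of \<open>0\<close>, \<open>m\<close>, \<open>2 * m\<close>, and two of these lie in the same layer; their difference
  is also a difference of two points of the coset contained in \<open>A\<close>, which contradicts uniqueness.
\<close>

lemma saturated_2_or_p_if_difference_periodic:
  assumes fact: "factorization (int p * m) n A B" and n2: "n = 2" and p2: "p > 2"
    and diff: "\<forall>x\<in>{0..<int p * m}. \<forall>y\<in>{0..<int p * m}. x mod m = y mod m \<longrightarrow> fibre (- 1) A x = fibre (- 1) A y"
  shows "saturated (int p * m) n m n A \<or> saturated (int p * m) n m n B \<or> saturated (int p * m) n (int p * m) 1 A"
proof (rule ccontr)
  let ?N = "int p * m"
  assume neg: "\<not> ?thesis"
  have m0: "m > 0" and N0: "?N > 0" using p prime_gt_0_nat by (auto simp: m)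
  have AB: "A \<subseteq> box ?N n" "B \<subseteq> box ?N n" "(0, 0) \<in> B"
    and tiles: "tiles ?N n A (\<lambda>a. a) B (\<lambda>b. b)"
    using fact by (auto simp: factorization_def)
  note unique = tiles_unique[OF tiles]
  have "\<not> (\<forall>x\<in>{0..<?N}. \<forall>y\<in>{0..<?N}. x mod m = y mod m \<longrightarrow> fibre 1 A x = fibre 1 A y)"
    using saturated_if_fibres_periodic[OF n2 AB(1)] diff neg by blast
  then have sumB: "\<forall>x\<in>{0..<?N}. \<forall>y\<in>{0..<?N}. x mod m = y mod m \<longrightarrow> fibre 1 B x = fibre 1 B y"
    using fibre_periodic_or[OF fact, of 1] by blast
  have bit: "y = 0 \<or> y = 1" if "(x, y) \<in> box ?N n" for x y using that n2 by (auto simp: box_def)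
  obtain a y where ay: "(a, y) \<in> A" "(a, 1 - y) \<notin> A"
  proof -
    obtain z w where zw: "z \<in> box ?N n" "w \<in> A" "red ?N 1 z = red ?N 1 w" "z \<notin> A"
      using neg by (auto simp: saturated_def)
    obtain x y where w: "w = (x, y)" by (cases w)
    have wb: "(x, y) \<in> box ?N n" using zw AB w by auto
    have "fst z = x" using zw wb w by (auto simp: red_def box_def)
    then have z: "z = (x, snd z)" by (simp add: prod_eq_iff)
    then have "(x, snd z) \<in> box ?N n" "(x, snd z) \<notin> A" using zw(1,4) by simp_all
    then have "snd z = 1 - y" using bit[OF wb] bit[of x "snd z"] zw(2) w by auto
    then have "z = (x, 1 - y)" using z by simp
    then show thesis using that[of x y] zw w by simp
  qed
  have "(a, y) \<in> box ?N n" using ay AB by auto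
  then have y: "y = 0 \<or> y = 1" and a: "a \<in> {0..<?N}" using bit by (auto simp: box_def)
  have coset: "(a', y) \<in> A" if "a' \<in> {0..<?N}" "a' mod m = a mod m" for a'
    using diff[rule_format, of a' a] ay y that a by (auto simp: fibre_def of_bool_def split: if_splits)
  obtain x where x: "(x, 0) \<in> A" "(x, 1) \<in> A"
  proof -
    obtain z w where zw: "z \<in> box ?N n" "w \<in> A" "red m n z = red m n w" "z \<notin> A"
      using neg by (auto simp: saturated_def)
    obtain x y x' y'' where xy: "w = (x, y)" "z = (x', y'')" by (cases w, cases z)
    have "(x, y) \<in> box ?N n" using zw AB xy by auto
    then have r: "y'' = y" "x' mod m = x mod m" "y = 0 \<or> y = 1" "x \<in> {0..<?N}" "x' \<in> {0..<?N}"
      using zw(1,3) n2 bit xy by (auto simp: red_def box_def)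
    have "fibre (- 1) A x' = fibre (- 1) A x" by (rule diff[rule_format, OF r(5,4,2)])
    then have "(x, 0) \<in> A \<and> (x, 1) \<in> A"
      using r(3) zw(2,4) unfolding xy r(1)
      by (elim disjE) (simp_all add: fibre_def of_bool_def split: if_splits)
    then show thesis using that by blast
  qed
  have Bsingle: "\<not> ((b, 0) \<in> B \<and> (b, 1) \<in> B)" for b
    using unique(1)[of "(x, 0)" "(b, 1)" "(x, 1)" "(b, 0)"] x by auto
  have "fibre 1 B 0 = 1" using AB(3) Bsingle[of 0] by (simp add: fibre_def)
  have layer: "\<exists>y. (y = 0 \<or> y = 1) \<and> (j * m, y) \<in> B" if "j \<in> {0, 1, 2}" for j
  proof -
    have "j * m \<le> 2 * m" "0 \<le> j * m" using that m0 by auto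
    moreover have "2 * m < ?N" using p2 m0 by simp
    ultimately have "fibre 1 B (j * m) = fibre 1 B 0" using N0 by (intro sumB[rule_format]) auto
    then show ?thesis using \<open>fibre 1 B 0 = 1\<close> by (auto simp: fibre_def of_bool_def split: if_splits)
  qed
  obtain i j y' where ij: "i \<noteq> j" "(i * m, y') \<in> B" "(j * m, y') \<in> B"
  proof -
    obtain y0 y1 y2 where
      "y0 = 0 \<or> y0 = 1" "(0 * m, y0) \<in> B" "y1 = 0 \<or> y1 = 1" "(1 * m, y1) \<in> B"
      "y2 = 0 \<or> y2 = 1" "(2 * m, y2) \<in> B"
      using layer[of 0] layer[of 1] layer[of 2] by blast
    moreover from this have "y0 = y1 \<or> y0 = y2 \<or> y1 = y2" by auto
    ultimately show thesis
      using that[of 0 1 y0] that[of 0 2 y0] that[of 1 2 y1] by auto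
  qed
  have "((a + t * m) mod ?N, y) \<in> A" for t
    using N0 by (intro coset) (simp_all add: mod_mod_cancel)
  moreover have "red ?N n (((a + i * m) mod ?N, y) + (j * m, y')) = red ?N n (((a + j * m) mod ?N, y) + (i * m, y'))"
    by (simp add: red_def mod_simps algebra_simps)
  ultimately have "(j * m, y') = (i * m, y')" using unique(2) ij(2,3) by blast
  then show False using ij m0 by simp
qed

lemma periodic_factor:
  assumes fact: "factorization (int p * m) n A B" and p2: "p > 2"
  shows "saturated (int p * m) n m n A \<or> saturated (int p * m) n m n B \<or>
    n = 2 \<and> (saturated (int p * m) n (int p * m) 1 A \<or> saturated (int p * m) n (int p * m) 1 B)"
proof (cases "n = 1")
  case True
  have "A \<subseteq> box (int p * m) n" "B \<subseteq> box (int p * m) n" using fact by (auto simp: factorization_def)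
  then show ?thesis
    using fibre_periodic_or[OF fact, of 1] saturated_if_fibre_periodic[OF True] by blast
next
  case False
  then have "n = 2" using n by simp
  then show ?thesis
    using fibre_periodic_or[OF fact, of "- 1"] saturated_2_or_p_if_difference_periodic[OF fact _ p2]
      saturated_2_or_p_if_difference_periodic[OF factorization_commute[OF fact] _ p2] by blast
qed

end

section \<open>Towers of quotients\<close>

text \<open>
  In a step from the moduli \<open>m\<close>, \<open>n\<close> up to \<open>M\<close>, \<open>N\<close> one factor is the full preimage of its image, and
  the reduction is injective on the other one.
\<close>

definition lift_full :: "int \<Rightarrow> int \<Rightarrow> int \<Rightarrow> int \<Rightarrow> (int \<times> int) set \<Rightarrow> (int \<times> int) set \<Rightarrow> bool" where
  "lift_full M N m n A1 A \<longleftrightarrow> A = {z \<in> box M N. red m n z \<in> A1}"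

definition lift_inj :: "int \<Rightarrow> int \<Rightarrow> int \<Rightarrow> int \<Rightarrow> (int \<times> int) set \<Rightarrow> (int \<times> int) set \<Rightarrow> bool" where
  "lift_inj M N m n B1 B \<longleftrightarrow> B \<subseteq> box M N \<and> (0, 0) \<in> B \<and> bij_betw (red m n) B B1"

lemma lift_full_trans:
  assumes "lift_full m n m' n' A2 A1" "lift_full M N m n A1 A"
    and "m > 0" "n > 0" "m' dvd m" "n' dvd n"
  shows "lift_full M N m' n' A2 A"
  using assms by (auto simp: lift_full_def red_in_box red_red)

lemma lift_inj_trans:
  assumes "lift_inj m n m' n' B2 B1" "lift_inj M N m n B1 B"
    and "m' dvd m" "n' dvd n"
  shows "lift_inj M N m' n' B2 B"
proof -
  have "bij_betw (red m' n' \<circ> red m n) B B2"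
    using assms bij_betw_trans unfolding lift_inj_def by blast
  moreover have "red m' n' \<circ> red m n = red m' n'" using assms by (auto simp: red_red)
  ultimately show ?thesis using assms unfolding lift_inj_def by simp
qed

text \<open>
  If \<open>A\<close> is saturated, a sum \<open>a + b\<close> that is only correct modulo the small moduli can be corrected within
  \<open>A\<close>: the element \<open>z - b\<close> is congruent to \<open>a\<close> and so belongs to \<open>A\<close>. This transfers uniqueness from the
  group to the quotient.
\<close>

lemma factorization_quotient:
  assumes fact: "factorization M N A B" and sat: "saturated M N m n A"
    and pos: "M > 0" "N > 0" "m > 0" "n > 0" and dvd: "m dvd M" "n dvd N"
  shows "factorization m n (red m n ` A) (red m n ` B) \<and>
    lift_full M N m n (red m n ` A) A \<and> lift_inj M N m n (red m n ` B) B"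
proof -
  have AB: "A \<subseteq> box M N" "B \<subseteq> box M N" "(0, 0) \<in> A" "(0, 0) \<in> B"
    and tiles: "tiles M N A (\<lambda>a. a) B (\<lambda>b. b)"
    using fact by (auto simp: factorization_def)
  note unique = tiles_unique[OF tiles]
  \<comment> \<open>Reducing \<open>z - b\<close> modulo \<open>M\<close>, \<open>N\<close> gives the element of \<open>A\<close> that completes \<open>b\<close> to \<open>z\<close>.\<close>
  have lift: "red M N (z - b) \<in> A" if "a \<in> A" "red m n (a + b) = red m n z" for a b z
  proof -
    have "red m n (z - b) = red m n a"
      using that(2) unfolding red_eq_iff by (simp add: dvd_diff_commute algebra_simps)
    then have "red m n (red M N (z - b)) \<in> red m n ` A" using that(1) dvd by (simp add: red_red)
    then show ?thesis using sat red_in_box[OF pos(1,2)] unfolding saturated_def by blast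
  qed
  have uniq: "b = b'" if b: "a \<in> A" "b \<in> B" "a' \<in> A" "b' \<in> B" "red m n (a + b) = red m n (a' + b')" for a b a' b'
  proof -
    let ?z = "a' + b'"
    have "red M N (red M N (?z - b) + b) = red M N (red M N (?z - b') + b')"
      by (simp add: red_def mod_simps)
    moreover have "red M N (?z - b) \<in> A" "red M N (?z - b') \<in> A"
      using lift[OF b(1) b(5)] lift[OF b(3), of b' "?z"] by simp_all
    ultimately show ?thesis using unique(2) b(2,4) by blast
  qed
  have "inj_on (red m n) B"
    using uniq[of "(0, 0)" _ "(0, 0)"] AB(3) by (auto intro!: inj_onI)
  then have inj: "lift_inj M N m n (red m n ` B) B"
    using AB by (simp add: lift_inj_def bij_betw_def)
  have full: "lift_full M N m n (red m n ` A) A"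
    using sat AB by (auto simp: lift_full_def saturated_def)
  have "tiles m n (red m n ` A) (\<lambda>a. a) (red m n ` B) (\<lambda>b. b)"
  proof (rule tilesI[OF pos(3,4)])
    fix a1 b1 a2 b2
    assume "a1 \<in> red m n ` A" "b1 \<in> red m n ` B" "a2 \<in> red m n ` A" "b2 \<in> red m n ` B"
      and eq: "red m n (a1 + b1) = red m n (a2 + b2)"
    then obtain a b a' b' where ab: "a \<in> A" "b \<in> B" "a' \<in> A" "b' \<in> B"
      "a1 = red m n a" "b1 = red m n b" "a2 = red m n a'" "b2 = red m n b'" by blast
    have "red m n (red m n x + red m n y) = red m n (x + y)" for x y
      by (simp add: red_def mod_simps)
    then have eq': "red m n (a + b) = red m n (a' + b')" using eq ab by simp
    then have "b = b'" using uniq ab by blast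
    then have "red m n a = red m n a'" using eq' unfolding red_eq_iff by simp
    then show "a1 = a2 \<and> b1 = b2" using ab \<open>b = b'\<close> by simp
  next
    fix z assume z: "z \<in> box m n"
    obtain a b where ab: "a \<in> A" "b \<in> B" "red M N (a + b) = red M N z"
      using tiles_ex[OF tiles pos(1,2)] by blast
    have "red m n (red m n a + red m n b) = red m n (red M N (a + b))"
      using dvd by (simp add: red_red) (simp add: red_def mod_simps)
    also have "\<dots> = z" using ab dvd z by (simp add: red_red red_id)
    finally show "\<exists>a\<in>red m n ` A. \<exists>b\<in>red m n ` B. red m n (a + b) = z" using ab by blast
  qed
  moreover have "red m n (0, 0) = (0, 0)" by (simp add: red_def)
  then have "(0, 0) \<in> red m n ` A" "(0, 0) \<in> red m n ` B" using AB by (metis imageI)+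
  moreover have "red m n ` A \<subseteq> box m n" "red m n ` B \<subseteq> box m n" using red_in_box[OF pos(3,4)] by blast+
  ultimately show ?thesis using full inj unfolding factorization_def by simp
qed

text \<open>
  The list consists of exponents: \<open>(a, b)\<close> stands for the moduli \<open>p ^ a\<close> and \<open>2 ^ b\<close>, the largest first.
  The first set is the one that is lifted fully in the topmost step. The two sets change places in the
  recursive call, so full and injective lifts alternate along the chain.
\<close>

fun tower :: "int \<Rightarrow> (nat \<times> nat) list \<Rightarrow> (int \<times> int) set \<Rightarrow> (int \<times> int) set \<Rightarrow> bool" where
  "tower p [] A B = False"
| "tower p [(a, b)] A B = (a = 0 \<and> b = 0 \<and> A = {(0, 0)} \<and> B = {(0, 0)})"
| "tower p ((a', b') # (a, b) # ls) A B =
     (a \<le> a' \<and> b \<le> b' \<and> (a, b) \<noteq> (a', b') \<and>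
      (\<exists>A1 B1. tower p ((a, b) # ls) B1 A1 \<and>
        lift_full (p ^ a') (2 ^ b') (p ^ a) (2 ^ b) A1 A \<and>
        lift_inj (p ^ a') (2 ^ b') (p ^ a) (2 ^ b) B1 B))"

text \<open>
  The case of trivial first modulus is not covered by characters of order divisible by \<open>p\<close>: there one
  of the two factors is the whole group \<open>\<int>\<^sub>2\<close>, because \<open>(0, 1)\<close> is a sum.
\<close>

lemma periodic_factor_exponents:
  assumes p: "prime p" "p > 2" and fact: "factorization (int p ^ a) (2 ^ b) A B"
    and b: "b \<le> 1" and ab: "(a, b) \<noteq> (0, 0)"
  shows "\<exists>a' b'. a' \<le> a \<and> b' \<le> b \<and> (a', b') \<noteq> (a, b) \<and>
    (saturated (int p ^ a) (2 ^ b) (int p ^ a') (2 ^ b') A \<or>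
     saturated (int p ^ a) (2 ^ b) (int p ^ a') (2 ^ b') B)"
proof (cases a)
  case 0
  with ab b have b1: "b = 1" by auto
  have AB: "A \<subseteq> box 1 2" "B \<subseteq> box 1 2" "(0, 0) \<in> A" "(0, 0) \<in> B"
    and tiles: "tiles 1 2 A (\<lambda>a. a) B (\<lambda>b. b)"
    using fact by (auto simp: factorization_def 0 b1)
  obtain u v where uv: "u \<in> A" "v \<in> B" "red 1 2 (u + v) = red 1 2 (0, 1)"
    using tiles_ex[OF tiles, of "(0, 1)"] by auto
  have "u \<in> {(0, 0), (0, 1)}" "v \<in> {(0, 0), (0, 1)}" using uv AB by (auto simp: box_def)
  then have "(0, 1) \<in> A \<or> (0, 1) \<in> B" using uv by (auto simp: red_def)
  moreover have "saturated 1 2 1 1 X" if "(0, 1) \<in> X" "(0, 0) \<in> X" for X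
  proof -
    have "z = (0, 0) \<or> z = (0, 1)" if "z \<in> box 1 2" for z using that by (auto simp: box_def)
    then show ?thesis using that by (auto simp: saturated_def)
  qed
  ultimately show ?thesis
    using AB by (intro exI[of _ 0]) (auto simp: 0 b1)
next
  case (Suc k)
  have n: "(2::int) ^ b = 1 \<or> (2::int) ^ b = 2" "(2::int) ^ b = 2 \<longleftrightarrow> b = 1" using b by (cases b; simp)+
  consider "saturated (int p ^ a) (2 ^ b) (int p ^ k) (2 ^ b) A \<or> saturated (int p ^ a) (2 ^ b) (int p ^ k) (2 ^ b) B"
    | "b = 1" "saturated (int p ^ a) (2 ^ b) (int p ^ a) (2 ^ 0) A \<or> saturated (int p ^ a) (2 ^ b) (int p ^ a) (2 ^ 0) B"
    using periodic_factor[OF p(1) refl n(1), of k A B] fact p n(2) by (auto simp: Suc)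
  then show ?thesis
  proof cases
    case 1
    then show ?thesis by (intro exI[of _ k] exI[of _ b]) (auto simp: Suc)
  next
    case 2
    then show ?thesis by (intro exI[of _ a] exI[of _ 0]) auto
  qed
qed

text \<open>
  When the new step lifts the same set fully as the step below it, the two steps are composed into
  one; this keeps the alternation.
\<close>

lemma tower_extend:
  assumes t: "tower p ((a', b') # ls) A1 B1 \<or> tower p ((a', b') # ls) B1 A1" and p: "p > 0"
    and le: "a' \<le> a" "b' \<le> b" "(a', b') \<noteq> (a, b)"
    and lifts: "lift_full (p ^ a) (2 ^ b) (p ^ a') (2 ^ b') A1 A" "lift_inj (p ^ a) (2 ^ b) (p ^ a') (2 ^ b') B1 B"
  shows "\<exists>ls. tower p ((a, b) # ls) A B"
proof (cases "tower p ((a', b') # ls) B1 A1")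
  case True
  then have "tower p ((a, b) # (a', b') # ls) A B" using le lifts by auto
  then show ?thesis by blast
next
  case False
  then have t: "tower p ((a', b') # ls) A1 B1" using t by simp
  show ?thesis
  proof (cases ls)
    case Nil
    then show ?thesis using t False by auto
  next
    case (Cons L ls')
    obtain a'' b'' where L: "L = (a'', b'')" by (cases L)
    obtain A2 B2 where 2: "tower p ((a'', b'') # ls') B2 A2" "a'' \<le> a'" "b'' \<le> b'" "(a'', b'') \<noteq> (a', b')"
      "lift_full (p ^ a') (2 ^ b') (p ^ a'') (2 ^ b'') A2 A1" "lift_inj (p ^ a') (2 ^ b') (p ^ a'') (2 ^ b'') B2 B1"
      using t unfolding Cons L tower.simps by blast
    have "p ^ a'' dvd p ^ a'" "(2::int) ^ b'' dvd 2 ^ b'" using 2 by (simp_all add: le_imp_power_dvd)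
    then have "lift_full (p ^ a) (2 ^ b) (p ^ a'') (2 ^ b'') A2 A" "lift_inj (p ^ a) (2 ^ b) (p ^ a'') (2 ^ b'') B2 B"
      using lift_full_trans[OF 2(5) lifts(1)] lift_inj_trans[OF 2(6) lifts(2)] p by simp_all
    then have "tower p ((a, b) # (a'', b'') # ls') A B" using 2 le by auto
    then show ?thesis by blast
  qed
qed

lemma factorization_tower:
  assumes p: "prime p" "p > 2" and "factorization (int p ^ a) (2 ^ b) A B" "b \<le> 1"
  shows "\<exists>ls. tower (int p) ((a, b) # ls) A B \<or> tower (int p) ((a, b) # ls) B A"
  using assms(3,4)
proof (induction "a + b" arbitrary: a b A B rule: less_induct)
  case less
  have ppos: "int p > 0" using p by simp
  show ?case
  proof (cases "(a, b) = (0, 0)")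
    case True
    then have "A \<subseteq> {(0, 0)}" "B \<subseteq> {(0, 0)}" "(0, 0) \<in> A" "(0, 0) \<in> B"
      using less.prems(1) by (auto simp: factorization_def box_def)
    then have "tower (int p) [(a, b)] A B" using True by auto
    then show ?thesis by blast
  next
    case False
    have step: "\<exists>ls. tower (int p) ((a, b) # ls) A B"
      if fact: "factorization (int p ^ a) (2 ^ b) A B"
        and le: "a' \<le> a" "b' \<le> b" "(a', b') \<noteq> (a, b)"
        and sat: "saturated (int p ^ a) (2 ^ b) (int p ^ a') (2 ^ b') A" for A B a' b'
    proof -
      let ?A = "red (int p ^ a') (2 ^ b') ` A" and ?B = "red (int p ^ a') (2 ^ b') ` B"
      have q: "factorization (int p ^ a') (2 ^ b') ?A ?B"
        "lift_full (int p ^ a) (2 ^ b) (int p ^ a') (2 ^ b') ?A A"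
        "lift_inj (int p ^ a) (2 ^ b) (int p ^ a') (2 ^ b') ?B B"
        using factorization_quotient[OF fact sat] ppos le by (auto simp: le_imp_power_dvd)
      have "a' + b' < a + b" using le by auto
      then obtain ls where "tower (int p) ((a', b') # ls) ?A ?B \<or> tower (int p) ((a', b') # ls) ?B ?A"
        using less.hyps[of a' b' ?A ?B] q(1) le(2) less.prems(2) by auto
      then show ?thesis using tower_extend[OF _ ppos le q(2,3)] by blast
    qed
    obtain a' b' where le: "a' \<le> a" "b' \<le> b" "(a', b') \<noteq> (a, b)"
      and sat: "saturated (int p ^ a) (2 ^ b) (int p ^ a') (2 ^ b') A \<or>
        saturated (int p ^ a) (2 ^ b) (int p ^ a') (2 ^ b') B"
      using periodic_factor_exponents[OF p less.prems False] by blast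
    then show ?thesis
      using step[OF less.prems(1) le] step[OF factorization_commute[OF less.prems(1)] le] by blast
  qed
qed

text \<open>
  In the lowest step one of the factors is lifted injectively from the trivial group, so it stays
  \<open>{0}\<close>, and from then on all its elements reduce to \<open>0\<close> modulo the second smallest moduli. Which
  factor this is depends on the parity of the number of steps.
\<close>

lemma tower_bottom:
  assumes "tower p ls A B" "length ls \<ge> 2" "p > 0"
  shows "\<exists>a b. (a, b) \<noteq> (0, 0) \<and> a \<le> fst (hd ls) \<and> b \<le> snd (hd ls) \<and>
    (\<forall>z\<in>(if even (length ls) then B else A). red (p ^ a) (2 ^ b) z = (0, 0))"
  using assms
proof (induction p ls A B rule: tower.induct)
  case (3 p a' b' a b ls A B)
  obtain A1 B1 where t: "tower p ((a, b) # ls) B1 A1" and le: "a \<le> a'" "b \<le> b'" "(a, b) \<noteq> (a', b')"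
    and lifts: "lift_full (p ^ a') (2 ^ b') (p ^ a) (2 ^ b) A1 A" "lift_inj (p ^ a') (2 ^ b') (p ^ a) (2 ^ b) B1 B"
    using "3.prems"(1) by auto
  show ?case
  proof (cases ls)
    case Nil
    then have "a = 0" "b = 0" "B1 = {(0, 0)}" using t by auto
    then have "B = {(0, 0)}" using lifts(2) unfolding lift_inj_def bij_betw_def
      by (auto simp: red_def inj_on_def)
    then show ?thesis using le \<open>a = 0\<close> \<open>b = 0\<close> Nil
      by (intro exI[of _ a'] exI[of _ b']) (auto simp: red_def)
  next
    case (Cons L ls')
    then have "2 \<le> length ((a, b) # ls)" by simp
    then obtain c d where cd: "(c, d) \<noteq> (0, 0)" "c \<le> a" "d \<le> b"
      "\<forall>z\<in>(if even (length ((a, b) # ls)) then A1 else B1). red (p ^ c) (2 ^ d) z = (0, 0)"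
      using "3.IH"[OF t] "3.prems"(3) by auto
    have "red (p ^ a) (2 ^ b) z \<in> A1" if "z \<in> A" for z
      using lifts(1) that by (auto simp: lift_full_def)
    moreover have "red (p ^ a) (2 ^ b) z \<in> B1" if "z \<in> B" for z
      using lifts(2) that by (auto simp: lift_inj_def bij_betw_def)
    moreover have "red (p ^ c) (2 ^ d) (red (p ^ a) (2 ^ b) z) = red (p ^ c) (2 ^ d) z" for z
      using cd by (intro red_red) (auto simp: le_imp_power_dvd)
    ultimately have "\<forall>z\<in>(if even (length ((a', b') # (a, b) # ls)) then B else A). red (p ^ c) (2 ^ d) z = (0, 0)"
      using cd(4) by (auto split: if_splits) metis+
    then show ?thesis using cd le by (intro exI[of _ c] exI[of _ d]) auto
  qed
qed auto


section \<open>Chains of divisors of twice the cube of a prime\<close>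

text \<open>
  The condition that \<open>tower\<close> imposes on its list of exponents alone.
\<close>

fun descending :: "(nat \<times> nat) list \<Rightarrow> bool" where
  "descending [] = False"
| "descending [(a, b)] = (a = 0 \<and> b = 0)"
| "descending ((a', b') # (a, b) # ls) =
     (a \<le> a' \<and> b \<le> b' \<and> (a, b) \<noteq> (a', b') \<and> descending ((a, b) # ls))"

lemma tower_descending: "tower p ls A B \<Longrightarrow> descending ls"
  by (induction p ls A B rule: tower.induct) auto

lemma descending_Cons_iff:
  "descending ((a', b') # ls) \<longleftrightarrow> a' = 0 \<and> b' = 0 \<and> ls = [] \<or>
     (\<exists>a\<in>{0..a'}. \<exists>b\<in>{0..b'}. \<exists>ls'. (a, b) \<noteq> (a', b') \<and> ls = (a, b) # ls' \<and> descending ((a, b) # ls'))"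
proof (cases ls)
  case (Cons L ls')
  then show ?thesis by (cases L) auto
qed simp

lemma upto_simps:
  "{0..0::nat} = {0}" "{0..Suc 0} = {0, 1}" "{0..2::nat} = {0, 1, 2}" "{0..3::nat} = {0, 1, 2, 3}"
  by auto

lemma descending_0_0: "descending ((0, 0) # ls) \<longleftrightarrow> ls = []"
  by (subst descending_Cons_iff) auto

lemma descending_1_0: "descending ((1, 0) # ls) \<longleftrightarrow> ls = [(0, 0)]"
  by (subst descending_Cons_iff) (auto simp: upto_simps descending_0_0)

lemma descending_0_1: "descending ((0, 1) # ls) \<longleftrightarrow> ls = [(0, 0)]"
  by (subst descending_Cons_iff) (auto simp: upto_simps descending_0_0)

lemma descending_2_0: "descending ((2, 0) # ls) \<longleftrightarrow> ls \<in> {[(0, 0)], [(1, 0), (0, 0)]}"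
  by (subst descending_Cons_iff) (auto simp: upto_simps descending_0_0 descending_1_0[simplified])

lemma descending_3_0:
  "descending ((3, 0) # ls) \<longleftrightarrow>
     ls \<in> {[(0, 0)], [(1, 0), (0, 0)], [(2, 0), (0, 0)], [(2, 0), (1, 0), (0, 0)]}"
  by (subst descending_Cons_iff)
    (auto simp: upto_simps descending_0_0 descending_1_0[simplified] descending_2_0)

lemma descending_1_1:
  "descending ((1, 1) # ls) \<longleftrightarrow> ls \<in> {[(0, 0)], [(1, 0), (0, 0)], [(0, 1), (0, 0)]}"
  by (subst descending_Cons_iff)
    (auto simp: upto_simps descending_0_0 descending_1_0[simplified] descending_0_1[simplified])

lemma descending_2_1:
  "descending ((2, 1) # ls) \<longleftrightarrow>
     ls \<in> {[(0, 0)], [(1, 0), (0, 0)], [(0, 1), (0, 0)], [(2, 0), (0, 0)], [(2, 0), (1, 0), (0, 0)],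
           [(1, 1), (0, 0)], [(1, 1), (1, 0), (0, 0)], [(1, 1), (0, 1), (0, 0)]}"
  by (subst descending_Cons_iff)
    (auto simp: upto_simps descending_0_0 descending_1_0[simplified] descending_0_1[simplified]
      descending_2_0 descending_1_1[simplified])

text \<open>
  These are the ordered factorizations of \<open>2 p\<^sup>3\<close>, of which there are twenty.
\<close>

lemma descending_3_1:
  assumes "descending ((3, 1) # ls)"
  shows "ls \<in> {[(0, 0)],
    [(1, 0), (0, 0)], [(0, 1), (0, 0)], [(2, 0), (0, 0)], [(1, 1), (0, 0)], [(3, 0), (0, 0)], [(2, 1), (0, 0)],
    [(2, 1), (1, 0), (0, 0)], [(3, 0), (1, 0), (0, 0)], [(2, 1), (0, 1), (0, 0)],
    [(2, 1), (2, 0), (0, 0)], [(1, 1), (1, 0), (0, 0)], [(3, 0), (2, 0), (0, 0)],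
    [(2, 1), (1, 1), (0, 0)], [(2, 0), (1, 0), (0, 0)], [(1, 1), (0, 1), (0, 0)],
    [(3, 0), (2, 0), (1, 0), (0, 0)], [(2, 1), (1, 1), (1, 0), (0, 0)],
    [(2, 1), (2, 0), (1, 0), (0, 0)], [(2, 1), (1, 1), (0, 1), (0, 0)]}"
  using assms
  by (subst (asm) descending_Cons_iff)
    (auto simp: upto_simps descending_0_0 descending_1_0[simplified] descending_0_1[simplified]
      descending_2_0 descending_3_0 descending_1_1[simplified] descending_2_1[simplified])

section \<open>Lifting parametrized sets\<close>

text \<open>
  All the sets of the classification have this form, and so do their images in the quotients.
\<close>

definition family :: "int \<Rightarrow> int \<Rightarrow> 'u set \<Rightarrow> ('u \<Rightarrow> int) \<Rightarrow> ('u \<Rightarrow> int) \<Rightarrow> (int \<times> int) set" where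
  "family M N U f g = (\<lambda>u. red M N (f u, g u)) ` U"

lemma family_single: "family M N {()} (\<lambda>_. 0) (\<lambda>_. 0) = {(0, 0)}"
  by (simp add: family_def red_def)

lemma atLeastLessThan_0_1_int: "{0..<1::int} = {0}"
  by auto

lemma family_reindex:
  assumes "U = h ` V" "\<And>v. v \<in> V \<Longrightarrow> f (h v) = f' v \<and> g (h v) = g' v"
  shows "family M N U f g = family M N V f' g'"
  unfolding family_def assms(1) image_image by (rule image_cong) (auto simp: assms(2))

text \<open>
  The points above a given point are obtained by adding the multiples of the old moduli below the new
  ones. Thus a full lift adds two indices, one for each modulus; an index is superfluous if its modulus
  does not grow.
\<close>

lemma lift_full_family:
  assumes "lift_full M N m n A1 A" "A1 = family m n U f g"
    and M: "M = m * q" and N: "N = n * r" and pos: "m > 0" "q > 0" "n > 0" "r > 0"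
  shows "A = family M N (U \<times> {0..<q} \<times> {0..<r}) (\<lambda>(u, j, k). f u + j * m) (\<lambda>(u, j, k). g u + k * n)"
proof -
  have "z \<in> family M N (U \<times> {0..<q} \<times> {0..<r}) (\<lambda>(u, j, k). f u + j * m) (\<lambda>(u, j, k). g u + k * n)"
    if z: "z \<in> box M N" "u \<in> U" "red m n z = red m n (f u, g u)" for z u
  proof -
    obtain s t where st: "fst z - f u = m * s" "snd z - g u = n * t"
      using z(3) unfolding red_eq_iff by (auto elim!: dvdE)
    have "red M N (f u + (s mod q) * m, g u + (t mod r) * n) = red M N z"
    proof -
      have "(f u + (s mod q) * m) - fst z = - (m * (s - s mod q))"
        "(g u + (t mod r) * n) - snd z = - (n * (t - t mod r))"
        using st by (simp_all add: algebra_simps)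
      then show ?thesis unfolding red_eq_iff M N fst_conv snd_conv
        by (simp add: dvd_minus_mod)
    qed
    then have "z = red M N (f u + (s mod q) * m, g u + (t mod r) * n)" using red_id[OF z(1)] by simp
    then show ?thesis unfolding family_def
      using z(2) pos by (intro image_eqI[of _ _ "(u, s mod q, t mod r)"]) auto
  qed
  moreover have "red m n (red M N (f u + j * m, g u + k * n)) = red m n (f u, g u)" for u j k
    unfolding M N by (subst red_red) (auto simp: red_eq_iff)
  moreover have "M > 0" and "N > 0" using M N pos by auto
  note facts = calculation this
  show ?thesis
  proof
    show "A \<subseteq> family M N (U \<times> {0..<q} \<times> {0..<r}) (\<lambda>(u, j, k). f u + j * m) (\<lambda>(u, j, k). g u + k * n)"
    proof
      fix z assume "z \<in> A"
      then obtain u where "z \<in> box M N" "u \<in> U" "red m n z = red m n (f u, g u)"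
        using assms(1) unfolding lift_full_def assms(2) family_def by blast
      then show "z \<in> family M N (U \<times> {0..<q} \<times> {0..<r}) (\<lambda>(u, j, k). f u + j * m) (\<lambda>(u, j, k). g u + k * n)"
        by (rule facts(1))
    qed
    show "family M N (U \<times> {0..<q} \<times> {0..<r}) (\<lambda>(u, j, k). f u + j * m) (\<lambda>(u, j, k). g u + k * n) \<subseteq> A"
      unfolding family_def
    proof (rule image_subsetI)
      fix v assume "v \<in> U \<times> {0..<q} \<times> {0..<r}"
      then obtain u j k where v: "v = (u, j, k)" "u \<in> U" by blast
      have "red M N (f u + j * m, g u + k * n) \<in> A"
        using assms(1) facts(2) v(2) red_in_box[OF facts(3,4)]
        unfolding lift_full_def assms(2) family_def by simp
      then show "red M N (case v of (u, j, k) \<Rightarrow> f u + j * m, case v of (u, j, k) \<Rightarrow> g u + k * n) \<in> A"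
        by (simp add: v)
    qed
  qed
qed

lemma lift_full_family_p:
  assumes "lift_full M n m n A1 A" "A1 = family m n U f g" "M = m * q" "m > 0" "q > 0" "n > 0"
  shows "A = family M n (U \<times> {0..<q}) (\<lambda>(u, j). f u + j * m) (\<lambda>(u, j). g u)"
proof -
  have "A = family M n (U \<times> {0..<q} \<times> {0..<1}) (\<lambda>(u, j, k). f u + j * m) (\<lambda>(u, j, k). g u + k * n)"
    by (rule lift_full_family[OF assms(1,2)]) (use assms in auto)
  also have "\<dots> = family M n (U \<times> {0..<q}) (\<lambda>(u, j). f u + j * m) (\<lambda>(u, j). g u)"
    by (rule family_reindex[where h = "\<lambda>(u, j). (u, j, 0)"]) (auto simp: atLeastLessThan_0_1_int image_def)
  finally show ?thesis .
qed

lemma lift_full_family_p2: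
  assumes "lift_full M 2 m 1 A1 A" "A1 = family m 1 U f (\<lambda>_. 0)" "M = m * q" "m > 0" "q > 0"
  shows "A = family M 2 (U \<times> {0..<q} \<times> {0..<2}) (\<lambda>(u, j, k). f u + j * m) (\<lambda>(u, j, k). k)"
proof -
  have "A = family M 2 (U \<times> {0..<q} \<times> {0..<2}) (\<lambda>(u, j, k). f u + j * m) (\<lambda>(u, j, k). 0 + k * 1)"
    by (rule lift_full_family[OF assms(1,2)]) (use assms in auto)
  then show ?thesis by simp
qed

lemma lift_full_family_2:
  assumes "lift_full m 2 m 1 A1 A" "A1 = family m 1 U f (\<lambda>_. 0)" "m > 0"
  shows "A = family m 2 (U \<times> {0..<2}) (\<lambda>(u, k). f u) (\<lambda>(u, k). k)"
proof -
  have "A = family m 2 (U \<times> {0..<1} \<times> {0..<2}) (\<lambda>(u, j, k). f u + j * m) (\<lambda>(u, j, k). k)"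
    by (rule lift_full_family_p2[OF assms(1,2)]) (use assms in auto)
  also have "\<dots> = family m 2 (U \<times> {0..<2}) (\<lambda>(u, k). f u) (\<lambda>(u, k). k)"
    by (rule family_reindex[where h = "\<lambda>(u, k). (u, 0, k)"]) (auto simp: atLeastLessThan_0_1_int image_def)
  finally show ?thesis .
qed

lemma lift_full_zero_p:
  assumes "lift_full M n m n {(0, 0)} A" "M = m * q" "m > 0" "q > 0" "n > 0"
  shows "A = family M n {0..<q} (\<lambda>j. j * m) (\<lambda>_. 0)"
  unfolding lift_full_family_p[OF assms(1) family_single[symmetric] assms(2-)]
  by (rule family_reindex[where h = "\<lambda>j. ((), j)"]) auto

lemma lift_full_zero_2:
  assumes "lift_full m 2 m 1 {(0, 0)} A" "m > 0"
  shows "A = family m 2 {0..<2} (\<lambda>_. 0) (\<lambda>k. k)"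
  unfolding lift_full_family_2[OF assms(1) family_single[symmetric] assms(2)]
  by (rule family_reindex[where h = "\<lambda>k. ((), k)"]) auto

lemma lift_full_zero_p2:
  assumes "lift_full M 2 m 1 {(0, 0)} A" "M = m * q" "m > 0" "q > 0"
  shows "A = family M 2 ({0..<q} \<times> {0..<2}) (\<lambda>(j, k). j * m) (\<lambda>(j, k). k)"
  unfolding lift_full_family_p2[OF assms(1) family_single[symmetric] assms(2-)]
  by (rule family_reindex[where h = "\<lambda>(j, k). ((), j, k)"]) auto

lemma lift_inj_zero: "lift_inj M N m n {(0, 0)} B \<Longrightarrow> B = {(0, 0)}"
proof -
  assume "lift_inj M N m n {(0, 0)} B"
  then have B: "(0, 0) \<in> B" "inj_on (red m n) B" "red m n ` B = {(0, 0)}"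
    by (auto simp: lift_inj_def bij_betw_def)
  have "b = (0, 0)" if "b \<in> B" for b
  proof -
    have "red m n b \<in> {(0, 0)}" "red m n (0, 0) \<in> {(0, 0)}"
      using that B(1) unfolding B(3)[symmetric] by (auto intro: imageI)
    then show ?thesis using inj_onD[OF B(2) _ that B(1)] by simp
  qed
  then show ?thesis using B(1) by blast
qed

text \<open>
  Every index has a unique point above it, which differs from \<open>(f u, g u)\<close> by multiples of the old
  moduli; these multiples are the new parameters. At the index of the zero element they vanish, because
  the zero element belongs to the lifted set.
\<close>

lemma lift_inj_family:
  assumes inj: "lift_inj M N m n B1 B" and B1: "B1 = family m n U f g" and w: "w \<in> U" "f w = 0" "g w = 0"
  shows "\<exists>s t. s w = 0 \<and> t w = 0 \<and> B = family M N U (\<lambda>u. f u + s u * m) (\<lambda>u. g u + t u * n)"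
proof -
  have B: "B \<subseteq> box M N" "(0, 0) \<in> B" "inj_on (red m n) B" "red m n ` B = B1"
    using inj by (auto simp: lift_inj_def bij_betw_def)
  define D where "D u = inv_into B (red m n) (red m n (f u, g u))" for u
  have D: "D u \<in> B" "red m n (D u) = red m n (f u, g u)" if "u \<in> U" for u
  proof -
    have "red m n (f u, g u) \<in> red m n ` B" using that unfolding B B1 family_def by blast
    then show "D u \<in> B" "red m n (D u) = red m n (f u, g u)"
      unfolding D_def by (rule inv_into_into, rule f_inv_into_f)
  qed
  have D0: "D w = (0, 0)"
    using inj_onD[OF B(3) _ D(1)[OF w(1)] B(2)] D(2)[OF w(1)] w by simp
  have DB: "D ` U = B"
  proof
    show "D ` U \<subseteq> B" using D by blast
    show "B \<subseteq> D ` U"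
    proof
      fix b assume b: "b \<in> B"
      then obtain u where u: "u \<in> U" "red m n b = red m n (f u, g u)"
        using B(4) unfolding B1 family_def by blast
      then have "b = D u" using inj_onD[OF B(3)] D b by metis
      then show "b \<in> D ` U" using u by blast
    qed
  qed
  define s t where "s u = (fst (D u) - f u) div m" and "t u = (snd (D u) - g u) div n" for u
  have "D u = red M N (f u + s u * m, g u + t u * n)" if "u \<in> U" for u
  proof -
    have "f u + s u * m = fst (D u)" "g u + t u * n = snd (D u)"
      using D(2)[OF that] unfolding red_eq_iff s_def t_def by simp_all
    then show ?thesis using red_id[of "D u" M N] D(1)[OF that] B(1) by auto
  qed
  then have "B = family M N U (\<lambda>u. f u + s u * m) (\<lambda>u. g u + t u * n)"
    unfolding family_def DB[symmetric] by (intro image_cong) auto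
  moreover have "s w = 0" "t w = 0" by (simp_all add: s_def t_def D0 w)
  ultimately show ?thesis by blast
qed

lemma lift_inj_family_p:
  assumes "lift_inj M n m n B1 B" "B1 = family m n U f g" "w \<in> U" "f w = 0" "g w = 0"
  shows "\<exists>a. a w = 0 \<and> B = family M n U (\<lambda>u. f u + a u * m) g"
proof -
  obtain s t where st: "s w = 0" "B = family M n U (\<lambda>u. f u + s u * m) (\<lambda>u. g u + t u * n)"
    using lift_inj_family[OF assms] by blast
  have "family M n U (\<lambda>u. f u + s u * m) (\<lambda>u. g u + t u * n) = family M n U (\<lambda>u. f u + s u * m) g"
    by (simp add: family_def red_def)
  then show ?thesis using st by auto
qed

text \<open>
  When both moduli grow, the Chinese remainder theorem combines the two new parameters into one
  integer \<open>a u\<close>, with \<open>a u\<close> congruent to \<open>s u\<close> modulo the odd number \<open>q\<close> and to \<open>t u\<close> modulo \<open>2\<close>. This is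
  why a single letter occurs in both coordinates.
\<close>

lemma lift_inj_family_p2:
  assumes "lift_inj M 2 m 1 B1 B" "B1 = family m 1 U f (\<lambda>_. 0)" "w \<in> U" "f w = 0" "M = m * q" "odd q"
  shows "\<exists>a. a w = 0 \<and> B = family M 2 U (\<lambda>u. f u + a u * m) a"
proof -
  obtain s t where st: "s w = 0" "t w = 0" "B = family M 2 U (\<lambda>u. f u + s u * m) (\<lambda>u. 0 + t u * 1)"
    using lift_inj_family[OF assms(1-4)] by blast
  \<comment> \<open>Modulo \<open>q\<close> the second summand vanishes; modulo \<open>2\<close> the sum is \<open>s u + s u + t u\<close>, as \<open>q\<close> is odd.\<close>
  define a where "a u = s u + q * (s u + t u)" for u
  have "red M 2 (f u + a u * m, a u) = red M 2 (f u + s u * m, 0 + t u * 1)" for u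
    using assms(6) unfolding red_eq_iff a_def assms(5) by (simp add: algebra_simps) blast
  then have "B = family M 2 U (\<lambda>u. f u + a u * m) a" unfolding st(3) family_def by simp
  moreover have "a w = 0" using st by (simp add: a_def)
  ultimately show ?thesis by blast
qed

lemma lift_inj_family_2:
  assumes "lift_inj m 2 m 1 B1 B" "B1 = family m 1 U f (\<lambda>_. 0)" "w \<in> U" "f w = 0"
  shows "\<exists>a. a w = 0 \<and> B = family m 2 U f a"
proof -
  obtain a where "a w = 0" "B = family m 2 U (\<lambda>u. f u + a u * m) a"
    using lift_inj_family_p2[OF assms, of 1] by auto
  moreover have "family m 2 U (\<lambda>u. f u + a u * m) a = family m 2 U f a"
    by (simp add: family_def red_def)
  ultimately show ?thesis by auto
qed

section \<open>From chains to parametrized pairs\<close>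

text \<open>
  The index added by the lift is placed in the middle, as in the family with three indices whose
  parameter depends on the first and the last one.
\<close>

lemma lift_full_family_p_pair:
  assumes "lift_full M n m n A1 A" "A1 = family m n (I \<times> K) (\<lambda>(i, k). f i k) (\<lambda>(i, k). g i k)"
    and "M = m * q" "m > 0" "q > 0" "n > 0"
  shows "A = family M n (I \<times> {0..<q} \<times> K) (\<lambda>(i, j, k). f i k + j * m) (\<lambda>(i, j, k). g i k)"
  unfolding lift_full_family_p[OF assms]
proof (rule family_reindex[where h = "\<lambda>(i, j, k). ((i, k), j)"])
  show "(I \<times> K) \<times> {0..<q} = (\<lambda>(i, j, k). ((i, k), j)) ` (I \<times> {0..<q} \<times> K)"
  proof (rule equalityI)
    show "(I \<times> K) \<times> {0..<q} \<subseteq> (\<lambda>(i, j, k). ((i, k), j)) ` (I \<times> {0..<q} \<times> K)"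
    proof
      fix z assume "z \<in> (I \<times> K) \<times> {0..<q}"
      then obtain i j k where "z = ((i, k), j)" "(i, j, k) \<in> I \<times> {0..<q} \<times> K" by auto
      then show "z \<in> (\<lambda>(i, j, k). ((i, k), j)) ` (I \<times> {0..<q} \<times> K)"
        by (metis (mono_tags, lifting) case_prod_conv image_eqI)
    qed
  qed auto
qed auto

lemma elt_family_1: "{elt p (f i) (g i) |i. i \<in> I} = family (int p ^ 3) 2 I f g"
  by (simp add: family_def elt_def red_def Setcompr_eq_image)

lemma elt_family_2:
  "{elt p (f i j) (g i j) |i j. i \<in> I \<and> j \<in> J} =
    family (int p ^ 3) 2 (I \<times> J) (\<lambda>(i, j). f i j) (\<lambda>(i, j). g i j)"
  by (auto simp: family_def elt_def red_def image_def)

lemma elt_family_3: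
  "{elt p (f i j k) (g i j k) |i j k. i \<in> I \<and> j \<in> J \<and> k \<in> K} =
    family (int p ^ 3) 2 (I \<times> J \<times> K) (\<lambda>(i, j, k). f i j k) (\<lambda>(i, j, k). g i j k)"
  by (auto simp: family_def elt_def red_def image_def)

lemmas elt_families = elt_family_1 elt_family_2 elt_family_3

context
  fixes p :: nat
  assumes p: "p > 0" "odd p"
begin

lemmas steps = p power2_eq_square power3_eq_cube case_prod_unfold

text \<open>
  For each chain the two sets are followed upwards from \<open>{0}\<close>. With \<open>S1\<close>, \<open>C1\<close>, \<open>S2\<close>, \<open>C2\<close> and so on as
  the reductions of \<open>S\<close> and \<open>C\<close>, each step applies a full lift to one of them and an injective lift to the
  other; \<open>a\<close> and \<open>b\<close> are the parameters added to \<open>S\<close> and \<open>l\<close> those added to \<open>C\<close>. The set that comes first in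
  \<open>tower\<close> is \<open>S\<close> exactly when the number of steps is odd.
\<close>

lemma tower_imp_pair1:
  assumes "tower (int p) [(3, 1), (1, 0), (0, 0)] C S"
  shows "listed_pair p S C"
proof -
  from assms obtain S1 C1 where
    s1: "lift_full (int p) 1 1 1 {(0, 0)} S1"
    and c1: "lift_inj (int p) 1 1 1 {(0, 0)} C1"
    and c2: "lift_full (int p ^ 3) 2 (int p) 1 C1 C"
    and s2: "lift_inj (int p ^ 3) 2 (int p) 1 S1 S"
    unfolding tower.simps power_0 power_one_right by blast
  have S1: "S1 = family (int p) 1 {0..<int p}
      (\<lambda>i. i) (\<lambda>_. 0)"
    using lift_full_zero_p[OF s1, where q = "int p"] by (simp add: steps)
  have C1: "C1 = {(0, 0)}"
    using lift_inj_zero[OF c1] by simp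
  have C2: "C = family (int p ^ 3) 2 ({0..<(int p)\<^sup>2} \<times> {0..<2})
      (\<lambda>(i, j). i * int p) (\<lambda>(i, j). j)"
    using lift_full_zero_p2[OF c2[unfolded C1], where q = "int p ^ 2"] by (simp add: steps)
  obtain a where a: "a 0 = 0"
    and S2: "S = family (int p ^ 3) 2 {0..<int p}
      (\<lambda>i. i + a i * int p) (\<lambda>i. a i)"
    using lift_inj_family_p2[OF s2 S1, where w = "0" and q = "int p ^ 2"] by (auto simp: steps)
  show ?thesis
    using listed_pair.pair1[of a p, unfolded elt_families] a
    by (simp add: S2 C2 case_prod_unfold)
qed

lemma tower_imp_pair2:
  assumes "tower (int p) [(3, 1), (0, 1), (0, 0)] C S"
  shows "listed_pair p S C"
proof -
  from assms obtain S1 C1 where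
    s1: "lift_full 1 2 1 1 {(0, 0)} S1"
    and c1: "lift_inj 1 2 1 1 {(0, 0)} C1"
    and c2: "lift_full (int p ^ 3) 2 1 2 C1 C"
    and s2: "lift_inj (int p ^ 3) 2 1 2 S1 S"
    unfolding tower.simps power_0 power_one_right by blast
  have S1: "S1 = family 1 2 {0..<2}
      (\<lambda>_. 0) (\<lambda>i. i)"
    using lift_full_zero_2[OF s1] by (simp add: steps)
  have C1: "C1 = {(0, 0)}"
    using lift_inj_zero[OF c1] by simp
  have C2: "C = family (int p ^ 3) 2 {0..<int p ^ 3}
      (\<lambda>i. i) (\<lambda>_. 0)"
    using lift_full_zero_p[OF c2[unfolded C1], where q = "int p ^ 3"] by (simp add: steps)
  obtain a where a: "a 0 = 0"
    and S2: "S = family (int p ^ 3) 2 {0..<2}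
      (\<lambda>i. a i) (\<lambda>i. i)"
    using lift_inj_family_p[OF s2 S1, where w = "0"] by (auto simp: steps)
  show ?thesis
    using listed_pair.pair2[of a p, unfolded elt_families] a
    by (simp add: S2 C2 case_prod_unfold)
qed

lemma tower_imp_pair3:
  assumes "tower (int p) [(3, 1), (2, 1), (1, 0), (0, 0)] S C"
  shows "listed_pair p S C"
proof -
  from assms obtain S1 C1 S2 C2 where
    s1: "lift_full (int p) 1 1 1 {(0, 0)} S1"
    and c1: "lift_inj (int p) 1 1 1 {(0, 0)} C1"
    and c2: "lift_full (int p ^ 2) 2 (int p) 1 C1 C2"
    and s2: "lift_inj (int p ^ 2) 2 (int p) 1 S1 S2"
    and s3: "lift_full (int p ^ 3) 2 (int p ^ 2) 2 S2 S"
    and c3: "lift_inj (int p ^ 3) 2 (int p ^ 2) 2 C2 C"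
    unfolding tower.simps power_0 power_one_right by blast
  have S1: "S1 = family (int p) 1 {0..<int p}
      (\<lambda>i. i) (\<lambda>_. 0)"
    using lift_full_zero_p[OF s1, where q = "int p"] by (simp add: steps)
  have C1: "C1 = {(0, 0)}"
    using lift_inj_zero[OF c1] by simp
  have C2: "C2 = family ((int p)\<^sup>2) 2 ({0..<int p} \<times> {0..<2})
      (\<lambda>(i, j). i * int p) (\<lambda>(i, j). j)"
    using lift_full_zero_p2[OF c2[unfolded C1], where q = "int p"] by (simp add: steps)
  obtain a where a: "a 0 = 0"
    and S2: "S2 = family ((int p)\<^sup>2) 2 {0..<int p}
      (\<lambda>i. i + a i * int p) (\<lambda>i. a i)"
    using lift_inj_family_p2[OF s2 S1, where w = "0" and q = "int p"] by (auto simp: steps)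
  have S3: "S = family (int p ^ 3) 2 ({0..<int p} \<times> {0..<int p})
      (\<lambda>(i, j). i + a i * int p + j * (int p)\<^sup>2) (\<lambda>(i, j). a i)"
    using lift_full_family_p[OF s3 S2, where q = "int p"] by (simp add: steps)
  obtain l where l: "l (0, 0) = 0"
    and C3: "C = family (int p ^ 3) 2 ({0..<int p} \<times> {0..<2})
      (\<lambda>(i, j). i * int p + l (i, j) * (int p)\<^sup>2) (\<lambda>(i, j). j)"
    using lift_inj_family_p[OF c3 C2, where w = "(0, 0)"] by (auto simp: steps)
  show ?thesis
    using listed_pair.pair3[of a "curry l" p, unfolded elt_families] a l
    by (simp add: S3 C3 case_prod_unfold)
qed

lemma tower_imp_pair4:
  assumes "tower (int p) [(3, 1), (3, 0), (2, 0), (1, 0), (0, 0)] C S"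
  shows "listed_pair p S C"
proof -
  from assms obtain S1 C1 S2 C2 S3 C3 where
    s1: "lift_full (int p) 1 1 1 {(0, 0)} S1"
    and c1: "lift_inj (int p) 1 1 1 {(0, 0)} C1"
    and c2: "lift_full (int p ^ 2) 1 (int p) 1 C1 C2"
    and s2: "lift_inj (int p ^ 2) 1 (int p) 1 S1 S2"
    and s3: "lift_full (int p ^ 3) 1 (int p ^ 2) 1 S2 S3"
    and c3: "lift_inj (int p ^ 3) 1 (int p ^ 2) 1 C2 C3"
    and c4: "lift_full (int p ^ 3) 2 (int p ^ 3) 1 C3 C"
    and s4: "lift_inj (int p ^ 3) 2 (int p ^ 3) 1 S3 S"
    unfolding tower.simps power_0 power_one_right by blast
  have S1: "S1 = family (int p) 1 {0..<int p}
      (\<lambda>i. i) (\<lambda>_. 0)"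
    using lift_full_zero_p[OF s1, where q = "int p"] by (simp add: steps)
  have C1: "C1 = {(0, 0)}"
    using lift_inj_zero[OF c1] by simp
  have C2: "C2 = family ((int p)\<^sup>2) 1 {0..<int p}
      (\<lambda>i. i * int p) (\<lambda>_. 0)"
    using lift_full_zero_p[OF c2[unfolded C1], where q = "int p"] by (simp add: steps)
  obtain a where a: "a 0 = 0"
    and S2: "S2 = family ((int p)\<^sup>2) 1 {0..<int p}
      (\<lambda>i. i + a i * int p) (\<lambda>_. 0)"
    using lift_inj_family_p[OF s2 S1, where w = "0"] by (auto simp: steps)
  have S3: "S3 = family (int p ^ 3) 1 ({0..<int p} \<times> {0..<int p})
      (\<lambda>(i, j). i + a i * int p + j * (int p)\<^sup>2) (\<lambda>_. 0)"
    using lift_full_family_p[OF s3 S2, where q = "int p"] by (simp add: steps)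
  obtain l where l: "l 0 = 0"
    and C3: "C3 = family (int p ^ 3) 1 {0..<int p}
      (\<lambda>i. i * int p + l i * (int p)\<^sup>2) (\<lambda>_. 0)"
    using lift_inj_family_p[OF c3 C2, where w = "0"] by (auto simp: steps)
  have C4: "C = family (int p ^ 3) 2 ({0..<int p} \<times> {0..<2})
      (\<lambda>(i, j). i * int p + l i * (int p)\<^sup>2) (\<lambda>(i, j). j)"
    using lift_full_family_2[OF c4 C3] by (simp add: steps)
  obtain b where b: "b (0, 0) = 0"
    and S4: "S = family (int p ^ 3) 2 ({0..<int p} \<times> {0..<int p})
      (\<lambda>(i, j). i + a i * int p + j * (int p)\<^sup>2) (\<lambda>(i, j). b (i, j))"
    using lift_inj_family_2[OF s4 S3, where w = "(0, 0)"] a by (auto simp: steps)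
  show ?thesis
    using listed_pair.pair4[of a "curry b" l p, unfolded elt_families] a b l
    by (simp add: S4 C4 case_prod_unfold)
qed

lemma tower_imp_pair5:
  assumes "tower (int p) [(3, 1), (2, 1), (1, 1), (1, 0), (0, 0)] C S"
  shows "listed_pair p S C"
proof -
  from assms obtain S1 C1 S2 C2 S3 C3 where
    s1: "lift_full (int p) 1 1 1 {(0, 0)} S1"
    and c1: "lift_inj (int p) 1 1 1 {(0, 0)} C1"
    and c2: "lift_full (int p) 2 (int p) 1 C1 C2"
    and s2: "lift_inj (int p) 2 (int p) 1 S1 S2"
    and s3: "lift_full (int p ^ 2) 2 (int p) 2 S2 S3"
    and c3: "lift_inj (int p ^ 2) 2 (int p) 2 C2 C3"
    and c4: "lift_full (int p ^ 3) 2 (int p ^ 2) 2 C3 C"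
    and s4: "lift_inj (int p ^ 3) 2 (int p ^ 2) 2 S3 S"
    unfolding tower.simps power_0 power_one_right by blast
  have S1: "S1 = family (int p) 1 {0..<int p}
      (\<lambda>i. i) (\<lambda>_. 0)"
    using lift_full_zero_p[OF s1, where q = "int p"] by (simp add: steps)
  have C1: "C1 = {(0, 0)}"
    using lift_inj_zero[OF c1] by simp
  have C2: "C2 = family (int p) 2 {0..<2}
      (\<lambda>_. 0) (\<lambda>i. i)"
    using lift_full_zero_2[OF c2[unfolded C1]] by (simp add: steps)
  obtain a where a: "a 0 = 0"
    and S2: "S2 = family (int p) 2 {0..<int p}
      (\<lambda>i. i) (\<lambda>i. a i)"
    using lift_inj_family_2[OF s2 S1, where w = "0"] by (auto simp: steps)
  have S3: "S3 = family ((int p)\<^sup>2) 2 ({0..<int p} \<times> {0..<int p})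
      (\<lambda>(i, j). i + j * int p) (\<lambda>(i, j). a i)"
    using lift_full_family_p[OF s3 S2, where q = "int p"] by (simp add: steps)
  obtain l where l: "l 0 = 0"
    and C3: "C3 = family ((int p)\<^sup>2) 2 {0..<2}
      (\<lambda>i. l i * int p) (\<lambda>i. i)"
    using lift_inj_family_p[OF c3 C2, where w = "0"] by (auto simp: steps)
  have C4: "C = family (int p ^ 3) 2 ({0..<2} \<times> {0..<int p})
      (\<lambda>(i, j). l i * int p + j * (int p)\<^sup>2) (\<lambda>(i, j). i)"
    using lift_full_family_p[OF c4 C3, where q = "int p"] by (simp add: steps)
  obtain b where b: "b (0, 0) = 0"
    and S4: "S = family (int p ^ 3) 2 ({0..<int p} \<times> {0..<int p})
      (\<lambda>(i, j). i + j * int p + b (i, j) * (int p)\<^sup>2) (\<lambda>(i, j). a i)"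
    using lift_inj_family_p[OF s4 S3, where w = "(0, 0)"] a by (auto simp: steps)
  show ?thesis
    using listed_pair.pair5[of a "curry b" l p, unfolded elt_families] a b l
    by (simp add: S4 C4 case_prod_unfold)
qed

lemma tower_imp_pair6:
  assumes "tower (int p) [(3, 1), (2, 0), (0, 0)] C S"
  shows "listed_pair p S C"
proof -
  from assms obtain S1 C1 where
    s1: "lift_full (int p ^ 2) 1 1 1 {(0, 0)} S1"
    and c1: "lift_inj (int p ^ 2) 1 1 1 {(0, 0)} C1"
    and c2: "lift_full (int p ^ 3) 2 (int p ^ 2) 1 C1 C"
    and s2: "lift_inj (int p ^ 3) 2 (int p ^ 2) 1 S1 S"
    unfolding tower.simps power_0 power_one_right by blast
  have S1: "S1 = family ((int p)\<^sup>2) 1 {0..<(int p)\<^sup>2}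
      (\<lambda>i. i) (\<lambda>_. 0)"
    using lift_full_zero_p[OF s1, where q = "int p ^ 2"] by (simp add: steps)
  have C1: "C1 = {(0, 0)}"
    using lift_inj_zero[OF c1] by simp
  have C2: "C = family (int p ^ 3) 2 ({0..<int p} \<times> {0..<2})
      (\<lambda>(i, j). i * (int p)\<^sup>2) (\<lambda>(i, j). j)"
    using lift_full_zero_p2[OF c2[unfolded C1], where q = "int p"] by (simp add: steps)
  obtain a where a: "a 0 = 0"
    and S2: "S = family (int p ^ 3) 2 {0..<(int p)\<^sup>2}
      (\<lambda>i. i + a i * (int p)\<^sup>2) (\<lambda>i. a i)"
    using lift_inj_family_p2[OF s2 S1, where w = "0" and q = "int p"] by (auto simp: steps)
  show ?thesis
    using listed_pair.pair6[of a p, unfolded elt_families] a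
    by (simp add: S2 C2 case_prod_unfold)
qed

lemma tower_imp_pair7:
  assumes "tower (int p) [(3, 1), (3, 0), (1, 0), (0, 0)] S C"
  shows "listed_pair p S C"
proof -
  from assms obtain S1 C1 S2 C2 where
    s1: "lift_full (int p) 1 1 1 {(0, 0)} S1"
    and c1: "lift_inj (int p) 1 1 1 {(0, 0)} C1"
    and c2: "lift_full (int p ^ 3) 1 (int p) 1 C1 C2"
    and s2: "lift_inj (int p ^ 3) 1 (int p) 1 S1 S2"
    and s3: "lift_full (int p ^ 3) 2 (int p ^ 3) 1 S2 S"
    and c3: "lift_inj (int p ^ 3) 2 (int p ^ 3) 1 C2 C"
    unfolding tower.simps power_0 power_one_right by blast
  have S1: "S1 = family (int p) 1 {0..<int p}
      (\<lambda>i. i) (\<lambda>_. 0)"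
    using lift_full_zero_p[OF s1, where q = "int p"] by (simp add: steps)
  have C1: "C1 = {(0, 0)}"
    using lift_inj_zero[OF c1] by simp
  have C2: "C2 = family (int p ^ 3) 1 {0..<(int p)\<^sup>2}
      (\<lambda>i. i * int p) (\<lambda>_. 0)"
    using lift_full_zero_p[OF c2[unfolded C1], where q = "int p ^ 2"] by (simp add: steps)
  obtain a where a: "a 0 = 0"
    and S2: "S2 = family (int p ^ 3) 1 {0..<int p}
      (\<lambda>i. i + a i * int p) (\<lambda>_. 0)"
    using lift_inj_family_p[OF s2 S1, where w = "0"] by (auto simp: steps)
  have S3: "S = family (int p ^ 3) 2 ({0..<int p} \<times> {0..<2})
      (\<lambda>(i, j). i + a i * int p) (\<lambda>(i, j). j)"
    using lift_full_family_2[OF s3 S2] by (simp add: steps)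
  obtain l where l: "l 0 = 0"
    and C3: "C = family (int p ^ 3) 2 {0..<(int p)\<^sup>2}
      (\<lambda>i. i * int p) (\<lambda>i. l i)"
    using lift_inj_family_2[OF c3 C2, where w = "0"] by (auto simp: steps)
  show ?thesis
    using listed_pair.pair7[of a l p, unfolded elt_families] a l
    by (simp add: S3 C3 case_prod_unfold)
qed

lemma tower_imp_pair8:
  assumes "tower (int p) [(3, 1), (2, 1), (0, 1), (0, 0)] S C"
  shows "listed_pair p S C"
proof -
  from assms obtain S1 C1 S2 C2 where
    s1: "lift_full 1 2 1 1 {(0, 0)} S1"
    and c1: "lift_inj 1 2 1 1 {(0, 0)} C1"
    and c2: "lift_full (int p ^ 2) 2 1 2 C1 C2"
    and s2: "lift_inj (int p ^ 2) 2 1 2 S1 S2"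
    and s3: "lift_full (int p ^ 3) 2 (int p ^ 2) 2 S2 S"
    and c3: "lift_inj (int p ^ 3) 2 (int p ^ 2) 2 C2 C"
    unfolding tower.simps power_0 power_one_right by blast
  have S1: "S1 = family 1 2 {0..<2}
      (\<lambda>_. 0) (\<lambda>i. i)"
    using lift_full_zero_2[OF s1] by (simp add: steps)
  have C1: "C1 = {(0, 0)}"
    using lift_inj_zero[OF c1] by simp
  have C2: "C2 = family ((int p)\<^sup>2) 2 {0..<(int p)\<^sup>2}
      (\<lambda>i. i) (\<lambda>_. 0)"
    using lift_full_zero_p[OF c2[unfolded C1], where q = "int p ^ 2"] by (simp add: steps)
  obtain a where a: "a 0 = 0"
    and S2: "S2 = family ((int p)\<^sup>2) 2 {0..<2}
      (\<lambda>i. a i) (\<lambda>i. i)"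
    using lift_inj_family_p[OF s2 S1, where w = "0"] by (auto simp: steps)
  have S3: "S = family (int p ^ 3) 2 ({0..<2} \<times> {0..<int p})
      (\<lambda>(i, j). a i + j * (int p)\<^sup>2) (\<lambda>(i, j). i)"
    using lift_full_family_p[OF s3 S2, where q = "int p"] by (simp add: steps)
  obtain l where l: "l 0 = 0"
    and C3: "C = family (int p ^ 3) 2 {0..<(int p)\<^sup>2}
      (\<lambda>i. i + l i * (int p)\<^sup>2) (\<lambda>_. 0)"
    using lift_inj_family_p[OF c3 C2, where w = "0"] by (auto simp: steps)
  show ?thesis
    using listed_pair.pair8[of a l p, unfolded elt_families] a l
    by (simp add: S3 C3 case_prod_unfold)
qed

lemma tower_imp_pair9:
  assumes "tower (int p) [(3, 1), (2, 1), (2, 0), (1, 0), (0, 0)] C S"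
  shows "listed_pair p S C"
proof -
  from assms obtain S1 C1 S2 C2 S3 C3 where
    s1: "lift_full (int p) 1 1 1 {(0, 0)} S1"
    and c1: "lift_inj (int p) 1 1 1 {(0, 0)} C1"
    and c2: "lift_full (int p ^ 2) 1 (int p) 1 C1 C2"
    and s2: "lift_inj (int p ^ 2) 1 (int p) 1 S1 S2"
    and s3: "lift_full (int p ^ 2) 2 (int p ^ 2) 1 S2 S3"
    and c3: "lift_inj (int p ^ 2) 2 (int p ^ 2) 1 C2 C3"
    and c4: "lift_full (int p ^ 3) 2 (int p ^ 2) 2 C3 C"
    and s4: "lift_inj (int p ^ 3) 2 (int p ^ 2) 2 S3 S"
    unfolding tower.simps power_0 power_one_right by blast
  have S1: "S1 = family (int p) 1 {0..<int p}
      (\<lambda>i. i) (\<lambda>_. 0)"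
    using lift_full_zero_p[OF s1, where q = "int p"] by (simp add: steps)
  have C1: "C1 = {(0, 0)}"
    using lift_inj_zero[OF c1] by simp
  have C2: "C2 = family ((int p)\<^sup>2) 1 {0..<int p}
      (\<lambda>i. i * int p) (\<lambda>_. 0)"
    using lift_full_zero_p[OF c2[unfolded C1], where q = "int p"] by (simp add: steps)
  obtain a where a: "a 0 = 0"
    and S2: "S2 = family ((int p)\<^sup>2) 1 {0..<int p}
      (\<lambda>i. i + a i * int p) (\<lambda>_. 0)"
    using lift_inj_family_p[OF s2 S1, where w = "0"] by (auto simp: steps)
  have S3: "S3 = family ((int p)\<^sup>2) 2 ({0..<int p} \<times> {0..<2})
      (\<lambda>(i, j). i + a i * int p) (\<lambda>(i, j). j)"
    using lift_full_family_2[OF s3 S2] by (simp add: steps)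
  obtain l where l: "l 0 = 0"
    and C3: "C3 = family ((int p)\<^sup>2) 2 {0..<int p}
      (\<lambda>i. i * int p) (\<lambda>i. l i)"
    using lift_inj_family_2[OF c3 C2, where w = "0"] by (auto simp: steps)
  have C4: "C = family (int p ^ 3) 2 ({0..<int p} \<times> {0..<int p})
      (\<lambda>(i, j). i * int p + j * (int p)\<^sup>2) (\<lambda>(i, j). l i)"
    using lift_full_family_p[OF c4 C3, where q = "int p"] by (simp add: steps)
  obtain b where b: "b (0, 0) = 0"
    and S4: "S = family (int p ^ 3) 2 ({0..<int p} \<times> {0..<2})
      (\<lambda>(i, j). i + a i * int p + b (i, j) * (int p)\<^sup>2) (\<lambda>(i, j). j)"
    using lift_inj_family_p[OF s4 S3, where w = "(0, 0)"] a by (auto simp: steps)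
  show ?thesis
    using listed_pair.pair9[of a "curry b" l p, unfolded elt_families] a b l
    by (simp add: S4 C4 case_prod_unfold)
qed

lemma tower_imp_pair10:
  assumes "tower (int p) [(3, 1), (2, 1), (1, 1), (0, 1), (0, 0)] C S"
  shows "listed_pair p S C"
proof -
  from assms obtain S1 C1 S2 C2 S3 C3 where
    s1: "lift_full 1 2 1 1 {(0, 0)} S1"
    and c1: "lift_inj 1 2 1 1 {(0, 0)} C1"
    and c2: "lift_full (int p) 2 1 2 C1 C2"
    and s2: "lift_inj (int p) 2 1 2 S1 S2"
    and s3: "lift_full (int p ^ 2) 2 (int p) 2 S2 S3"
    and c3: "lift_inj (int p ^ 2) 2 (int p) 2 C2 C3"
    and c4: "lift_full (int p ^ 3) 2 (int p ^ 2) 2 C3 C"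
    and s4: "lift_inj (int p ^ 3) 2 (int p ^ 2) 2 S3 S"
    unfolding tower.simps power_0 power_one_right by blast
  have S1: "S1 = family 1 2 {0..<2}
      (\<lambda>_. 0) (\<lambda>i. i)"
    using lift_full_zero_2[OF s1] by (simp add: steps)
  have C1: "C1 = {(0, 0)}"
    using lift_inj_zero[OF c1] by simp
  have C2: "C2 = family (int p) 2 {0..<int p}
      (\<lambda>i. i) (\<lambda>_. 0)"
    using lift_full_zero_p[OF c2[unfolded C1], where q = "int p"] by (simp add: steps)
  obtain a where a: "a 0 = 0"
    and S2: "S2 = family (int p) 2 {0..<2}
      (\<lambda>i. a i) (\<lambda>i. i)"
    using lift_inj_family_p[OF s2 S1, where w = "0"] by (auto simp: steps)
  have S3: "S3 = family ((int p)\<^sup>2) 2 ({0..<2} \<times> {0..<int p})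
      (\<lambda>(i, j). a i + j * int p) (\<lambda>(i, j). i)"
    using lift_full_family_p[OF s3 S2, where q = "int p"] by (simp add: steps)
  obtain l where l: "l 0 = 0"
    and C3: "C3 = family ((int p)\<^sup>2) 2 {0..<int p}
      (\<lambda>i. i + l i * int p) (\<lambda>_. 0)"
    using lift_inj_family_p[OF c3 C2, where w = "0"] by (auto simp: steps)
  have C4: "C = family (int p ^ 3) 2 ({0..<int p} \<times> {0..<int p})
      (\<lambda>(i, j). i + l i * int p + j * (int p)\<^sup>2) (\<lambda>_. 0)"
    using lift_full_family_p[OF c4 C3, where q = "int p"] by (simp add: steps)
  obtain b where b: "b (0, 0) = 0"
    and S4: "S = family (int p ^ 3) 2 ({0..<2} \<times> {0..<int p})
      (\<lambda>(i, j). a i + j * int p + b (i, j) * (int p)\<^sup>2) (\<lambda>(i, j). i)"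
    using lift_inj_family_p[OF s4 S3, where w = "(0, 0)"] a by (auto simp: steps)
  show ?thesis
    using listed_pair.pair10[of a "curry b" l p, unfolded elt_families] a b l
    by (simp add: S4 C4 case_prod_unfold)
qed

lemma tower_imp_pair11:
  assumes "tower (int p) [(3, 1), (1, 1), (0, 0)] C S"
  shows "listed_pair p S C"
proof -
  from assms obtain S1 C1 where
    s1: "lift_full (int p) 2 1 1 {(0, 0)} S1"
    and c1: "lift_inj (int p) 2 1 1 {(0, 0)} C1"
    and c2: "lift_full (int p ^ 3) 2 (int p) 2 C1 C"
    and s2: "lift_inj (int p ^ 3) 2 (int p) 2 S1 S"
    unfolding tower.simps power_0 power_one_right by blast
  have S1: "S1 = family (int p) 2 ({0..<int p} \<times> {0..<2})
      (\<lambda>(i, j). i) (\<lambda>(i, j). j)"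
    using lift_full_zero_p2[OF s1, where q = "int p"] by (simp add: steps)
  have C1: "C1 = {(0, 0)}"
    using lift_inj_zero[OF c1] by simp
  have C2: "C = family (int p ^ 3) 2 {0..<(int p)\<^sup>2}
      (\<lambda>i. i * int p) (\<lambda>_. 0)"
    using lift_full_zero_p[OF c2[unfolded C1], where q = "int p ^ 2"] by (simp add: steps)
  obtain b where b: "b (0, 0) = 0"
    and S2: "S = family (int p ^ 3) 2 ({0..<int p} \<times> {0..<2})
      (\<lambda>(i, j). i + b (i, j) * int p) (\<lambda>(i, j). j)"
    using lift_inj_family_p[OF s2 S1, where w = "(0, 0)"] by (auto simp: steps)
  show ?thesis
    using listed_pair.pair11[of "curry b" p, unfolded elt_families] b
    by (simp add: S2 C2 case_prod_unfold)
qed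

lemma tower_imp_pair12:
  assumes "tower (int p) [(3, 1), (2, 1), (2, 0), (0, 0)] S C"
  shows "listed_pair p S C"
proof -
  from assms obtain S1 C1 S2 C2 where
    s1: "lift_full (int p ^ 2) 1 1 1 {(0, 0)} S1"
    and c1: "lift_inj (int p ^ 2) 1 1 1 {(0, 0)} C1"
    and c2: "lift_full (int p ^ 2) 2 (int p ^ 2) 1 C1 C2"
    and s2: "lift_inj (int p ^ 2) 2 (int p ^ 2) 1 S1 S2"
    and s3: "lift_full (int p ^ 3) 2 (int p ^ 2) 2 S2 S"
    and c3: "lift_inj (int p ^ 3) 2 (int p ^ 2) 2 C2 C"
    unfolding tower.simps power_0 power_one_right by blast
  have S1: "S1 = family ((int p)\<^sup>2) 1 {0..<(int p)\<^sup>2}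
      (\<lambda>i. i) (\<lambda>_. 0)"
    using lift_full_zero_p[OF s1, where q = "int p ^ 2"] by (simp add: steps)
  have C1: "C1 = {(0, 0)}"
    using lift_inj_zero[OF c1] by simp
  have C2: "C2 = family ((int p)\<^sup>2) 2 {0..<2}
      (\<lambda>_. 0) (\<lambda>i. i)"
    using lift_full_zero_2[OF c2[unfolded C1]] by (simp add: steps)
  obtain a where a: "a 0 = 0"
    and S2: "S2 = family ((int p)\<^sup>2) 2 {0..<(int p)\<^sup>2}
      (\<lambda>i. i) (\<lambda>i. a i)"
    using lift_inj_family_2[OF s2 S1, where w = "0"] by (auto simp: steps)
  have S3: "S = family (int p ^ 3) 2 ({0..<(int p)\<^sup>2} \<times> {0..<int p})
      (\<lambda>(i, j). i + j * (int p)\<^sup>2) (\<lambda>(i, j). a i)"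
    using lift_full_family_p[OF s3 S2, where q = "int p"] by (simp add: steps)
  obtain l where l: "l 0 = 0"
    and C3: "C = family (int p ^ 3) 2 {0..<2}
      (\<lambda>i. l i * (int p)\<^sup>2) (\<lambda>i. i)"
    using lift_inj_family_p[OF c3 C2, where w = "0"] by (auto simp: steps)
  show ?thesis
    using listed_pair.pair12[of a l p, unfolded elt_families] a l
    by (simp add: S3 C3 case_prod_unfold)
qed

lemma tower_imp_pair13:
  assumes "tower (int p) [(3, 1), (1, 1), (1, 0), (0, 0)] S C"
  shows "listed_pair p S C"
proof -
  from assms obtain S1 C1 S2 C2 where
    s1: "lift_full (int p) 1 1 1 {(0, 0)} S1"
    and c1: "lift_inj (int p) 1 1 1 {(0, 0)} C1"
    and c2: "lift_full (int p) 2 (int p) 1 C1 C2"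
    and s2: "lift_inj (int p) 2 (int p) 1 S1 S2"
    and s3: "lift_full (int p ^ 3) 2 (int p) 2 S2 S"
    and c3: "lift_inj (int p ^ 3) 2 (int p) 2 C2 C"
    unfolding tower.simps power_0 power_one_right by blast
  have S1: "S1 = family (int p) 1 {0..<int p}
      (\<lambda>i. i) (\<lambda>_. 0)"
    using lift_full_zero_p[OF s1, where q = "int p"] by (simp add: steps)
  have C1: "C1 = {(0, 0)}"
    using lift_inj_zero[OF c1] by simp
  have C2: "C2 = family (int p) 2 {0..<2}
      (\<lambda>_. 0) (\<lambda>i. i)"
    using lift_full_zero_2[OF c2[unfolded C1]] by (simp add: steps)
  obtain a where a: "a 0 = 0"
    and S2: "S2 = family (int p) 2 {0..<int p}
      (\<lambda>i. i) (\<lambda>i. a i)"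
    using lift_inj_family_2[OF s2 S1, where w = "0"] by (auto simp: steps)
  have S3: "S = family (int p ^ 3) 2 ({0..<int p} \<times> {0..<(int p)\<^sup>2})
      (\<lambda>(i, j). i + j * int p) (\<lambda>(i, j). a i)"
    using lift_full_family_p[OF s3 S2, where q = "int p ^ 2"] by (simp add: steps)
  obtain l where l: "l 0 = 0"
    and C3: "C = family (int p ^ 3) 2 {0..<2}
      (\<lambda>i. l i * int p) (\<lambda>i. i)"
    using lift_inj_family_p[OF c3 C2, where w = "0"] by (auto simp: steps)
  show ?thesis
    using listed_pair.pair13[of a l p, unfolded elt_families] a l
    by (simp add: S3 C3 case_prod_unfold)
qed

lemma tower_imp_pair14:
  assumes "tower (int p) [(3, 1), (3, 0), (0, 0)] C S"
  shows "listed_pair p S C"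
proof -
  from assms obtain S1 C1 where
    s1: "lift_full (int p ^ 3) 1 1 1 {(0, 0)} S1"
    and c1: "lift_inj (int p ^ 3) 1 1 1 {(0, 0)} C1"
    and c2: "lift_full (int p ^ 3) 2 (int p ^ 3) 1 C1 C"
    and s2: "lift_inj (int p ^ 3) 2 (int p ^ 3) 1 S1 S"
    unfolding tower.simps power_0 power_one_right by blast
  have S1: "S1 = family (int p ^ 3) 1 {0..<int p ^ 3}
      (\<lambda>i. i) (\<lambda>_. 0)"
    using lift_full_zero_p[OF s1, where q = "int p ^ 3"] by (simp add: steps)
  have C1: "C1 = {(0, 0)}"
    using lift_inj_zero[OF c1] by simp
  have C2: "C = family (int p ^ 3) 2 {0..<2}
      (\<lambda>_. 0) (\<lambda>i. i)"
    using lift_full_zero_2[OF c2[unfolded C1]] by (simp add: steps)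
  obtain a where a: "a 0 = 0"
    and S2: "S = family (int p ^ 3) 2 {0..<int p ^ 3}
      (\<lambda>i. i) (\<lambda>i. a i)"
    using lift_inj_family_2[OF s2 S1, where w = "0"] by (auto simp: steps)
  show ?thesis
    using listed_pair.pair14[of a p, unfolded elt_families] a
    by (simp add: S2 C2 case_prod_unfold)
qed

lemma tower_imp_pair15:
  assumes "tower (int p) [(3, 1), (3, 0), (2, 0), (0, 0)] S C"
  shows "listed_pair p S C"
proof -
  from assms obtain S1 C1 S2 C2 where
    s1: "lift_full (int p ^ 2) 1 1 1 {(0, 0)} S1"
    and c1: "lift_inj (int p ^ 2) 1 1 1 {(0, 0)} C1"
    and c2: "lift_full (int p ^ 3) 1 (int p ^ 2) 1 C1 C2"
    and s2: "lift_inj (int p ^ 3) 1 (int p ^ 2) 1 S1 S2"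
    and s3: "lift_full (int p ^ 3) 2 (int p ^ 3) 1 S2 S"
    and c3: "lift_inj (int p ^ 3) 2 (int p ^ 3) 1 C2 C"
    unfolding tower.simps power_0 power_one_right by blast
  have S1: "S1 = family ((int p)\<^sup>2) 1 {0..<(int p)\<^sup>2}
      (\<lambda>i. i) (\<lambda>_. 0)"
    using lift_full_zero_p[OF s1, where q = "int p ^ 2"] by (simp add: steps)
  have C1: "C1 = {(0, 0)}"
    using lift_inj_zero[OF c1] by simp
  have C2: "C2 = family (int p ^ 3) 1 {0..<int p}
      (\<lambda>i. i * (int p)\<^sup>2) (\<lambda>_. 0)"
    using lift_full_zero_p[OF c2[unfolded C1], where q = "int p"] by (simp add: steps)
  obtain a where a: "a 0 = 0"
    and S2: "S2 = family (int p ^ 3) 1 {0..<(int p)\<^sup>2}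
      (\<lambda>i. i + a i * (int p)\<^sup>2) (\<lambda>_. 0)"
    using lift_inj_family_p[OF s2 S1, where w = "0"] by (auto simp: steps)
  have S3: "S = family (int p ^ 3) 2 ({0..<(int p)\<^sup>2} \<times> {0..<2})
      (\<lambda>(i, j). i + a i * (int p)\<^sup>2) (\<lambda>(i, j). j)"
    using lift_full_family_2[OF s3 S2] by (simp add: steps)
  obtain l where l: "l 0 = 0"
    and C3: "C = family (int p ^ 3) 2 {0..<int p}
      (\<lambda>i. i * (int p)\<^sup>2) (\<lambda>i. l i)"
    using lift_inj_family_2[OF c3 C2, where w = "0"] by (auto simp: steps)
  show ?thesis
    using listed_pair.pair15[of a l p, unfolded elt_families] a l
    by (simp add: S3 C3 case_prod_unfold)
qed

lemma tower_imp_pair16: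
  assumes "tower (int p) [(3, 1), (2, 1), (1, 1), (0, 0)] S C"
  shows "listed_pair p S C"
proof -
  from assms obtain S1 C1 S2 C2 where
    s1: "lift_full (int p) 2 1 1 {(0, 0)} S1"
    and c1: "lift_inj (int p) 2 1 1 {(0, 0)} C1"
    and c2: "lift_full (int p ^ 2) 2 (int p) 2 C1 C2"
    and s2: "lift_inj (int p ^ 2) 2 (int p) 2 S1 S2"
    and s3: "lift_full (int p ^ 3) 2 (int p ^ 2) 2 S2 S"
    and c3: "lift_inj (int p ^ 3) 2 (int p ^ 2) 2 C2 C"
    unfolding tower.simps power_0 power_one_right by blast
  have S1: "S1 = family (int p) 2 ({0..<int p} \<times> {0..<2})
      (\<lambda>(i, j). i) (\<lambda>(i, j). j)"
    using lift_full_zero_p2[OF s1, where q = "int p"] by (simp add: steps)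
  have C1: "C1 = {(0, 0)}"
    using lift_inj_zero[OF c1] by simp
  have C2: "C2 = family ((int p)\<^sup>2) 2 {0..<int p}
      (\<lambda>i. i * int p) (\<lambda>_. 0)"
    using lift_full_zero_p[OF c2[unfolded C1], where q = "int p"] by (simp add: steps)
  obtain b where b: "b (0, 0) = 0"
    and S2: "S2 = family ((int p)\<^sup>2) 2 ({0..<int p} \<times> {0..<2})
      (\<lambda>(i, j). i + b (i, j) * int p) (\<lambda>(i, j). j)"
    using lift_inj_family_p[OF s2 S1, where w = "(0, 0)"] by (auto simp: steps)
  have S3: "S = family (int p ^ 3) 2 ({0..<int p} \<times> {0..<int p} \<times> {0..<2})
      (\<lambda>(i, j, k). i + b (i, k) * int p + j * (int p)\<^sup>2) (\<lambda>(i, j, k). k)"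
    using lift_full_family_p_pair[OF s3 S2, where q = "int p"] by (simp add: steps)
  obtain l where l: "l 0 = 0"
    and C3: "C = family (int p ^ 3) 2 {0..<int p}
      (\<lambda>i. i * int p + l i * (int p)\<^sup>2) (\<lambda>_. 0)"
    using lift_inj_family_p[OF c3 C2, where w = "0"] by (auto simp: steps)
  show ?thesis
    using listed_pair.pair16[of "curry b" l p, unfolded elt_families] b l
    by (simp add: S3 C3 case_prod_unfold)
qed

lemma tower_imp_pair17:
  assumes "tower (int p) [(3, 1), (2, 0), (1, 0), (0, 0)] S C"
  shows "listed_pair p S C"
proof -
  from assms obtain S1 C1 S2 C2 where
    s1: "lift_full (int p) 1 1 1 {(0, 0)} S1"
    and c1: "lift_inj (int p) 1 1 1 {(0, 0)} C1"
    and c2: "lift_full (int p ^ 2) 1 (int p) 1 C1 C2"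
    and s2: "lift_inj (int p ^ 2) 1 (int p) 1 S1 S2"
    and s3: "lift_full (int p ^ 3) 2 (int p ^ 2) 1 S2 S"
    and c3: "lift_inj (int p ^ 3) 2 (int p ^ 2) 1 C2 C"
    unfolding tower.simps power_0 power_one_right by blast
  have S1: "S1 = family (int p) 1 {0..<int p}
      (\<lambda>i. i) (\<lambda>_. 0)"
    using lift_full_zero_p[OF s1, where q = "int p"] by (simp add: steps)
  have C1: "C1 = {(0, 0)}"
    using lift_inj_zero[OF c1] by simp
  have C2: "C2 = family ((int p)\<^sup>2) 1 {0..<int p}
      (\<lambda>i. i * int p) (\<lambda>_. 0)"
    using lift_full_zero_p[OF c2[unfolded C1], where q = "int p"] by (simp add: steps)
  obtain a where a: "a 0 = 0"
    and S2: "S2 = family ((int p)\<^sup>2) 1 {0..<int p}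
      (\<lambda>i. i + a i * int p) (\<lambda>_. 0)"
    using lift_inj_family_p[OF s2 S1, where w = "0"] by (auto simp: steps)
  have S3: "S = family (int p ^ 3) 2 ({0..<int p} \<times> {0..<int p} \<times> {0..<2})
      (\<lambda>(i, j, k). i + a i * int p + j * (int p)\<^sup>2) (\<lambda>(i, j, k). k)"
    using lift_full_family_p2[OF s3 S2, where q = "int p"] by (simp add: steps)
  obtain l where l: "l 0 = 0"
    and C3: "C = family (int p ^ 3) 2 {0..<int p}
      (\<lambda>i. i * int p + l i * (int p)\<^sup>2) (\<lambda>i. l i)"
    using lift_inj_family_p2[OF c3 C2, where w = "0" and q = "int p"] by (auto simp: steps)
  show ?thesis
    using listed_pair.pair17[of a l p, unfolded elt_families] a l
    by (simp add: S3 C3 case_prod_unfold)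
qed

lemma tower_imp_pair18:
  assumes "tower (int p) [(3, 1), (1, 1), (0, 1), (0, 0)] S C"
  shows "listed_pair p S C"
proof -
  from assms obtain S1 C1 S2 C2 where
    s1: "lift_full 1 2 1 1 {(0, 0)} S1"
    and c1: "lift_inj 1 2 1 1 {(0, 0)} C1"
    and c2: "lift_full (int p) 2 1 2 C1 C2"
    and s2: "lift_inj (int p) 2 1 2 S1 S2"
    and s3: "lift_full (int p ^ 3) 2 (int p) 2 S2 S"
    and c3: "lift_inj (int p ^ 3) 2 (int p) 2 C2 C"
    unfolding tower.simps power_0 power_one_right by blast
  have S1: "S1 = family 1 2 {0..<2}
      (\<lambda>_. 0) (\<lambda>i. i)"
    using lift_full_zero_2[OF s1] by (simp add: steps)
  have C1: "C1 = {(0, 0)}"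
    using lift_inj_zero[OF c1] by simp
  have C2: "C2 = family (int p) 2 {0..<int p}
      (\<lambda>i. i) (\<lambda>_. 0)"
    using lift_full_zero_p[OF c2[unfolded C1], where q = "int p"] by (simp add: steps)
  obtain a where a: "a 0 = 0"
    and S2: "S2 = family (int p) 2 {0..<2}
      (\<lambda>i. a i) (\<lambda>i. i)"
    using lift_inj_family_p[OF s2 S1, where w = "0"] by (auto simp: steps)
  have S3: "S = family (int p ^ 3) 2 ({0..<2} \<times> {0..<(int p)\<^sup>2})
      (\<lambda>(i, j). a i + j * int p) (\<lambda>(i, j). i)"
    using lift_full_family_p[OF s3 S2, where q = "int p ^ 2"] by (simp add: steps)
  obtain l where l: "l 0 = 0"
    and C3: "C = family (int p ^ 3) 2 {0..<int p}
      (\<lambda>i. i + l i * int p) (\<lambda>_. 0)"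
    using lift_inj_family_p[OF c3 C2, where w = "0"] by (auto simp: steps)
  show ?thesis
    using listed_pair.pair18[of a l p, unfolded elt_families] a l
    by (simp add: S3 C3 case_prod_unfold)
qed

lemma tower_imp_pair19:
  assumes "tower (int p) [(3, 1), (2, 1), (0, 0)] C S"
  shows "listed_pair p S C"
proof -
  from assms obtain S1 C1 where
    s1: "lift_full (int p ^ 2) 2 1 1 {(0, 0)} S1"
    and c1: "lift_inj (int p ^ 2) 2 1 1 {(0, 0)} C1"
    and c2: "lift_full (int p ^ 3) 2 (int p ^ 2) 2 C1 C"
    and s2: "lift_inj (int p ^ 3) 2 (int p ^ 2) 2 S1 S"
    unfolding tower.simps power_0 power_one_right by blast
  have S1: "S1 = family ((int p)\<^sup>2) 2 ({0..<(int p)\<^sup>2} \<times> {0..<2})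
      (\<lambda>(i, j). i) (\<lambda>(i, j). j)"
    using lift_full_zero_p2[OF s1, where q = "int p ^ 2"] by (simp add: steps)
  have C1: "C1 = {(0, 0)}"
    using lift_inj_zero[OF c1] by simp
  have C2: "C = family (int p ^ 3) 2 {0..<int p}
      (\<lambda>i. i * (int p)\<^sup>2) (\<lambda>_. 0)"
    using lift_full_zero_p[OF c2[unfolded C1], where q = "int p"] by (simp add: steps)
  obtain b where b: "b (0, 0) = 0"
    and S2: "S = family (int p ^ 3) 2 ({0..<(int p)\<^sup>2} \<times> {0..<2})
      (\<lambda>(i, j). i + b (i, j) * (int p)\<^sup>2) (\<lambda>(i, j). j)"
    using lift_inj_family_p[OF s2 S1, where w = "(0, 0)"] by (auto simp: steps)
  show ?thesis
    using listed_pair.pair19[of "curry b" p, unfolded elt_families] b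
    by (simp add: S2 C2 case_prod_unfold)
qed

end

section \<open>The parametrized pairs are factorizations\<close>

definition family_tiles where
  "family_tiles m n U f g V f' g' \<longleftrightarrow> tiles m n U (\<lambda>u. (f u, g u)) V (\<lambda>v. (f' v, g' v))"

lemma family_tiles_commute: "family_tiles m n U f g V f' g' \<Longrightarrow> family_tiles m n V f' g' U f g"
  unfolding family_tiles_def by (rule tiles_commute)

lemma family_tiles_trivial: "family_tiles 1 1 {()} (\<lambda>_. 0) (\<lambda>_. 0) {()} (\<lambda>_. 0) (\<lambda>_. 0)"
  unfolding family_tiles_def by (rule tilesI) (auto simp: red_def box_def)

text \<open>
  Raising the moduli, one family receives new digits and the other one may be changed by arbitrary
  multiples of the old moduli. Uniqueness of the indices \<open>u\<close> and \<open>v\<close> is inherited from the quotient, and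
  then the digits \<open>j\<close> and \<open>k\<close> are determined. The lifted families change places, so that lifts along an
  alternating chain can be composed without further rearrangement. The bijection \<open>h\<close> allows trivial
  index components to be dropped.
\<close>

lemma family_tiles_lift:
  assumes T: "family_tiles m n U f g V f' g'"
    and M: "M = m * q" and N: "N = n * r" and pos: "m > 0" "q > 0" "n > 0" "r > 0"
    and h: "bij_betw h W (U \<times> {0..<q} \<times> {0..<r})"
    and FG: "\<And>w u j k. w \<in> W \<Longrightarrow> h w = (u, j, k) \<Longrightarrow> F w = f u + j * m \<and> G w = g u + k * n"
    and F'G': "\<And>v. v \<in> V \<Longrightarrow> F' v mod m = f' v mod m \<and> G' v mod n = g' v mod n"
  shows "family_tiles M N V F' G' W F G"
proof -
  have T: "tiles m n U (\<lambda>u. (f u, g u)) V (\<lambda>v. (f' v, g' v))" using T by (simp add: family_tiles_def)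
  have MN: "M > 0" "N > 0" using M N pos by auto
  have low: "red m n (red M N ((F w, G w) + (F' v, G' v))) = red m n ((f u, g u) + (f' v, g' v))"
    if "w \<in> W" "v \<in> V" "h w = (u, j, k)" for u v w j k
  proof -
    have "red m n (red M N ((F w, G w) + (F' v, G' v))) = red m n ((F w, G w) + (F' v, G' v))"
      unfolding M N by (intro red_red) auto
    also have "\<dots> = red m n ((f u, g u) + (f' v, g' v))"
      using FG[OF that(1,3)] F'G'[OF that(2)]
      by (intro red_add_cong) (simp_all add: red_def)
    finally show ?thesis .
  qed
  have "tiles M N W (\<lambda>w. (F w, G w)) V (\<lambda>v. (F' v, G' v))"
  proof (rule tilesI[OF MN])
    fix w v w' v'
    assume wv: "w \<in> W" "v \<in> V" "w' \<in> W" "v' \<in> V"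
      and eq: "red M N ((F w, G w) + (F' v, G' v)) = red M N ((F w', G w') + (F' v', G' v'))"
    obtain u j k where hw: "h w = (u, j, k)" by (cases "h w")
    obtain u' j' k' where hw': "h w' = (u', j', k')" by (cases "h w'")
    have mem: "(u, j, k) \<in> U \<times> {0..<q} \<times> {0..<r}" "(u', j', k') \<in> U \<times> {0..<q} \<times> {0..<r}"
      using bij_betwE[OF h] wv hw hw' by metis+
    have "red m n ((f u, g u) + (f' v, g' v)) = red m n ((f u', g u') + (f' v', g' v'))"
      using low[OF wv(1,2) hw] low[OF wv(3,4) hw'] eq by simp
    then have uv: "u = u'" "v = v'" using tiles_unique[OF T] mem wv by blast+
    have "m * q dvd m * (j - j')" "n * r dvd n * (k - k')"
      using eq uv FG[OF wv(1) hw] FG[OF wv(3) hw'] unfolding M N red_eq_iff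
      by (simp_all add: algebra_simps)
    then have "q dvd j - j'" "r dvd k - k'" using pos by simp_all
    then have "j mod q = j' mod q" "k mod r = k' mod r" by (simp_all add: mod_eq_dvd_iff)
    then have "j = j'" "k = k'" using mem by simp_all
    then have "w = w'" using bij_betw_imp_inj_on[OF h] wv hw hw' uv by (metis inj_onD)
    then show "w = w' \<and> v = v'" using uv by simp
  next
    fix z assume z: "z \<in> box M N"
    obtain u v where uv: "u \<in> U" "v \<in> V" "red m n ((f u, g u) + (f' v, g' v)) = red m n z"
      using tiles_ex[OF T pos(1,3)] by blast
    have "red m n (f u + F' v, g u + G' v) = red m n z"
      using uv(3) F'G'[OF uv(2)] red_add_cong[of m n "(F' v, G' v)" "(f' v, g' v)" "(f u, g u)" "(f u, g u)"]
      by (simp add: red_def add.commute)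
    then have "m dvd fst z - (f u + F' v)" "n dvd snd z - (g u + G' v)"
      unfolding red_eq_iff by (simp_all add: dvd_diff_commute)
    then obtain s t where "fst z - (f u + F' v) = m * s" "snd z - (g u + G' v) = n * t"
      by (elim dvdE)
    then have st: "fst z = f u + F' v + m * s" "snd z = g u + G' v + n * t" by simp_all
    have "(u, s mod q, t mod r) \<in> U \<times> {0..<q} \<times> {0..<r}" using uv pos by simp
    then obtain w where w: "w \<in> W" "h w = (u, s mod q, t mod r)"
      using bij_betw_imp_surj_on[OF h] by (metis imageE)
    have "red M N ((F w, G w) + (F' v, G' v)) = red M N z"
    proof -
      have "F w + F' v - fst z = - (m * (s - s mod q))" "G w + G' v - snd z = - (n * (t - t mod r))"
        using FG[OF w] st by (simp_all add: algebra_simps)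
      then show ?thesis unfolding red_eq_iff M N by (simp add: dvd_minus_mod)
    qed
    then show "\<exists>w\<in>W. \<exists>v\<in>V. red M N ((F w, G w) + (F' v, G' v)) = z"
      using w(1) uv(2) red_id[OF z] by auto
  qed
  then show ?thesis unfolding family_tiles_def by (rule tiles_commute)
qed

lemma family_tiles_p:
  assumes "family_tiles m n U f g V f' g'" "M = m * q" "m > 0" "q > 0" "n > 0"
    and "\<And>v. v \<in> V \<Longrightarrow> F' v mod m = f' v mod m \<and> G' v mod n = g' v mod n"
  shows "family_tiles M n V F' G' (U \<times> {0..<q}) (\<lambda>(u, j). f u + j * m) (\<lambda>(u, j). g u)"
proof (rule family_tiles_lift[OF assms(1,2), where r = 1 and h = "\<lambda>(u, j). (u, j, 0)"])
  show "bij_betw (\<lambda>(u, j). (u, j, 0)) (U \<times> {0..<q}) (U \<times> {0..<q} \<times> {0..<1::int})"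
    by (rule bij_betw_byWitness[where f' = "\<lambda>(u, j, _). (u, j)"]) auto
qed (use assms in auto)

lemma family_tiles_p2:
  assumes "family_tiles m 1 U f (\<lambda>_. 0) V f' g'" "M = m * q" "m > 0" "q > 0"
    and "\<And>v. v \<in> V \<Longrightarrow> F' v mod m = f' v mod m"
  shows "family_tiles M 2 V F' G' (U \<times> {0..<q} \<times> {0..<2}) (\<lambda>(u, j, k). f u + j * m) (\<lambda>(u, j, k). k)"
proof (rule family_tiles_lift[OF assms(1,2), where r = 2 and h = "\<lambda>z. z"])
  show "bij_betw (\<lambda>z. z) (U \<times> {0..<q} \<times> {0..<2::int}) (U \<times> {0..<q} \<times> {0..<2::int})"
    by (rule bij_betw_byWitness[where f' = "\<lambda>z. z"]) auto
qed (use assms in auto)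

lemma family_tiles_2:
  assumes "family_tiles m 1 U f (\<lambda>_. 0) V f' g'" "m > 0"
    and "\<And>v. v \<in> V \<Longrightarrow> F' v mod m = f' v mod m"
  shows "family_tiles m 2 V F' G' (U \<times> {0..<2}) (\<lambda>(u, k). f u) (\<lambda>(u, k). k)"
proof (rule family_tiles_lift[OF assms(1), where q = 1 and r = 2 and h = "\<lambda>(u, k). (u, 0, k)"])
  show "bij_betw (\<lambda>(u, k). (u, 0, k)) (U \<times> {0..<2::int}) (U \<times> {0..<1::int} \<times> {0..<2::int})"
    by (rule bij_betw_byWitness[where f' = "\<lambda>(u, _, k). (u, k)"]) auto
qed (use assms in auto)

lemma family_tiles_p_pair:
  assumes "family_tiles m n (I \<times> K) (\<lambda>(i, k). f i k) (\<lambda>(i, k). g i k) V f' g'"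
    "M = m * q" "m > 0" "q > 0" "n > 0"
    and "\<And>v. v \<in> V \<Longrightarrow> F' v mod m = f' v mod m \<and> G' v mod n = g' v mod n"
  shows "family_tiles M n V F' G' (I \<times> {0..<q} \<times> K) (\<lambda>(i, j, k). f i k + j * m) (\<lambda>(i, j, k). g i k)"
proof (rule family_tiles_lift[OF assms(1,2), where r = 1 and h = "\<lambda>(i, j, k). ((i, k), j, 0)"])
  show "bij_betw (\<lambda>(i, j, k). ((i, k), j, 0)) (I \<times> {0..<q} \<times> K) ((I \<times> K) \<times> {0..<q} \<times> {0..<1::int})"
    by (rule bij_betw_byWitness[where f' = "\<lambda>((i, k), j, _). (i, j, k)"]) auto
qed (use assms in auto)

lemma family_tiles_zero_p:
  assumes "family_tiles m n {()} (\<lambda>_. 0) (\<lambda>_. 0) V f' g'" "M = m * q" "m > 0" "q > 0" "n > 0"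
    and "\<And>v. v \<in> V \<Longrightarrow> F' v mod m = f' v mod m \<and> G' v mod n = g' v mod n"
  shows "family_tiles M n V F' G' {0..<q} (\<lambda>j. j * m) (\<lambda>_. 0)"
proof (rule family_tiles_lift[OF assms(1,2), where r = 1 and h = "\<lambda>j. ((), j, 0)"])
  show "bij_betw (\<lambda>j. ((), j, 0)) ({0..<q}) ({()} \<times> {0..<q} \<times> {0..<1::int})"
    by (rule bij_betw_byWitness[where f' = "\<lambda>(_, j, _). j"]) auto
qed (use assms in auto)

lemma family_tiles_zero_2:
  assumes "family_tiles m 1 {()} (\<lambda>_. 0) (\<lambda>_. 0) V f' g'" "m > 0"
    and "\<And>v. v \<in> V \<Longrightarrow> F' v mod m = f' v mod m"
  shows "family_tiles m 2 V F' G' {0..<2} (\<lambda>_. 0) (\<lambda>k. k)"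
proof (rule family_tiles_lift[OF assms(1), where q = 1 and r = 2 and h = "\<lambda>k. ((), 0, k)"])
  show "bij_betw (\<lambda>k. ((), 0, k)) ({0..<2::int}) ({()} \<times> {0..<1::int} \<times> {0..<2::int})"
    by (rule bij_betw_byWitness[where f' = "\<lambda>(_, _, k). k"]) auto
qed (use assms in auto)

lemma family_tiles_zero_p2:
  assumes "family_tiles m 1 {()} (\<lambda>_. 0) (\<lambda>_. 0) V f' g'" "M = m * q" "m > 0" "q > 0"
    and "\<And>v. v \<in> V \<Longrightarrow> F' v mod m = f' v mod m"
  shows "family_tiles M 2 V F' G' ({0..<q} \<times> {0..<2}) (\<lambda>(j, k). j * m) (\<lambda>(j, k). k)"
proof (rule family_tiles_lift[OF assms(1,2), where r = 2 and h = "\<lambda>(j, k). ((), j, k)"])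
  show "bij_betw (\<lambda>(j, k). ((), j, k)) ({0..<q} \<times> {0..<2::int}) ({()} \<times> {0..<q} \<times> {0..<2::int})"
    by (rule bij_betw_byWitness[where f' = "\<lambda>(_, j, k). (j, k)"]) auto
qed (use assms in auto)

lemma tiles_families:
  assumes T: "family_tiles M N U f g V f' g'" and pos: "M > 0" "N > 0"
  shows "tiles M N (family M N U f g) (\<lambda>a. a) (family M N V f' g') (\<lambda>b. b)"
proof -
  have T: "tiles M N U (\<lambda>u. (f u, g u)) V (\<lambda>v. (f' v, g' v))" using T by (simp add: family_tiles_def)
  have red_sum: "red M N (red M N z + red M N w) = red M N (z + w)" for z w
    by (simp add: red_def mod_simps)
  show ?thesis
  proof (rule tilesI[OF pos])
    fix a b a' b'
    assume "a \<in> family M N U f g" "b \<in> family M N V f' g'" "a' \<in> family M N U f g" "b' \<in> family M N V f' g'"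
      and eq: "red M N (a + b) = red M N (a' + b')"
    then obtain u v u' v' where uv: "u \<in> U" "v \<in> V" "u' \<in> U" "v' \<in> V"
      and ab: "a = red M N (f u, g u)" "b = red M N (f' v, g' v)" "a' = red M N (f u', g u')" "b' = red M N (f' v', g' v')"
      unfolding family_def by blast
    have "u = u'" "v = v'" using tiles_unique[OF T uv] eq unfolding ab red_sum by blast+
    then show "a = a' \<and> b = b'" by (simp add: ab)
  next
    fix z assume z: "z \<in> box M N"
    obtain u v where uv: "u \<in> U" "v \<in> V" "red M N ((f u, g u) + (f' v, g' v)) = red M N z"
      using tiles_ex[OF T pos] by blast
    then have "red M N (red M N (f u, g u) + red M N (f' v, g' v)) = z" by (simp only: red_sum red_id[OF z])
    then show "\<exists>a\<in>family M N U f g. \<exists>b\<in>family M N V f' g'. red M N (a + b) = z"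
      using uv unfolding family_def by blast
  qed
qed

context
  fixes p :: nat
  assumes p: "p > 0"
begin

lemmas tiles_steps = p mult.assoc power2_eq_square power3_eq_cube case_prod_unfold

text \<open>
  Each of the nineteen pairs arises by lifting the trivial tiling along its chain of divisors. In every
  intermediate tiling the new parameters may be introduced freely, because they are multiplied by the
  modulus that has been reached.
\<close>

lemma family_tiles_pair1:
  "family_tiles (int p ^ 3) 2
  {0..<int p} (\<lambda>i. i + a i * int p) (\<lambda>i. a i)
  ({0..<(int p)\<^sup>2} \<times> {0..<2}) (\<lambda>(i, j). i * int p) (\<lambda>(i, j). j)"
proof -
  have T1: "family_tiles (int p) 1
      {()} (\<lambda>_. 0) (\<lambda>_. 0)
      {0..<int p} (\<lambda>i. i) (\<lambda>_. 0)"
    using family_tiles_zero_p[OF family_tiles_trivial,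
        where q = "int p" and F' = "\<lambda>_. 0" and G' = "\<lambda>_. 0"]
    by (simp add: tiles_steps)
  show ?thesis
    using family_tiles_zero_p2[OF T1,
        where q = "int p ^ 2" and F' = "\<lambda>i. i + a i * int p" and G' = "\<lambda>i. a i"]
    by (simp add: tiles_steps)
qed

lemma family_tiles_pair2:
  "family_tiles (int p ^ 3) 2
  {0..<2} (\<lambda>i. a i) (\<lambda>i. i)
  {0..<int p ^ 3} (\<lambda>i. i) (\<lambda>_. 0)"
proof -
  have T1: "family_tiles 1 2
      {()} (\<lambda>_. 0) (\<lambda>_. 0)
      {0..<2} (\<lambda>_. 0) (\<lambda>i. i)"
    using family_tiles_zero_2[OF family_tiles_trivial,
        where F' = "\<lambda>_. 0" and G' = "\<lambda>_. 0"]
    by (simp add: tiles_steps)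
  show ?thesis
    using family_tiles_zero_p[OF T1,
        where q = "int p ^ 3" and F' = "\<lambda>i. a i" and G' = "\<lambda>i. i"]
    by (simp add: tiles_steps)
qed

lemma family_tiles_pair3:
  "family_tiles (int p ^ 3) 2
  ({0..<int p} \<times> {0..<2}) (\<lambda>(i, j). i * int p + l i j * (int p)\<^sup>2) (\<lambda>(i, j). j)
  ({0..<int p} \<times> {0..<int p}) (\<lambda>(i, j). i + a i * int p + j * (int p)\<^sup>2) (\<lambda>(i, j). a i)"
proof -
  have T1: "family_tiles (int p) 1
      {()} (\<lambda>_. 0) (\<lambda>_. 0)
      {0..<int p} (\<lambda>i. i) (\<lambda>_. 0)"
    using family_tiles_zero_p[OF family_tiles_trivial,
        where q = "int p" and F' = "\<lambda>_. 0" and G' = "\<lambda>_. 0"]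
    by (simp add: tiles_steps)
  have T2: "family_tiles ((int p)\<^sup>2) 2
      {0..<int p} (\<lambda>i. i + a i * int p) (\<lambda>i. a i)
      ({0..<int p} \<times> {0..<2}) (\<lambda>(i, j). i * int p) (\<lambda>(i, j). j)"
    using family_tiles_zero_p2[OF T1,
        where q = "int p" and F' = "\<lambda>i. i + a i * int p" and G' = "\<lambda>i. a i"]
    by (simp add: tiles_steps)
  show ?thesis
    using family_tiles_p[OF T2,
        where q = "int p" and F' = "\<lambda>(i, j). i * int p + l i j * (int p)\<^sup>2" and G' = "\<lambda>(i, j). j"]
    by (simp add: tiles_steps)
qed

lemma family_tiles_pair4:
  "family_tiles (int p ^ 3) 2
  ({0..<int p} \<times> {0..<int p}) (\<lambda>(i, j). i + a i * int p + j * (int p)\<^sup>2) (\<lambda>(i, j). b i j)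
  ({0..<int p} \<times> {0..<2}) (\<lambda>(i, j). i * int p + l i * (int p)\<^sup>2) (\<lambda>(i, j). j)"
proof -
  have T1: "family_tiles (int p) 1
      {()} (\<lambda>_. 0) (\<lambda>_. 0)
      {0..<int p} (\<lambda>i. i) (\<lambda>_. 0)"
    using family_tiles_zero_p[OF family_tiles_trivial,
        where q = "int p" and F' = "\<lambda>_. 0" and G' = "\<lambda>_. 0"]
    by (simp add: tiles_steps)
  have T2: "family_tiles ((int p)\<^sup>2) 1
      {0..<int p} (\<lambda>i. i + a i * int p) (\<lambda>_. 0)
      {0..<int p} (\<lambda>i. i * int p) (\<lambda>_. 0)"
    using family_tiles_zero_p[OF T1,
        where q = "int p" and F' = "\<lambda>i. i + a i * int p" and G' = "\<lambda>_. 0"]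
    by (simp add: tiles_steps)
  have T3: "family_tiles (int p ^ 3) 1
      {0..<int p} (\<lambda>i. i * int p + l i * (int p)\<^sup>2) (\<lambda>_. 0)
      ({0..<int p} \<times> {0..<int p}) (\<lambda>(i, j). i + a i * int p + j * (int p)\<^sup>2) (\<lambda>_. 0)"
    using family_tiles_p[OF T2,
        where q = "int p" and F' = "\<lambda>i. i * int p + l i * (int p)\<^sup>2" and G' = "\<lambda>_. 0"]
    by (simp add: tiles_steps)
  show ?thesis
    using family_tiles_2[OF T3,
        where F' = "\<lambda>(i, j). i + a i * int p + j * (int p)\<^sup>2" and G' = "\<lambda>(i, j). b i j"]
    by (simp add: tiles_steps)
qed

lemma family_tiles_pair5:
  "family_tiles (int p ^ 3) 2
  ({0..<int p} \<times> {0..<int p}) (\<lambda>(i, j). i + j * int p + b i j * (int p)\<^sup>2) (\<lambda>(i, j). a i)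
  ({0..<2} \<times> {0..<int p}) (\<lambda>(i, j). l i * int p + j * (int p)\<^sup>2) (\<lambda>(i, j). i)"
proof -
  have T1: "family_tiles (int p) 1
      {()} (\<lambda>_. 0) (\<lambda>_. 0)
      {0..<int p} (\<lambda>i. i) (\<lambda>_. 0)"
    using family_tiles_zero_p[OF family_tiles_trivial,
        where q = "int p" and F' = "\<lambda>_. 0" and G' = "\<lambda>_. 0"]
    by (simp add: tiles_steps)
  have T2: "family_tiles (int p) 2
      {0..<int p} (\<lambda>i. i) (\<lambda>i. a i)
      {0..<2} (\<lambda>_. 0) (\<lambda>i. i)"
    using family_tiles_zero_2[OF T1,
        where F' = "\<lambda>i. i" and G' = "\<lambda>i. a i"]
    by (simp add: tiles_steps)
  have T3: "family_tiles ((int p)\<^sup>2) 2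
      {0..<2} (\<lambda>i. l i * int p) (\<lambda>i. i)
      ({0..<int p} \<times> {0..<int p}) (\<lambda>(i, j). i + j * int p) (\<lambda>(i, j). a i)"
    using family_tiles_p[OF T2,
        where q = "int p" and F' = "\<lambda>i. l i * int p" and G' = "\<lambda>i. i"]
    by (simp add: tiles_steps)
  show ?thesis
    using family_tiles_p[OF T3,
        where q = "int p" and F' = "\<lambda>(i, j). i + j * int p + b i j * (int p)\<^sup>2" and G' = "\<lambda>(i, j). a i"]
    by (simp add: tiles_steps)
qed

lemma family_tiles_pair6:
  "family_tiles (int p ^ 3) 2
  {0..<(int p)\<^sup>2} (\<lambda>i. i + a i * (int p)\<^sup>2) (\<lambda>i. a i)
  ({0..<int p} \<times> {0..<2}) (\<lambda>(i, j). i * (int p)\<^sup>2) (\<lambda>(i, j). j)"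
proof -
  have T1: "family_tiles ((int p)\<^sup>2) 1
      {()} (\<lambda>_. 0) (\<lambda>_. 0)
      {0..<(int p)\<^sup>2} (\<lambda>i. i) (\<lambda>_. 0)"
    using family_tiles_zero_p[OF family_tiles_trivial,
        where q = "int p ^ 2" and F' = "\<lambda>_. 0" and G' = "\<lambda>_. 0"]
    by (simp add: tiles_steps)
  show ?thesis
    using family_tiles_zero_p2[OF T1,
        where q = "int p" and F' = "\<lambda>i. i + a i * (int p)\<^sup>2" and G' = "\<lambda>i. a i"]
    by (simp add: tiles_steps)
qed

lemma family_tiles_pair7:
  "family_tiles (int p ^ 3) 2
  {0..<(int p)\<^sup>2} (\<lambda>i. i * int p) (\<lambda>i. l i)
  ({0..<int p} \<times> {0..<2}) (\<lambda>(i, j). i + a i * int p) (\<lambda>(i, j). j)"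
proof -
  have T1: "family_tiles (int p) 1
      {()} (\<lambda>_. 0) (\<lambda>_. 0)
      {0..<int p} (\<lambda>i. i) (\<lambda>_. 0)"
    using family_tiles_zero_p[OF family_tiles_trivial,
        where q = "int p" and F' = "\<lambda>_. 0" and G' = "\<lambda>_. 0"]
    by (simp add: tiles_steps)
  have T2: "family_tiles (int p ^ 3) 1
      {0..<int p} (\<lambda>i. i + a i * int p) (\<lambda>_. 0)
      {0..<(int p)\<^sup>2} (\<lambda>i. i * int p) (\<lambda>_. 0)"
    using family_tiles_zero_p[OF T1,
        where q = "int p ^ 2" and F' = "\<lambda>i. i + a i * int p" and G' = "\<lambda>_. 0"]
    by (simp add: tiles_steps)
  show ?thesis
    using family_tiles_2[OF T2,
        where F' = "\<lambda>i. i * int p" and G' = "\<lambda>i. l i"]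
    by (simp add: tiles_steps)
qed

lemma family_tiles_pair8:
  "family_tiles (int p ^ 3) 2
  {0..<(int p)\<^sup>2} (\<lambda>i. i + l i * (int p)\<^sup>2) (\<lambda>_. 0)
  ({0..<2} \<times> {0..<int p}) (\<lambda>(i, j). a i + j * (int p)\<^sup>2) (\<lambda>(i, j). i)"
proof -
  have T1: "family_tiles 1 2
      {()} (\<lambda>_. 0) (\<lambda>_. 0)
      {0..<2} (\<lambda>_. 0) (\<lambda>i. i)"
    using family_tiles_zero_2[OF family_tiles_trivial,
        where F' = "\<lambda>_. 0" and G' = "\<lambda>_. 0"]
    by (simp add: tiles_steps)
  have T2: "family_tiles ((int p)\<^sup>2) 2
      {0..<2} (\<lambda>i. a i) (\<lambda>i. i)
      {0..<(int p)\<^sup>2} (\<lambda>i. i) (\<lambda>_. 0)"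
    using family_tiles_zero_p[OF T1,
        where q = "int p ^ 2" and F' = "\<lambda>i. a i" and G' = "\<lambda>i. i"]
    by (simp add: tiles_steps)
  show ?thesis
    using family_tiles_p[OF T2,
        where q = "int p" and F' = "\<lambda>i. i + l i * (int p)\<^sup>2" and G' = "\<lambda>_. 0"]
    by (simp add: tiles_steps)
qed

lemma family_tiles_pair9:
  "family_tiles (int p ^ 3) 2
  ({0..<int p} \<times> {0..<2}) (\<lambda>(i, j). i + a i * int p + b i j * (int p)\<^sup>2) (\<lambda>(i, j). j)
  ({0..<int p} \<times> {0..<int p}) (\<lambda>(i, j). i * int p + j * (int p)\<^sup>2) (\<lambda>(i, j). l i)"
proof -
  have T1: "family_tiles (int p) 1
      {()} (\<lambda>_. 0) (\<lambda>_. 0)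
      {0..<int p} (\<lambda>i. i) (\<lambda>_. 0)"
    using family_tiles_zero_p[OF family_tiles_trivial,
        where q = "int p" and F' = "\<lambda>_. 0" and G' = "\<lambda>_. 0"]
    by (simp add: tiles_steps)
  have T2: "family_tiles ((int p)\<^sup>2) 1
      {0..<int p} (\<lambda>i. i + a i * int p) (\<lambda>_. 0)
      {0..<int p} (\<lambda>i. i * int p) (\<lambda>_. 0)"
    using family_tiles_zero_p[OF T1,
        where q = "int p" and F' = "\<lambda>i. i + a i * int p" and G' = "\<lambda>_. 0"]
    by (simp add: tiles_steps)
  have T3: "family_tiles ((int p)\<^sup>2) 2
      {0..<int p} (\<lambda>i. i * int p) (\<lambda>i. l i)
      ({0..<int p} \<times> {0..<2}) (\<lambda>(i, j). i + a i * int p) (\<lambda>(i, j). j)"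
    using family_tiles_2[OF T2,
        where F' = "\<lambda>i. i * int p" and G' = "\<lambda>i. l i"]
    by (simp add: tiles_steps)
  show ?thesis
    using family_tiles_p[OF T3,
        where q = "int p" and F' = "\<lambda>(i, j). i + a i * int p + b i j * (int p)\<^sup>2" and G' = "\<lambda>(i, j). j"]
    by (simp add: tiles_steps)
qed

lemma family_tiles_pair10:
  "family_tiles (int p ^ 3) 2
  ({0..<2} \<times> {0..<int p}) (\<lambda>(i, j). a i + j * int p + b i j * (int p)\<^sup>2) (\<lambda>(i, j). i)
  ({0..<int p} \<times> {0..<int p}) (\<lambda>(i, j). i + l i * int p + j * (int p)\<^sup>2) (\<lambda>_. 0)"
proof -
  have T1: "family_tiles 1 2
      {()} (\<lambda>_. 0) (\<lambda>_. 0)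
      {0..<2} (\<lambda>_. 0) (\<lambda>i. i)"
    using family_tiles_zero_2[OF family_tiles_trivial,
        where F' = "\<lambda>_. 0" and G' = "\<lambda>_. 0"]
    by (simp add: tiles_steps)
  have T2: "family_tiles (int p) 2
      {0..<2} (\<lambda>i. a i) (\<lambda>i. i)
      {0..<int p} (\<lambda>i. i) (\<lambda>_. 0)"
    using family_tiles_zero_p[OF T1,
        where q = "int p" and F' = "\<lambda>i. a i" and G' = "\<lambda>i. i"]
    by (simp add: tiles_steps)
  have T3: "family_tiles ((int p)\<^sup>2) 2
      {0..<int p} (\<lambda>i. i + l i * int p) (\<lambda>_. 0)
      ({0..<2} \<times> {0..<int p}) (\<lambda>(i, j). a i + j * int p) (\<lambda>(i, j). i)"
    using family_tiles_p[OF T2,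
        where q = "int p" and F' = "\<lambda>i. i + l i * int p" and G' = "\<lambda>_. 0"]
    by (simp add: tiles_steps)
  show ?thesis
    using family_tiles_p[OF T3,
        where q = "int p" and F' = "\<lambda>(i, j). a i + j * int p + b i j * (int p)\<^sup>2" and G' = "\<lambda>(i, j). i"]
    by (simp add: tiles_steps)
qed

lemma family_tiles_pair11:
  "family_tiles (int p ^ 3) 2
  ({0..<int p} \<times> {0..<2}) (\<lambda>(i, j). i + b i j * int p) (\<lambda>(i, j). j)
  {0..<(int p)\<^sup>2} (\<lambda>i. i * int p) (\<lambda>_. 0)"
proof -
  have T1: "family_tiles (int p) 2
      {()} (\<lambda>_. 0) (\<lambda>_. 0)
      ({0..<int p} \<times> {0..<2}) (\<lambda>(i, j). i) (\<lambda>(i, j). j)"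
    using family_tiles_zero_p2[OF family_tiles_trivial,
        where q = "int p" and F' = "\<lambda>_. 0" and G' = "\<lambda>_. 0"]
    by (simp add: tiles_steps)
  show ?thesis
    using family_tiles_zero_p[OF T1,
        where q = "int p ^ 2" and F' = "\<lambda>(i, j). i + b i j * int p" and G' = "\<lambda>(i, j). j"]
    by (simp add: tiles_steps)
qed

lemma family_tiles_pair12:
  "family_tiles (int p ^ 3) 2
  {0..<2} (\<lambda>i. l i * (int p)\<^sup>2) (\<lambda>i. i)
  ({0..<(int p)\<^sup>2} \<times> {0..<int p}) (\<lambda>(i, j). i + j * (int p)\<^sup>2) (\<lambda>(i, j). a i)"
proof -
  have T1: "family_tiles ((int p)\<^sup>2) 1
      {()} (\<lambda>_. 0) (\<lambda>_. 0)
      {0..<(int p)\<^sup>2} (\<lambda>i. i) (\<lambda>_. 0)"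
    using family_tiles_zero_p[OF family_tiles_trivial,
        where q = "int p ^ 2" and F' = "\<lambda>_. 0" and G' = "\<lambda>_. 0"]
    by (simp add: tiles_steps)
  have T2: "family_tiles ((int p)\<^sup>2) 2
      {0..<(int p)\<^sup>2} (\<lambda>i. i) (\<lambda>i. a i)
      {0..<2} (\<lambda>_. 0) (\<lambda>i. i)"
    using family_tiles_zero_2[OF T1,
        where F' = "\<lambda>i. i" and G' = "\<lambda>i. a i"]
    by (simp add: tiles_steps)
  show ?thesis
    using family_tiles_p[OF T2,
        where q = "int p" and F' = "\<lambda>i. l i * (int p)\<^sup>2" and G' = "\<lambda>i. i"]
    by (simp add: tiles_steps)
qed

lemma family_tiles_pair13:
  "family_tiles (int p ^ 3) 2
  {0..<2} (\<lambda>i. l i * int p) (\<lambda>i. i)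
  ({0..<int p} \<times> {0..<(int p)\<^sup>2}) (\<lambda>(i, j). i + j * int p) (\<lambda>(i, j). a i)"
proof -
  have T1: "family_tiles (int p) 1
      {()} (\<lambda>_. 0) (\<lambda>_. 0)
      {0..<int p} (\<lambda>i. i) (\<lambda>_. 0)"
    using family_tiles_zero_p[OF family_tiles_trivial,
        where q = "int p" and F' = "\<lambda>_. 0" and G' = "\<lambda>_. 0"]
    by (simp add: tiles_steps)
  have T2: "family_tiles (int p) 2
      {0..<int p} (\<lambda>i. i) (\<lambda>i. a i)
      {0..<2} (\<lambda>_. 0) (\<lambda>i. i)"
    using family_tiles_zero_2[OF T1,
        where F' = "\<lambda>i. i" and G' = "\<lambda>i. a i"]
    by (simp add: tiles_steps)
  show ?thesis
    using family_tiles_p[OF T2,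
        where q = "int p ^ 2" and F' = "\<lambda>i. l i * int p" and G' = "\<lambda>i. i"]
    by (simp add: tiles_steps)
qed

lemma family_tiles_pair14:
  "family_tiles (int p ^ 3) 2
  {0..<int p ^ 3} (\<lambda>i. i) (\<lambda>i. a i)
  {0..<2} (\<lambda>_. 0) (\<lambda>i. i)"
proof -
  have T1: "family_tiles (int p ^ 3) 1
      {()} (\<lambda>_. 0) (\<lambda>_. 0)
      {0..<int p ^ 3} (\<lambda>i. i) (\<lambda>_. 0)"
    using family_tiles_zero_p[OF family_tiles_trivial,
        where q = "int p ^ 3" and F' = "\<lambda>_. 0" and G' = "\<lambda>_. 0"]
    by (simp add: tiles_steps)
  show ?thesis
    using family_tiles_zero_2[OF T1,
        where F' = "\<lambda>i. i" and G' = "\<lambda>i. a i"]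
    by (simp add: tiles_steps)
qed

lemma family_tiles_pair15:
  "family_tiles (int p ^ 3) 2
  {0..<int p} (\<lambda>i. i * (int p)\<^sup>2) (\<lambda>i. l i)
  ({0..<(int p)\<^sup>2} \<times> {0..<2}) (\<lambda>(i, j). i + a i * (int p)\<^sup>2) (\<lambda>(i, j). j)"
proof -
  have T1: "family_tiles ((int p)\<^sup>2) 1
      {()} (\<lambda>_. 0) (\<lambda>_. 0)
      {0..<(int p)\<^sup>2} (\<lambda>i. i) (\<lambda>_. 0)"
    using family_tiles_zero_p[OF family_tiles_trivial,
        where q = "int p ^ 2" and F' = "\<lambda>_. 0" and G' = "\<lambda>_. 0"]
    by (simp add: tiles_steps)
  have T2: "family_tiles (int p ^ 3) 1
      {0..<(int p)\<^sup>2} (\<lambda>i. i + a i * (int p)\<^sup>2) (\<lambda>_. 0)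
      {0..<int p} (\<lambda>i. i * (int p)\<^sup>2) (\<lambda>_. 0)"
    using family_tiles_zero_p[OF T1,
        where q = "int p" and F' = "\<lambda>i. i + a i * (int p)\<^sup>2" and G' = "\<lambda>_. 0"]
    by (simp add: tiles_steps)
  show ?thesis
    using family_tiles_2[OF T2,
        where F' = "\<lambda>i. i * (int p)\<^sup>2" and G' = "\<lambda>i. l i"]
    by (simp add: tiles_steps)
qed

lemma family_tiles_pair16:
  "family_tiles (int p ^ 3) 2
  {0..<int p} (\<lambda>i. i * int p + l i * (int p)\<^sup>2) (\<lambda>_. 0)
  ({0..<int p} \<times> {0..<int p} \<times> {0..<2}) (\<lambda>(i, j, k). i + b i k * int p + j * (int p)\<^sup>2) (\<lambda>(i, j, k). k)"
proof -
  have T1: "family_tiles (int p) 2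
      {()} (\<lambda>_. 0) (\<lambda>_. 0)
      ({0..<int p} \<times> {0..<2}) (\<lambda>(i, j). i) (\<lambda>(i, j). j)"
    using family_tiles_zero_p2[OF family_tiles_trivial,
        where q = "int p" and F' = "\<lambda>_. 0" and G' = "\<lambda>_. 0"]
    by (simp add: tiles_steps)
  have T2: "family_tiles ((int p)\<^sup>2) 2
      ({0..<int p} \<times> {0..<2}) (\<lambda>(i, j). i + b i j * int p) (\<lambda>(i, j). j)
      {0..<int p} (\<lambda>i. i * int p) (\<lambda>_. 0)"
    using family_tiles_zero_p[OF T1,
        where q = "int p" and F' = "\<lambda>(i, j). i + b i j * int p" and G' = "\<lambda>(i, j). j"]
    by (simp add: tiles_steps)
  show ?thesis
    using family_tiles_p_pair[OF T2,
        where q = "int p" and F' = "\<lambda>i. i * int p + l i * (int p)\<^sup>2" and G' = "\<lambda>_. 0"]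
    by (simp add: tiles_steps)
qed

lemma family_tiles_pair17:
  "family_tiles (int p ^ 3) 2
  {0..<int p} (\<lambda>i. i * int p + l i * (int p)\<^sup>2) (\<lambda>i. l i)
  ({0..<int p} \<times> {0..<int p} \<times> {0..<2}) (\<lambda>(i, j, k). i + a i * int p + j * (int p)\<^sup>2) (\<lambda>(i, j, k). k)"
proof -
  have T1: "family_tiles (int p) 1
      {()} (\<lambda>_. 0) (\<lambda>_. 0)
      {0..<int p} (\<lambda>i. i) (\<lambda>_. 0)"
    using family_tiles_zero_p[OF family_tiles_trivial,
        where q = "int p" and F' = "\<lambda>_. 0" and G' = "\<lambda>_. 0"]
    by (simp add: tiles_steps)
  have T2: "family_tiles ((int p)\<^sup>2) 1
      {0..<int p} (\<lambda>i. i + a i * int p) (\<lambda>_. 0)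
      {0..<int p} (\<lambda>i. i * int p) (\<lambda>_. 0)"
    using family_tiles_zero_p[OF T1,
        where q = "int p" and F' = "\<lambda>i. i + a i * int p" and G' = "\<lambda>_. 0"]
    by (simp add: tiles_steps)
  show ?thesis
    using family_tiles_p2[OF T2,
        where q = "int p" and F' = "\<lambda>i. i * int p + l i * (int p)\<^sup>2" and G' = "\<lambda>i. l i"]
    by (simp add: tiles_steps)
qed

lemma family_tiles_pair18:
  "family_tiles (int p ^ 3) 2
  {0..<int p} (\<lambda>i. i + l i * int p) (\<lambda>_. 0)
  ({0..<2} \<times> {0..<(int p)\<^sup>2}) (\<lambda>(i, j). a i + j * int p) (\<lambda>(i, j). i)"
proof -
  have T1: "family_tiles 1 2
      {()} (\<lambda>_. 0) (\<lambda>_. 0)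
      {0..<2} (\<lambda>_. 0) (\<lambda>i. i)"
    using family_tiles_zero_2[OF family_tiles_trivial,
        where F' = "\<lambda>_. 0" and G' = "\<lambda>_. 0"]
    by (simp add: tiles_steps)
  have T2: "family_tiles (int p) 2
      {0..<2} (\<lambda>i. a i) (\<lambda>i. i)
      {0..<int p} (\<lambda>i. i) (\<lambda>_. 0)"
    using family_tiles_zero_p[OF T1,
        where q = "int p" and F' = "\<lambda>i. a i" and G' = "\<lambda>i. i"]
    by (simp add: tiles_steps)
  show ?thesis
    using family_tiles_p[OF T2,
        where q = "int p ^ 2" and F' = "\<lambda>i. i + l i * int p" and G' = "\<lambda>_. 0"]
    by (simp add: tiles_steps)
qed

lemma family_tiles_pair19:
  "family_tiles (int p ^ 3) 2
  ({0..<(int p)\<^sup>2} \<times> {0..<2}) (\<lambda>(i, j). i + b i j * (int p)\<^sup>2) (\<lambda>(i, j). j)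
  {0..<int p} (\<lambda>i. i * (int p)\<^sup>2) (\<lambda>_. 0)"
proof -
  have T1: "family_tiles ((int p)\<^sup>2) 2
      {()} (\<lambda>_. 0) (\<lambda>_. 0)
      ({0..<(int p)\<^sup>2} \<times> {0..<2}) (\<lambda>(i, j). i) (\<lambda>(i, j). j)"
    using family_tiles_zero_p2[OF family_tiles_trivial,
        where q = "int p ^ 2" and F' = "\<lambda>_. 0" and G' = "\<lambda>_. 0"]
    by (simp add: tiles_steps)
  show ?thesis
    using family_tiles_zero_p[OF T1,
        where q = "int p" and F' = "\<lambda>(i, j). i + b i j * (int p)\<^sup>2" and G' = "\<lambda>(i, j). j"]
    by (simp add: tiles_steps)
qed

end

lemma listed_pair_tiles:
  assumes "listed_pair p S C" "p > 0"
  shows "tiles (int p ^ 3) 2 S (\<lambda>s. s) C (\<lambda>c. c)"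
proof -
  have pos: "int p ^ 3 > 0" "(2::int) > 0" using assms(2) by simp_all
  have zero: "(\<lambda>(i :: int, j :: int). 0 :: int) = (\<lambda>_. 0)" by auto
  note direct = tiles_families[OF _ pos]
  note swapped = tiles_families[OF family_tiles_commute pos]
  show ?thesis
    using assms(1)
  proof cases
    case (pair1 a)
    show ?thesis
      unfolding pair1 elt_family_1 elt_family_2 elt_family_3 by (rule direct, rule family_tiles_pair1[OF assms(2)])
  next
    case (pair2 a)
    show ?thesis
      unfolding pair2 elt_family_1 elt_family_2 elt_family_3 by (rule direct, rule family_tiles_pair2[OF assms(2)])
  next
    case (pair3 a l)
    show ?thesis
      unfolding pair3 elt_family_1 elt_family_2 elt_family_3 by (rule swapped, rule family_tiles_pair3[OF assms(2)])
  next
    case (pair4 a b l)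
    show ?thesis
      unfolding pair4 elt_family_1 elt_family_2 elt_family_3 by (rule direct, rule family_tiles_pair4[OF assms(2)])
  next
    case (pair5 a b l)
    show ?thesis
      unfolding pair5 elt_family_1 elt_family_2 elt_family_3 by (rule direct, rule family_tiles_pair5[OF assms(2)])
  next
    case (pair6 a)
    show ?thesis
      unfolding pair6 elt_family_1 elt_family_2 elt_family_3 by (rule direct, rule family_tiles_pair6[OF assms(2)])
  next
    case (pair7 a l)
    show ?thesis
      unfolding pair7 elt_family_1 elt_family_2 elt_family_3 by (rule swapped, rule family_tiles_pair7[OF assms(2)])
  next
    case (pair8 a l)
    show ?thesis
      unfolding pair8 elt_family_1 elt_family_2 elt_family_3 by (rule swapped, rule family_tiles_pair8[OF assms(2)])
  next
    case (pair9 a b l)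
    show ?thesis
      unfolding pair9 elt_family_1 elt_family_2 elt_family_3 by (rule direct, rule family_tiles_pair9[OF assms(2)])
  next
    case (pair10 a b l)
    show ?thesis
      unfolding pair10 elt_family_1 elt_family_2 elt_family_3 zero by (rule direct, rule family_tiles_pair10[OF assms(2)])
  next
    case (pair11 b)
    show ?thesis
      unfolding pair11 elt_family_1 elt_family_2 elt_family_3 by (rule direct, rule family_tiles_pair11[OF assms(2)])
  next
    case (pair12 a l)
    show ?thesis
      unfolding pair12 elt_family_1 elt_family_2 elt_family_3 by (rule swapped, rule family_tiles_pair12[OF assms(2)])
  next
    case (pair13 a l)
    show ?thesis
      unfolding pair13 elt_family_1 elt_family_2 elt_family_3 by (rule swapped, rule family_tiles_pair13[OF assms(2)])
  next
    case (pair14 a)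
    show ?thesis
      unfolding pair14 elt_family_1 elt_family_2 elt_family_3 by (rule direct, rule family_tiles_pair14[OF assms(2)])
  next
    case (pair15 a l)
    show ?thesis
      unfolding pair15 elt_family_1 elt_family_2 elt_family_3 by (rule swapped, rule family_tiles_pair15[OF assms(2)])
  next
    case (pair16 b l)
    show ?thesis
      unfolding pair16 elt_family_1 elt_family_2 elt_family_3 by (rule swapped, rule family_tiles_pair16[OF assms(2)])
  next
    case (pair17 a l)
    show ?thesis
      unfolding pair17 elt_family_1 elt_family_2 elt_family_3 by (rule swapped, rule family_tiles_pair17[OF assms(2)])
  next
    case (pair18 a l)
    show ?thesis
      unfolding pair18 elt_family_1 elt_family_2 elt_family_3 by (rule swapped, rule family_tiles_pair18[OF assms(2)])
  next
    case (pair19 b)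
    show ?thesis
      unfolding pair19 elt_family_1 elt_family_2 elt_family_3 by (rule direct, rule family_tiles_pair19[OF assms(2)])
  qed
qed

section \<open>Perfect codes as factorizations\<close>

context
  fixes p :: nat
  assumes p: "p > 0"
begin

lemma carrier_Z_p3_2: "carrier (Z_p3_2 p) = box (int p ^ 3) 2"
  using p by (simp add: Z_p3_2_def box_def carrier_integer_mod_group)

lemma one_Z_p3_2: "\<one>\<^bsub>Z_p3_2 p\<^esub> = (0, 0)"
  by (simp add: Z_p3_2_def)

lemma mult_Z_p3_2: "z \<otimes>\<^bsub>Z_p3_2 p\<^esub> w = red (int p ^ 3) 2 (z + w)"
  by (cases z; cases w) (simp add: Z_p3_2_def red_def)

lemma inv_Z_p3_2:
  assumes "z \<in> carrier (Z_p3_2 p)"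
  shows "inv\<^bsub>Z_p3_2 p\<^esub> z = red (int p ^ 3) 2 (- z)"
proof -
  obtain x y where z: "z = (x, y)" by (cases z)
  have "x \<in> carrier (integer_mod_group (p ^ 3))" "y \<in> carrier (integer_mod_group 2)"
    using assms by (simp_all add: Z_p3_2_def z)
  then show ?thesis by (simp add: Z_p3_2_def z inv_DirProd red_def)
qed

text \<open>
  The arcs starting at \<open>c\<close> lead to the points \<open>s + c\<close> with \<open>s \<in> S\<close>, and \<open>c\<close> itself is the case \<open>s = 0\<close>.
\<close>

lemma closed_out_nbhd_Z_p3_2:
  assumes S: "S \<subseteq> carrier (Z_p3_2 p)" and c: "c \<in> carrier (Z_p3_2 p)"
  shows "closed_out_nbhd (cayley_digraph (Z_p3_2 p) S) c =
    (\<lambda>s. red (int p ^ 3) 2 (s + c)) ` insert (0, 0) S"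
proof -
  let ?r = "red (int p ^ 3) 2"
  have diff: "v \<otimes>\<^bsub>Z_p3_2 p\<^esub> inv\<^bsub>Z_p3_2 p\<^esub> c = ?r (v - c)" for v
    unfolding inv_Z_p3_2[OF c] mult_Z_p3_2 by (simp add: red_def mod_simps)
  have rc: "?r c = c" using c by (simp add: carrier_Z_p3_2 red_id)
  have "{v. v \<in> carrier (Z_p3_2 p) \<and> ?r (v - c) \<in> S} = (\<lambda>s. ?r (s + c)) ` S"
  proof (intro equalityI subsetI)
    fix v assume "v \<in> {v. v \<in> carrier (Z_p3_2 p) \<and> ?r (v - c) \<in> S}"
    then have v: "?r v = v" "?r (v - c) \<in> S" by (simp_all add: carrier_Z_p3_2 red_id)
    have "?r (?r (v - c) + c) = ?r v" by (simp add: red_def mod_simps)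
    then show "v \<in> (\<lambda>s. ?r (s + c)) ` S" using v by (metis imageI)
  next
    fix v assume "v \<in> (\<lambda>s. ?r (s + c)) ` S"
    then obtain s where s: "s \<in> S" "v = ?r (s + c)" by blast
    have "?r (?r (s + c) - c) = ?r s" by (simp add: red_def mod_simps)
    also have "\<dots> = s" using s S by (auto simp: carrier_Z_p3_2 intro: red_id)
    finally show "v \<in> {v. v \<in> carrier (Z_p3_2 p) \<and> ?r (v - c) \<in> S}"
      using s p by (simp add: carrier_Z_p3_2 red_in_box)
  qed
  moreover have "?r ((0, 0) + c) = c" using rc by (simp add: plus_prod_def)
  ultimately show ?thesis
    using c by (simp add: closed_out_nbhd_def cayley_digraph_def diff)
qed

lemma perfect_code_iff_tiles:
  assumes S: "S \<subseteq> carrier (Z_p3_2 p)" and C: "C \<subseteq> carrier (Z_p3_2 p)"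
  shows "perfect_code (cayley_digraph (Z_p3_2 p) S) C \<longleftrightarrow>
    tiles (int p ^ 3) 2 (insert (0, 0) S) (\<lambda>s. s) C (\<lambda>c. c)"
proof -
  let ?r = "red (int p ^ 3) 2" and ?S = "insert (0, 0) S" and ?D = "cayley_digraph (Z_p3_2 p) S"
  have pos: "int p ^ 3 > 0" "(2::int) > 0" using p by simp_all
  have nbhd: "closed_out_nbhd ?D c = (\<lambda>s. ?r (s + c)) ` ?S" if "c \<in> C" for c
    using closed_out_nbhd_Z_p3_2[OF S] C that by blast
  have verts: "pverts ?D = box (int p ^ 3) 2" by (simp add: cayley_digraph_def carrier_Z_p3_2)
  have S_box: "?S \<subseteq> box (int p ^ 3) 2" using S p by (auto simp: carrier_Z_p3_2 box_def)
  show ?thesis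
  proof
    assume pc: "perfect_code ?D C"
    then have disj: "disjoint_family_on (closed_out_nbhd ?D) C"
      and cover: "(\<Union>c\<in>C. closed_out_nbhd ?D c) = box (int p ^ 3) 2"
      by (simp_all add: perfect_code_def verts)
    show "tiles (int p ^ 3) 2 ?S (\<lambda>s. s) C (\<lambda>c. c)"
    proof (rule tilesI[OF pos])
      fix s c s' c' assume sc: "s \<in> ?S" "c \<in> C" "s' \<in> ?S" "c' \<in> C" and eq: "?r (s + c) = ?r (s' + c')"
      have "?r (s + c) \<in> closed_out_nbhd ?D c" unfolding nbhd[OF sc(2)] using sc(1) by (rule imageI)
      moreover have "?r (s + c) \<in> closed_out_nbhd ?D c'"
        unfolding nbhd[OF sc(4)] eq using sc(3) by (rule imageI)
      ultimately have "c = c'" using disj sc unfolding disjoint_family_on_def by blast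
      then have "?r s = ?r s'" using eq unfolding red_eq_iff by simp
      then have "s = s'" using sc S_box red_id by (metis subsetD)
      then show "s = s' \<and> c = c'" using \<open>c = c'\<close> by simp
    next
      fix z assume "z \<in> box (int p ^ 3) 2"
      then obtain c where c: "c \<in> C" "z \<in> closed_out_nbhd ?D c" using cover by blast
      then show "\<exists>s\<in>?S. \<exists>c\<in>C. ?r (s + c) = z" using c(2) unfolding nbhd[OF c(1)] by blast
    qed
  next
    assume T: "tiles (int p ^ 3) 2 ?S (\<lambda>s. s) C (\<lambda>c. c)"
    have "disjoint_family_on (closed_out_nbhd ?D) C"
      unfolding disjoint_family_on_def
    proof (intro ballI impI)
      fix c c' assume c: "c \<in> C" "c' \<in> C" "c \<noteq> c'"
      show "closed_out_nbhd ?D c \<inter> closed_out_nbhd ?D c' = {}"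
        unfolding nbhd[OF c(1)] nbhd[OF c(2)]
        using tiles_unique(2)[OF T _ c(1) _ c(2)] c(3) by blast
    qed
    moreover have "(\<Union>c\<in>C. closed_out_nbhd ?D c) = box (int p ^ 3) 2"
    proof (intro equalityI subsetI)
      fix z assume "z \<in> (\<Union>c\<in>C. closed_out_nbhd ?D c)"
      then obtain c where c: "c \<in> C" "z \<in> closed_out_nbhd ?D c" by blast
      then have "z \<in> (\<lambda>s. ?r (s + c)) ` ?S" unfolding nbhd[OF c(1)] by simp
      then show "z \<in> box (int p ^ 3) 2" using red_in_box[OF pos] by blast
    next
      fix z assume z: "z \<in> box (int p ^ 3) 2"
      obtain s c where sc: "s \<in> ?S" "c \<in> C" "?r (s + c) = ?r z"
        using tiles_ex[OF T pos, of z] by blast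
      have "z \<in> closed_out_nbhd ?D c"
        unfolding nbhd[OF sc(2)] using sc(1,3) red_id[OF z] by (intro image_eqI[of _ _ s]) simp_all
      then show "z \<in> (\<Union>c\<in>C. closed_out_nbhd ?D c)" using sc(2) by blast
    qed
    ultimately show "perfect_code ?D C"
      using C by (simp add: perfect_code_def verts carrier_Z_p3_2)
  qed
qed

text \<open>
  The elements that reduce to \<open>0\<close> form a subgroup. With this lemma a generating set cannot be lifted
  injectively in the lowest step of a tower.
\<close>

lemma generate_subset_red_eq_0:
  assumes S: "S \<subseteq> carrier (Z_p3_2 p)" and zero: "\<And>z. z \<in> S \<Longrightarrow> red m n z = (0, 0)"
    and dvd: "m dvd int p ^ 3" "n dvd 2" and z: "z \<in> generate (Z_p3_2 p) S"
  shows "red m n z = (0, 0)"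
  using z
proof (induction rule: generate.induct)
  case one
  then show ?case by (simp add: one_Z_p3_2 red_def)
next
  case (incl h)
  then show ?case by (rule zero)
next
  case (inv h)
  have "red m n (- h) = (0, 0)" using zero[OF inv] by (auto simp: red_def mod_eq_0_iff_dvd)
  moreover have "h \<in> carrier (Z_p3_2 p)" using S inv by blast
  ultimately show ?case using dvd by (simp add: inv_Z_p3_2 red_red)
next
  case (eng h1 h2)
  have "red m n (h1 + h2) = red m n ((0, 0) + (0, 0))"
    using eng by (intro red_add_cong) (simp_all add: red_def)
  then show ?case using dvd by (simp add: mult_Z_p3_2 red_red) (simp add: red_def)
qed

end

section \<open>The classification\<close>

lemmas tower_imp_pairs = tower_imp_pair1 tower_imp_pair2 tower_imp_pair3 tower_imp_pair4 tower_imp_pair5 tower_imp_pair6 tower_imp_pair7 tower_imp_pair8 tower_imp_pair9 tower_imp_pair10 tower_imp_pair11 tower_imp_pair12 tower_imp_pair13 tower_imp_pair14 tower_imp_pair15 tower_imp_pair16 tower_imp_pair17 tower_imp_pair18 tower_imp_pair19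

theorem theorem5p6:
  fixes p :: nat and S C :: "(int \<times> int) set"
  assumes "prime p" and "odd p"
    and "S \<subset> carrier (Z_p3_2 p) - {\<one>\<^bsub>Z_p3_2 p\<^esub>}"
    and "generate (Z_p3_2 p) S = carrier (Z_p3_2 p)"
    and "\<one>\<^bsub>Z_p3_2 p\<^esub> \<in> C" and "C \<subseteq> carrier (Z_p3_2 p)"
  shows "perfect_code (cayley_digraph (Z_p3_2 p) S) C \<longleftrightarrow>
         listed_pair p (insert \<one>\<^bsub>Z_p3_2 p\<^esub> S) C"
proof -
  let ?S = "insert (0, 0) S"
  have p: "p > 0" "p > 2" using assms(1,2) prime_ge_2_nat[of p] by (auto simp: order_le_less)
  note Z = carrier_Z_p3_2[OF p(1)] one_Z_p3_2[OF p(1)]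
  have S: "S \<subset> box (int p ^ 3) 2 - {(0, 0)}" "S \<subseteq> carrier (Z_p3_2 p)" using assms(3) Z by auto
  have C: "(0, 0) \<in> C" "C \<subseteq> box (int p ^ 3) 2" using assms(5,6) Z by auto
  have code: "perfect_code (cayley_digraph (Z_p3_2 p) S) C \<longleftrightarrow>
      tiles (int p ^ 3) 2 ?S (\<lambda>s. s) C (\<lambda>c. c)"
    using perfect_code_iff_tiles[OF p(1) S(2) assms(6)] .
  \<comment> \<open>The element \<open>(1, 1)\<close> lies in no proper subgroup, so \<open>S\<close> cannot consist of elements that reduce to \<open>0\<close>.\<close>
  have no_proper_reduction: False
    if triv: "\<forall>z\<in>?S. red (int p ^ a) (2 ^ b) z = (0, 0)" and ab: "(a, b) \<noteq> (0, 0)" "a \<le> 3" "b \<le> 1" for a b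
  proof -
    have dvd: "int p ^ a dvd int p ^ 3" "(2::int) ^ b dvd 2"
      using ab le_imp_power_dvd[of b 1 "2::int"] by (simp_all add: le_imp_power_dvd)
    have "(1, 1) \<in> generate (Z_p3_2 p) S"
      using p by (simp add: assms(4) Z box_def power_strict_increasing)
    then have "red (int p ^ a) (2 ^ b) (1, 1) = (0, 0)"
      using generate_subset_red_eq_0[OF p(1) S(2) _ dvd] triv by blast
    then have "int p ^ a dvd 1" "(2::int) ^ b dvd 1" by (auto simp: red_def)
    then have "is_unit (int p) \<or> a = 0" "is_unit (2::int) \<or> b = 0"
      unfolding is_unit_power_iff by simp_all
    then have "a = 0" "b = 0" using p by simp_all
    then show False using ab by simp
  qed
  show ?thesis
    unfolding code Z
  proof
    assume T: "tiles (int p ^ 3) 2 ?S (\<lambda>s. s) C (\<lambda>c. c)"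
    have "factorization (int p ^ 3) (2 ^ 1) ?S C"
      using T S C p(1) by (auto simp: factorization_def box_def)
    then obtain ls where "tower (int p) ((3, 1) # ls) ?S C \<or> tower (int p) ((3, 1) # ls) C ?S"
      using factorization_tower[OF assms(1) p(2)] by blast
    then show "listed_pair p ?S C"
    proof
      assume t: "tower (int p) ((3, 1) # ls) ?S C"
      note ls = descending_3_1[OF tower_descending[OF t]]
      have "length ((3, 1) # ls) \<ge> 2" using ls by auto
      then obtain a b where ab: "(a, b) \<noteq> (0, 0)" "a \<le> 3" "b \<le> 1"
        "\<forall>z\<in>(if even (length ((3, 1) # ls)) then C else ?S). red (int p ^ a) (2 ^ b) z = (0, 0)"
        using tower_bottom[OF t] p(1) by auto
      have "even (length ((3, 1) # ls))"
      proof (rule ccontr)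
        assume "\<not> ?thesis"
        then have "\<forall>z\<in>?S. red (int p ^ a) (2 ^ b) z = (0, 0)" using ab(4) by simp
        then show False using no_proper_reduction ab(1,2,3) by blast
      qed
      \<comment> \<open>The chain with a single step is excluded because it would make \<open>S\<close> contain all nonzero elements.\<close>
      moreover have "ls \<noteq> [(0, 0)]"
      proof
        assume "ls = [(0, 0)]"
        then have "?S = box (int p ^ 3) 2"
          using t by (auto simp: lift_full_def red_def)
        then show False using S(1) by auto
      qed
      ultimately have "ls \<in> {[(2, 1), (1, 0), (0, 0)],
          [(3, 0), (1, 0), (0, 0)],
          [(2, 1), (0, 1), (0, 0)],
          [(2, 1), (2, 0), (0, 0)],
          [(1, 1), (1, 0), (0, 0)],
          [(3, 0), (2, 0), (0, 0)],
          [(2, 1), (1, 1), (0, 0)],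
          [(2, 0), (1, 0), (0, 0)],
          [(1, 1), (0, 1), (0, 0)]}"
        using ls by (elim insertE emptyE; hypsubst; simp)
      then show ?thesis
        using t by (elim insertE emptyE; hypsubst; elim tower_imp_pairs[OF p(1) assms(2)])
    next
      assume t: "tower (int p) ((3, 1) # ls) C ?S"
      note ls = descending_3_1[OF tower_descending[OF t]]
      have "length ((3, 1) # ls) \<ge> 2" using ls by auto
      then obtain a b where ab: "(a, b) \<noteq> (0, 0)" "a \<le> 3" "b \<le> 1"
        "\<forall>z\<in>(if even (length ((3, 1) # ls)) then ?S else C). red (int p ^ a) (2 ^ b) z = (0, 0)"
        using tower_bottom[OF t] p(1) by auto
      have "odd (length ((3, 1) # ls))"
      proof (rule ccontr)
        assume "\<not> ?thesis"
        then have "\<forall>z\<in>?S. red (int p ^ a) (2 ^ b) z = (0, 0)" using ab(4) by simp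
        then show False using no_proper_reduction ab(1,2,3) by blast
      qed
      then have "ls \<in> {[(1, 0), (0, 0)],
          [(0, 1), (0, 0)],
          [(2, 0), (0, 0)],
          [(1, 1), (0, 0)],
          [(3, 0), (0, 0)],
          [(2, 1), (0, 0)],
          [(3, 0), (2, 0), (1, 0), (0, 0)],
          [(2, 1), (1, 1), (1, 0), (0, 0)],
          [(2, 1), (2, 0), (1, 0), (0, 0)],
          [(2, 1), (1, 1), (0, 1), (0, 0)]}"
        using ls by (elim insertE emptyE; hypsubst; simp)
      then show ?thesis
        using t by (elim insertE emptyE; hypsubst; elim tower_imp_pairs[OF p(1) assms(2)])
    qed
  next
    assume "listed_pair p ?S C"
    then show "tiles (int p ^ 3) 2 ?S (\<lambda>s. s) C (\<lambda>c. c)"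
      by (rule listed_pair_tiles[OF _ p(1)])
  qed
qed

end
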